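(* Let $d\ge 2$ be an integer, let $\phi\in\mathcal O(\mathbb D^d,\mathbb D^d)\cap\mathcal C^1(\overline{\mathbb D}^d)$ and let $\beta>d-3$ be real. Then $C_\phi:A^2_\beta(\mathbb D^d)\to A^2_\beta(\mathbb D^d)$ is compact if and only if for all $j\in\{1,\dots,d\}$, $\phi(\overline{\mathbb D}^d\setminus T_{j+1,d})\cap T_{j,d}=\emptyset$.
   Context: $\mathbb D$ is the open unit disc of $\mathbb C$. $\mathcal O(\mathbb D^d,\mathbb D^d)$ is the set of holomorphic self-maps of $\mathbb D^d$; $\phi\in\mathcal C^1(\overline{\mathbb D}^d)$ means that $\phi$ and its first order partial derivatives extend continuously to $\overline{\mathbb D}^d$ (the extension is still denoted $\phi$). For $1\le j\le d$, $T_{j,d}=\{z\in\overline{\mathbb D}^d:\ \exists I\subset\{1,\dots,d\},\ |I|=j,\ |z_k|=1\ \forall k\in I\}$, and $T_{d+1,d}=\emptyset$. For $\beta>-1$, let $dA_\beta(z)=(\beta+1)(1-|z|^2)^\beta dA(z)$ with $dA$ the normalized area measure on $\mathbb D$, and $dV_\beta(z)=dA_\beta(z_1)\cdots dA_\beta(z_d)$ on $\mathbb D^d$. $A^2_\beta(\mathbb D^d)$ is the space of holomorphic $f:\mathbb D^d\to\mathbb C$ with $\|f\|^2=\int_{\mathbb D^d}|f|^2dV_\beta<\infty$. The composition operator is $C_\phi(f)=f\circ\phi$. *)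

theory Defs
  imports "HOL-Probability.Probability"
begin

definition polydisc :: "(complex ^ 'n) set" where
  "polydisc = {z. \<forall>k. cmod (z $ k) < 1}"

definition cpolydisc :: "(complex ^ 'n) set" where
  "cpolydisc = {z. \<forall>k. cmod (z $ k) \<le> 1}"

text \<open>For \<open>j > CARD('n)\<close> no index set of size \<open>j\<close> exists, so this set is empty.\<close>

definition torus_stratum :: "nat \<Rightarrow> (complex ^ 'n) set" where
  "torus_stratum j =
     {z \<in> cpolydisc. \<exists>I :: 'n set. card I = j \<and> (\<forall>k\<in>I. cmod (z $ k) = 1)}"

text \<open>Holomorphy in several variables as complex Frechet differentiability; meant for open \<open>S\<close>.\<close>

definition holomorphic_several_on :: "(complex ^ 'n \<Rightarrow> complex) \<Rightarrow> (complex ^ 'n) set \<Rightarrow> bool" where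
  "holomorphic_several_on f S \<longleftrightarrow>
     (\<forall>z\<in>S. \<exists>D. (f has_derivative D) (at z) \<and> (\<forall>c v. D (c *s v) = c * D v))"

definition holomorphic_self_map :: "(complex ^ 'n \<Rightarrow> complex ^ 'n) \<Rightarrow> bool" where
  "holomorphic_self_map \<phi> \<longleftrightarrow>
     (\<forall>k. holomorphic_several_on (\<lambda>z. \<phi> z $ k) polydisc) \<and> \<phi> ` polydisc \<subseteq> polydisc"

definition complex_partial :: "'n \<Rightarrow> (complex ^ 'n \<Rightarrow> complex) \<Rightarrow> complex ^ 'n \<Rightarrow> complex" where
  "complex_partial l f z = deriv (\<lambda>w. f (\<chi> k. if k = l then w else z $ k)) (z $ l)"

text \<open>For maps that are holomorphic on the open polydisc. The values of \<open>\<phi>\<close> on the boundary are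
  those of its continuous extension; the partial derivatives only make sense inside, so their
  extensions \<open>g\<close> are separate functions.\<close>

definition C1_closed_polydisc :: "(complex ^ 'n \<Rightarrow> complex ^ 'n) \<Rightarrow> bool" where
  "C1_closed_polydisc \<phi> \<longleftrightarrow>
     continuous_on cpolydisc \<phi> \<and>
     (\<forall>k l. \<exists>g. continuous_on cpolydisc g \<and>
              (\<forall>z\<in>polydisc. g z = complex_partial l (\<lambda>w. \<phi> w $ k) z))"

definition disc_measure :: "real \<Rightarrow> complex measure" where
  "disc_measure \<beta> =
     density lborel (\<lambda>z. ennreal (indicator (ball 0 1) z *
                           ((\<beta> + 1) / pi * (1 - (cmod z)\<^sup>2) powr \<beta>)))"

text \<open>The product measure, transported from functions \<open>'n \<Rightarrow> complex\<close> to vectors.\<close>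

definition polydisc_measure :: "real \<Rightarrow> (complex ^ 'n) measure" where
  "polydisc_measure \<beta> = distr (PiM UNIV (\<lambda>_::'n. disc_measure \<beta>)) borel (\<lambda>x. \<chi> k. x k)"

text \<open>A function on the polydisc is represented by its extension by \<open>0\<close>, so that distinct
  elements of the Bergman space are distinct as functions.\<close>

definition bergman_space :: "real \<Rightarrow> (complex ^ 'n \<Rightarrow> complex) set" where
  "bergman_space \<beta> =
     {f. holomorphic_several_on f polydisc \<and> (\<forall>z. z \<notin> polydisc \<longrightarrow> f z = 0) \<and>
         integrable (polydisc_measure \<beta>) (\<lambda>z. (cmod (f z))\<^sup>2)}"

definition bergman_norm :: "real \<Rightarrow> (complex ^ 'n \<Rightarrow> complex) \<Rightarrow> real" where
  "bergman_norm \<beta> f = sqrt (\<integral>z. (cmod (f z))\<^sup>2 \<partial>polydisc_measure \<beta>)"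

definition composition_operator ::
    "(complex ^ 'n \<Rightarrow> complex ^ 'n) \<Rightarrow> (complex ^ 'n \<Rightarrow> complex) \<Rightarrow> complex ^ 'n \<Rightarrow> complex" where
  "composition_operator \<phi> f = (\<lambda>z. if z \<in> polydisc then f (\<phi> z) else 0)"

text \<open>\<open>A\<close> is a complex vector space of functions with norm \<open>N\<close>; its topology is that of the metric
  \<open>N (f - g)\<close>. A compact operator is a linear \<open>T\<close> from \<open>A\<close> to \<open>A\<close> under which the image of the
  unit ball is relatively compact.\<close>

definition norm_topology :: "('a \<Rightarrow> complex) set \<Rightarrow> (('a \<Rightarrow> complex) \<Rightarrow> real) \<Rightarrow> ('a \<Rightarrow> complex) topology"
  where "norm_topology A N = Metric_space.mtopology A (\<lambda>f g. N (\<lambda>z. f z - g z))"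

definition compact_operator ::
    "('a \<Rightarrow> complex) set \<Rightarrow> (('a \<Rightarrow> complex) \<Rightarrow> real) \<Rightarrow>
     (('a \<Rightarrow> complex) \<Rightarrow> ('a \<Rightarrow> complex)) \<Rightarrow> bool" where
  "compact_operator A N T \<longleftrightarrow>
     T ` A \<subseteq> A \<and>
     (\<forall>f\<in>A. \<forall>g\<in>A. \<forall>a b. T (\<lambda>z. a * f z + b * g z) = (\<lambda>z. a * T f z + b * T g z)) \<and>
     compactin (norm_topology A N)
       ((norm_topology A N) closure_of (T ` {f \<in> A. N f \<le> 1}))"

end

theory Submission
  imports Defs "HOL-Complex_Analysis.Complex_Analysis"
begin

text \<open>
  Let \<open>n(z)\<close> be the number of unimodular coordinates of \<open>z\<close>. The boundary condition says that
  \<open>n(\<phi>(z)) < n(z)\<close> whenever \<open>n(\<phi>(z)) > 0\<close>.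

  Necessity: if \<open>0 < n(\<phi>(\<zeta>))\<close> and \<open>n(\<zeta>) \<le> n(\<phi>(\<zeta>))\<close>, move the unimodular coordinates of \<open>\<zeta>\<close> to
  distance \<open>t\<close> from the circle. As \<open>\<phi>\<close> is Lipschitz, normalised powers of Cauchy kernels with
  poles close to \<open>\<phi>(\<zeta>)\<close>, composed with \<open>\<phi>\<close>, have at that point size at least a constant times
  \<open>t powr (-(2 + \<beta>) n(\<phi>(\<zeta>)) / 2)\<close>, while a norm convergent sequence is there
  \<open>o(t powr (-(2 + \<beta>) n(\<zeta>) / 2))\<close>, by the area mean value inequality.

  Sufficiency: by the mean value inequality and Fubini, it is enough that the measure of
  \<open>{w. \<phi>(w) is in a Whitney box around z}\<close> is \<open>o(\<Prod> \<delta>(i) powr (2 + \<beta>))\<close>, where \<open>\<delta>(i) = 1 - |z(i)|\<close>.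
  Near \<open>\<zeta>\<close> with \<open>J = {i. |\<phi>(i)(\<zeta>)| = 1}\<close>, let \<open>S(i)\<close> be the set of \<open>k\<close> with \<open>\<partial>\<phi>(i)/\<partial>z(k) \<noteq> 0\<close> at \<open>\<zeta>\<close>.
  Schwarz-Pick gives \<open>1 - |w(k)| \<lesssim> 1 - |\<phi>(i)(w)|\<close> for \<open>k \<in> S(i)\<close>. Hopf's lemma shows that \<open>\<phi>(i)\<close> is
  still unimodular when the coordinates outside \<open>S(i)\<close> are replaced by \<open>0\<close>, so the condition
  makes \<open>\<Union>(S ` Q)\<close> larger than \<open>Q\<close> for every nonempty \<open>Q \<subseteq> J\<close>. Hence one can assign to the elements
  of \<open>J\<close> distinct coordinates \<open>k\<close> with \<open>1 - |w(k)| \<lesssim> \<delta>(i)\<close> and keep one further coordinate for the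
  index \<open>1\<close> with the smallest \<open>\<delta>\<close>; the latter is confined to a disc of radius \<open>\<lesssim> \<delta>(1)\<close>. The
  measure is therefore at most a constant times \<open>\<delta>(1) powr (2 + \<beta>) * (\<Prod>i\<in>J. \<delta>(i) powr (1 + \<beta>))\<close>, which
  is \<open>o(\<Prod>i\<in>J. \<delta>(i) powr (2 + \<beta>))\<close> because \<open>|J| \<le> d - 1\<close> and \<open>\<beta> > d - 3\<close>.
\<close>

text \<open>The bound \<beta> > d - 3 is the price of the last comparison. The mass divided by the
  target is \<open>\<delta>(1) powr (2 + \<beta>) / (\<Prod>i\<in>J. \<delta>(i))\<close>; as
  \<open>\<delta>(1)\<close> is the smallest, this is at most
  \<open>\<delta>(1) powr (2 + \<beta> - card J)\<close>, an exponent of at least 3 + \<beta> - d.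
  Only one coordinate is confined to a disc. With the other coordinates frozen, one nonzero partial
  derivative inverts one component; several discs at once would call for a nonvanishing minor of the
  Jacobian, which the boundary condition does not supply: for d = 3 two components may both equal
  (z1 + z2 + z3) / 3. The annuli lose one power of \<delta> per index, and the disc regains one
  where it is worth most. That the union of the S(i) is strictly larger than Q is what lets the
  spare coordinate be removed before representatives are chosen. On the boundary neither slices nor
  derivatives of \<phi> are available directly. Every estimate there is a non-strict inequality for
  the dilates r z, r < 1, passed to the limit r = 1.\<close>

no_notation fps_nth (infixl \<open>$\<close> 75)

subsection \<open>Lebesgue measure on the complex plane\<close>

text \<open>Boxes of the plane are products of intervals, and Lebesgue measure is determined by its
  values on boxes. This opens plane integrals to iterated real ones.\<close>

lemma lborel_eq_distr_Complex:
  "distr (lborel \<Otimes>\<^sub>M lborel) borel (\<lambda>(x, y). Complex x y) = (lborel :: complex measure)"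
proof (rule lborel_eqI[symmetric])
  have [measurable]: "(\<lambda>(x, y). Complex x y) \<in> borel_measurable (lborel \<Otimes>\<^sub>M lborel)"
  proof -
    have "(\<lambda>(x, y). Complex x y) \<in> borel_measurable borel"
      unfolding case_prod_unfold Complex_eq by (intro borel_measurable_continuous_onI continuous_intros)
    then show ?thesis by (simp add: lborel_prod)
  qed
  fix l u :: complex
  assume le: "\<And>b. b \<in> Basis \<Longrightarrow> l \<bullet> b \<le> u \<bullet> b"
  have le': "Re l \<le> Re u" "Im l \<le> Im u"
    using le[of 1] le[of \<i>] by (simp_all add: Basis_complex_def)
  have "(\<lambda>(x, y). Complex x y) -` box l u \<inter> space (lborel \<Otimes>\<^sub>M lborel) = {Re l <..< Re u} \<times> {Im l <..< Im u}"
    by (auto simp: in_box_complex_iff space_pair_measure)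
  then have "emeasure (distr (lborel \<Otimes>\<^sub>M lborel) borel (\<lambda>(x, y). Complex x y)) (box l u)
      = emeasure (lborel \<Otimes>\<^sub>M lborel) ({Re l <..< Re u} \<times> {Im l <..< Im u})"
    by (subst emeasure_distr) auto
  also have "\<dots> = ennreal ((Re u - Re l) * (Im u - Im l))"
    using le' by (subst lborel.emeasure_pair_measure_Times) (auto simp: ennreal_mult)
  also have "(Re u - Re l) * (Im u - Im l) = (\<Prod>b\<in>Basis. (u - l) \<bullet> b)"
    by (simp add: Basis_complex_def)
  finally show "emeasure (distr (lborel \<Otimes>\<^sub>M lborel) borel (\<lambda>(x, y). Complex x y)) (box l u)
      = ennreal (\<Prod>b\<in>Basis. (u - l) \<bullet> b)" .
qed simp

lemma measurable_Complex [measurable]: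
  assumes [measurable]: "f \<in> borel_measurable M" "g \<in> borel_measurable M"
  shows "(\<lambda>x. Complex (f x) (g x)) \<in> borel_measurable M"
  unfolding Complex_eq by measurable

lemma nn_integral_complex_iterated:
  fixes f :: "complex \<Rightarrow> ennreal"
  assumes [measurable]: "f \<in> borel_measurable borel"
  shows "(\<integral>\<^sup>+z. f z \<partial>lborel) = (\<integral>\<^sup>+x. \<integral>\<^sup>+y. f (Complex x y) \<partial>lborel \<partial>lborel)" (is ?thesis1)
    and "(\<integral>\<^sup>+z. f z \<partial>lborel) = (\<integral>\<^sup>+y. \<integral>\<^sup>+x. f (Complex x y) \<partial>lborel \<partial>lborel)" (is ?thesis2)
proof -
  have "(\<integral>\<^sup>+z. f z \<partial>lborel) = (\<integral>\<^sup>+z. f z \<partial>distr (lborel \<Otimes>\<^sub>M lborel) borel (\<lambda>(x, y). Complex x y))"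
    by (simp add: lborel_eq_distr_Complex)
  also have "\<dots> = (\<integral>\<^sup>+p. f (Complex (fst p) (snd p)) \<partial>(lborel \<Otimes>\<^sub>M lborel))"
    by (subst nn_integral_distr) (auto simp: case_prod_unfold)
  finally have *: "(\<integral>\<^sup>+z. f z \<partial>lborel) = \<dots>" .
  show ?thesis1
    unfolding * by (subst lborel.nn_integral_fst[symmetric]) auto
  show ?thesis2
    unfolding * by (subst lborel_pair.nn_integral_snd[symmetric]) auto
qed

text \<open>On every horizontal, respectively vertical, line a shear acts as a translation, so
  invariance of the one-dimensional measure is enough.\<close>

lemma nn_integral_shear:
  fixes f :: "complex \<Rightarrow> ennreal"
  assumes [measurable]: "f \<in> borel_measurable borel"
  shows "(\<integral>\<^sup>+z. f (z + of_real (a * Im z)) \<partial>lborel) = (\<integral>\<^sup>+z. f z \<partial>lborel)"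
    and "(\<integral>\<^sup>+z. f (z + \<i> * of_real (a * Re z)) \<partial>lborel) = (\<integral>\<^sup>+z. f z \<partial>lborel)"
proof -
  have "(\<integral>\<^sup>+x. f (Complex x y + of_real (a * y)) \<partial>lborel) = (\<integral>\<^sup>+x. f (Complex x y) \<partial>lborel)" for y
  proof -
    have "Complex x y + of_real (a * y) = Complex (a * y + 1 * x) y" for x
      by (simp add: complex_eq_iff)
    then show ?thesis
      using nn_integral_real_affine[of "\<lambda>x. f (Complex x y)" 1 "a * y"] by simp
  qed
  then show "(\<integral>\<^sup>+z. f (z + of_real (a * Im z)) \<partial>lborel) = (\<integral>\<^sup>+z. f z \<partial>lborel)"
    by (simp add: nn_integral_complex_iterated(2))
  have "(\<integral>\<^sup>+y. f (Complex x y + \<i> * of_real (a * x)) \<partial>lborel) = (\<integral>\<^sup>+y. f (Complex x y) \<partial>lborel)" for x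
  proof -
    have "Complex x y + \<i> * of_real (a * x) = Complex x (a * x + 1 * y)" for y
      by (simp add: complex_eq_iff)
    then show ?thesis
      using nn_integral_real_affine[of "\<lambda>y. f (Complex x y)" 1 "a * x"] by simp
  qed
  then show "(\<integral>\<^sup>+z. f (z + \<i> * of_real (a * Re z)) \<partial>lborel) = (\<integral>\<^sup>+z. f z \<partial>lborel)"
    by (simp add: nn_integral_complex_iterated(1))
qed

text \<open>A rotation by an angle other than \<open>\<pi>\<close> is a product of three shears.\<close>

lemma nn_integral_rotate:
  fixes f :: "complex \<Rightarrow> ennreal"
  assumes f [measurable]: "f \<in> borel_measurable borel" and c: "cmod c = 1"
  shows "(\<integral>\<^sup>+z. f (c * z) \<partial>lborel) = (\<integral>\<^sup>+z. f z \<partial>lborel)"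
proof -
  have *: "(\<integral>\<^sup>+z. f (c * z) \<partial>lborel) = (\<integral>\<^sup>+z. f z \<partial>lborel)"
    if [measurable]: "f \<in> borel_measurable borel" and c: "cmod c = 1" "c \<noteq> -1" for c and f :: "complex \<Rightarrow> ennreal"
  proof -
    \<comment> \<open>\<open>u\<close> and \<open>v\<close> are the cosine and sine of the angle,
      \<open>t\<close> is minus the tangent of half the angle: the outer shears use
      \<open>t\<close>, the middle one \<open>v\<close>, and \<open>1 + t * v = u\<close> matches
      the diagonal of their product.\<close>
    define u v t where "u = Re c" and "v = Im c" and "t = - v / (1 + u)"
    have uv: "u\<^sup>2 + v\<^sup>2 = 1"
      using c cmod_power2[of c] by (simp add: u_def v_def)
    have u: "1 + u \<noteq> 0"
    proof
      assume "1 + u = 0"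
      then have "u = -1" by simp
      then have "v = 0" using uv by simp
      with \<open>u = -1\<close> c(2) show False by (auto simp: u_def v_def complex_eq_iff)
    qed
    have tv: "1 + t * v = u" 
      using u uv by (simp add: t_def field_simps power2_eq_square)
    have "t * (1 + u) = - v" using u by (simp add: t_def)
    then have tt: "t + t * u = - v" by (simp add: algebra_simps)
    have "c * z = ((z + of_real (t * Im z)) + \<i> * of_real (v * Re (z + of_real (t * Im z))))
        + of_real (t * Im ((z + of_real (t * Im z)) + \<i> * of_real (v * Re (z + of_real (t * Im z)))))" for z
    proof -
      have "Re c * Re z - Im c * Im z = (1 + t * v) * Re z + (t + t * (1 + t * v)) * Im z"
        unfolding tv tt by (simp add: u_def v_def)
      moreover have "Re c * Im z + Im c * Re z = (1 + t * v) * Im z + v * Re z"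
        unfolding tv by (simp add: u_def v_def)
      ultimately show ?thesis
        by (simp add: complex_eq_iff) (simp add: algebra_simps)
    qed
    then have "(\<integral>\<^sup>+z. f (c * z) \<partial>lborel) = (\<integral>\<^sup>+z. f (((z + of_real (t * Im z)) + \<i> * of_real (v * Re (z + of_real (t * Im z))))
        + of_real (t * Im ((z + of_real (t * Im z)) + \<i> * of_real (v * Re (z + of_real (t * Im z)))))) \<partial>lborel)"
      by presburger
    also have "\<dots> = (\<integral>\<^sup>+z. f ((z + \<i> * of_real (v * Re z)) + of_real (t * Im (z + \<i> * of_real (v * Re z)))) \<partial>lborel)"
      by (rule nn_integral_shear(1)[of "\<lambda>z. f ((z + \<i> * of_real (v * Re z)) + of_real (t * Im (z + \<i> * of_real (v * Re z))))"]) measurable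
    also have "\<dots> = (\<integral>\<^sup>+z. f (z + of_real (t * Im z)) \<partial>lborel)"
      by (rule nn_integral_shear(2)[of "\<lambda>z. f (z + of_real (t * Im z))"]) measurable
    also have "\<dots> = (\<integral>\<^sup>+z. f z \<partial>lborel)"
      by (rule nn_integral_shear(1)) measurable
    finally show ?thesis .
  qed
  show ?thesis
  proof (cases "c = -1")
    \<comment> \<open>The half turn, where that tangent is infinite, is made of two quarter
      turns.\<close>
    case True
    have "(\<integral>\<^sup>+z. f (c * z) \<partial>lborel) = (\<integral>\<^sup>+z. f (\<i> * (\<i> * z)) \<partial>lborel)"
      by (simp add: True)
    also have "\<dots> = (\<integral>\<^sup>+z. f (\<i> * z) \<partial>lborel)"
      by (rule *[of "\<lambda>z. f (\<i> * z)"]) (auto simp: complex_eq_iff)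
    also have "\<dots> = (\<integral>\<^sup>+z. f z \<partial>lborel)"
      by (rule *) (auto simp: complex_eq_iff)
    finally show ?thesis .
  qed (use * c f in blast)
qed

subsection \<open>Boundary windows of the weighted disc\<close>

lemma disc_measure_sets [simp, measurable_cong]: "sets (disc_measure \<beta>) = sets borel"
  by (simp add: disc_measure_def)

lemma disc_measure_space [simp]: "space (disc_measure \<beta>) = UNIV"
  by (simp add: disc_measure_def)

definition disc_weight :: "real \<Rightarrow> complex \<Rightarrow> real" where
  "disc_weight \<beta> z = indicator (ball 0 1) z * ((\<beta> + 1) / pi * (1 - (cmod z)\<^sup>2) powr \<beta>)"

lemma disc_weight_measurable [measurable]: "disc_weight \<beta> \<in> borel_measurable borel"
proof -
  have [measurable]: "ball (0::complex) 1 \<in> sets borel" by simp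
  show ?thesis unfolding disc_weight_def[abs_def] by measurable
qed

lemma disc_weight_nonneg: "\<beta> > -1 \<Longrightarrow> 0 \<le> disc_weight \<beta> z"
  by (simp add: disc_weight_def)

lemma disc_measure_eq: "disc_measure \<beta> = density lborel (\<lambda>z. ennreal (disc_weight \<beta> z))"
  by (simp add: disc_measure_def disc_weight_def)

lemma nn_integral_powr_Ioc:
  assumes "\<beta> > -1" "s \<ge> 0"
  shows "(\<integral>\<^sup>+u. ennreal (indicator {0<..s} u * u powr \<beta>) \<partial>lborel) = ennreal (s powr (\<beta> + 1) / (\<beta> + 1))"
proof -
  have "((\<lambda>x. x powr \<beta>) has_integral (s powr (\<beta> + 1) / (\<beta> + 1))) {0..s}"
    using has_integral_powr_from_0 assms by blast
  then have "(\<integral>\<^sup>+x\<in>{0..s}. ennreal (x powr \<beta>) \<partial>lborel) = ennreal (s powr (\<beta> + 1) / (\<beta> + 1))"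
    by (intro nn_integral_has_integral_lebesgue') (auto)
  moreover have "(\<integral>\<^sup>+x\<in>{0..s}. ennreal (x powr \<beta>) \<partial>lborel) = (\<integral>\<^sup>+u. ennreal (indicator {0<..s} u * u powr \<beta>) \<partial>lborel)"
    by (intro nn_integral_cong) (auto split: split_indicator)
  ultimately show ?thesis by simp
qed

text \<open>With the imaginary part \<open>y\<close> fixed, let \<open>x1\<close> be the right end
  of the chord. Then \<open>1 - (cmod w)\<^sup>2 = (x1 - x) * (x1 + x)\<close>, and
  \<open>x \<ge> 1/2\<close> keeps \<open>x1 + x\<close> between 1 and 2, so the weight is
  comparable to \<open>(x1 - x) powr \<beta>\<close>, which is integrable up to the circle. The
  values of \<open>y\<close> fill an interval of length \<open>2 * r\<close>.\<close>

lemma right_window_integral: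
  assumes b: "\<beta> > -1" and r: "r > 0" and s: "0 < s"
  shows "(\<integral>\<^sup>+w. ennreal (indicator {w. 1/2 \<le> Re w \<and> cmod (w - a) \<le> r \<and> 0 < 1 - (cmod w)\<^sup>2 \<and> 1 - (cmod w)\<^sup>2 \<le> s} w
            * (1 - (cmod w)\<^sup>2) powr \<beta>) \<partial>lborel)
        \<le> ennreal (2 * r * (2 powr \<bar>\<beta>\<bar> * (s powr (\<beta> + 1) / (\<beta> + 1))))"
proof -
  let ?f = "\<lambda>w. ennreal (indicator {w. 1/2 \<le> Re w \<and> cmod (w - a) \<le> r \<and> 0 < 1 - (cmod w)\<^sup>2 \<and> 1 - (cmod w)\<^sup>2 \<le> s} w
            * (1 - (cmod w)\<^sup>2) powr \<beta>)"
  let ?K = "2 powr \<bar>\<beta>\<bar> * (s powr (\<beta> + 1) / (\<beta> + 1))"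
  have [measurable]: "?f \<in> borel_measurable borel" by measurable
  have K0: "0 \<le> ?K" using b by simp
  have inner: "(\<integral>\<^sup>+x. ?f (Complex x y) \<partial>lborel) \<le> indicator {Im a - r .. Im a + r} y * ennreal ?K" for y
  proof (cases "y \<in> {Im a - r .. Im a + r}")
    case False
    have "?f (Complex x y) = 0" for x
    proof -
      have "\<not> cmod (Complex x y - a) \<le> r"
        using abs_Im_le_cmod[of "Complex x y - a"] False by auto
      then show ?thesis by simp
    qed
    then have "(\<integral>\<^sup>+x. ?f (Complex x y) \<partial>lborel) = 0"
      by (simp only: nn_integral_const mult_zero_left)
    then show ?thesis by (simp only: zero_le)
  next
    case True
    define x1 where "x1 = sqrt (1 - y\<^sup>2)"
    have "?f (Complex x y) \<le> ennreal (2 powr \<bar>\<beta>\<bar>) * ennreal (indicator {0<..s} (x1 - x) * (x1 - x) powr \<beta>)" for x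
    proof (cases "1/2 \<le> x \<and> 0 < 1 - (x\<^sup>2 + y\<^sup>2) \<and> 1 - (x\<^sup>2 + y\<^sup>2) \<le> s")
      case True
      then have "0 < 1 - y\<^sup>2" by (smt (verit) zero_le_power2)
      then have x1: "x1\<^sup>2 = 1 - y\<^sup>2" "0 < x1" by (auto simp: x1_def)
      have "x\<^sup>2 < x1\<^sup>2" using True x1 by simp
      then have xx1: "x < x1" using x1(2) power2_less_imp_less less_imp_le by blast
      have "x1\<^sup>2 \<le> 1" using x1 by simp
      then have x11: "x1 \<le> 1" using x1(2) by (simp add: power_le_one_iff)
      have eq: "1 - (x\<^sup>2 + y\<^sup>2) = (x1 - x) * (x1 + x)"
        using x1 by (simp add: algebra_simps power2_eq_square)
      have sum: "1 \<le> x1 + x" "x1 + x \<le> 2" using True xx1 x11 by auto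
      have m: "(x1 - x) * 1 \<le> (x1 - x) * (x1 + x)"
        using sum xx1 by (intro mult_left_mono) auto
      have ins: "x1 - x \<in> {0<..s}"
        using xx1 True[unfolded eq] order_trans[OF m] by auto
      have "(x1 + x) powr \<beta> \<le> 2 powr \<bar>\<beta>\<bar>"
      proof (cases "\<beta> \<ge> 0")
        case True then show ?thesis using sum by (simp add: powr_mono2)
      next
        case False
        then have "(x1 + x) powr \<beta> \<le> 1" using sum powr_mono[of \<beta> 0 "x1 + x"] by simp
        also have "1 \<le> 2 powr \<bar>\<beta>\<bar>" by (simp add: ge_one_powr_ge_zero)
        finally show ?thesis .
      qed
      then have "(1 - (x\<^sup>2 + y\<^sup>2)) powr \<beta> \<le> (x1 - x) powr \<beta> * 2 powr \<bar>\<beta>\<bar>"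
        unfolding eq using xx1 sum by (simp add: powr_mult mult_left_mono)
      then show ?thesis
        using ins by (simp add: cmod_power2 ennreal_mult[symmetric] mult.commute indicator_def ennreal_leI)
    next
      case False
      then have "?f (Complex x y) = 0"
        by (auto simp: cmod_power2 split: split_indicator)
      then show ?thesis by (simp only: zero_le)
    qed
    then have "(\<integral>\<^sup>+x. ?f (Complex x y) \<partial>lborel) \<le> (\<integral>\<^sup>+x. ennreal (2 powr \<bar>\<beta>\<bar>) * ennreal (indicator {0<..s} (x1 - x) * (x1 - x) powr \<beta>) \<partial>lborel)"
      by (intro nn_integral_mono)
    also have "\<dots> = ennreal (2 powr \<bar>\<beta>\<bar>) * (\<integral>\<^sup>+x. ennreal (indicator {0<..s} (x1 - x) * (x1 - x) powr \<beta>) \<partial>lborel)"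
      by (intro nn_integral_cmult) measurable
    also have "(\<integral>\<^sup>+x. ennreal (indicator {0<..s} (x1 - x) * (x1 - x) powr \<beta>) \<partial>lborel)
        = (\<integral>\<^sup>+u. ennreal (indicator {0<..s} u * u powr \<beta>) \<partial>lborel)"
      using nn_integral_real_affine[of "\<lambda>u. ennreal (indicator {0<..s} u * u powr \<beta>)" "-1" x1] by simp
    also have "\<dots> = ennreal (s powr (\<beta> + 1) / (\<beta> + 1))"
      using nn_integral_powr_Ioc b s by simp
    finally show ?thesis using True b by (simp add: ennreal_mult[symmetric])
  qed
  have "(\<integral>\<^sup>+w. ?f w \<partial>lborel) = (\<integral>\<^sup>+y. \<integral>\<^sup>+x. ?f (Complex x y) \<partial>lborel \<partial>lborel)"
    by (rule nn_integral_complex_iterated(2)) measurable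
  also have "\<dots> \<le> (\<integral>\<^sup>+y. indicator {Im a - r .. Im a + r} y * ennreal ?K \<partial>lborel)"
    by (intro nn_integral_mono inner)
  also have "\<dots> = ennreal (2 * r) * ennreal ?K"
    using r by (subst nn_integral_multc) auto
  also have "\<dots> = ennreal (2 * r * ?K)"
    by (rule ennreal_mult[symmetric]) (use r K0 in auto)
  finally show ?thesis .
qed

text \<open>For \<open>s \<le> 1/4\<close> the real or the imaginary part of \<open>w\<close> has
  modulus at least 1/2, so a rotation by a multiple of the right angle moves \<open>w\<close> into
  the half-plane of \<open>right_window_integral\<close>; the centre \<open>a\<close> rotates
  along.\<close>

lemma disc_measure_window:
  assumes b: "\<beta> > -1"
  shows "\<exists>C>0. \<forall>a r s. r > 0 \<longrightarrow> 0 < s \<longrightarrow> s \<le> 1/4 \<longrightarrow>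
      emeasure (disc_measure \<beta>) {w. cmod (w - a) \<le> r \<and> 1 - (cmod w)\<^sup>2 \<le> s} \<le> ennreal (C * r * s powr (1 + \<beta>))"
proof (intro exI conjI allI impI)
  let ?C = "8 / pi * 2 powr \<bar>\<beta>\<bar>"
  show "?C > 0" by simp
  fix a :: complex and r s :: real
  assume r: "r > 0" and s: "0 < s" "s \<le> 1/4"
  define R where "R = {1, -1, \<i>, -\<i>}"
  have finR: "finite R" "card R = 4" by (auto simp: R_def complex_eq_iff)
  have R1: "cmod c = 1" if "c \<in> R" for c using that by (auto simp: R_def)
  define h where "h c w = ennreal ((\<beta> + 1) / pi) * ennreal (indicator {w. 1/2 \<le> Re w \<and> cmod (w - c * a) \<le> r \<and> 0 < 1 - (cmod w)\<^sup>2 \<and> 1 - (cmod w)\<^sup>2 \<le> s} w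
            * (1 - (cmod w)\<^sup>2) powr \<beta>)" for c w
  have [measurable]: "h c \<in> borel_measurable borel" for c unfolding h_def by measurable
  let ?E = "{w. cmod (w - a) \<le> r \<and> 1 - (cmod w)\<^sup>2 \<le> s}"
  have "ennreal (disc_weight \<beta> w) * indicator ?E w \<le> (\<Sum>c\<in>R. h c (c * w))" for w
  proof (cases "w \<in> ?E \<and> cmod w < 1")
    case True
    have pos: "0 < 1 - (cmod w)\<^sup>2" using True by (simp add: abs_square_less_1)
    have "\<exists>c\<in>R. 1/2 \<le> Re (c * w)"
    proof (rule ccontr)
      assume "\<not> ?thesis"
      then have n: "Re (c * w) < 1/2" if "c \<in> R" for c using that by force
      have "\<bar>Re w\<bar> < 1/2" "\<bar>Im w\<bar> < 1/2"
        using n[of 1] n[of "-1"] n[of \<i>] n[of "-\<i>"] by (auto simp: R_def)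
      then have "(Re w)\<^sup>2 < 1/4" "(Im w)\<^sup>2 < 1/4"
        using power_strict_mono[of "\<bar>Re w\<bar>" "1/2" 2] power_strict_mono[of "\<bar>Im w\<bar>" "1/2" 2]
        by (simp_all add: power_divide)
      then show False using True s by (simp add: cmod_power2)
    qed
    then obtain c where c: "c \<in> R" "1/2 \<le> Re (c * w)" by blast
    have "cmod (c * w - c * a) = cmod (w - a)"
      using R1[OF c(1)] by (simp add: norm_mult right_diff_distrib[symmetric])
    then have "ennreal (disc_weight \<beta> w) * indicator ?E w = h c (c * w)"
      using c True pos R1[OF c(1)] b
      by (simp add: h_def disc_weight_def norm_mult ennreal_mult'[symmetric])
    also have "\<dots> \<le> (\<Sum>c\<in>R. h c (c * w))"
      using finR c by (intro member_le_sum) auto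
    finally show ?thesis .
  qed (auto simp: disc_weight_def)
  then have "(\<integral>\<^sup>+w. ennreal (disc_weight \<beta> w) * indicator ?E w \<partial>lborel) \<le> (\<integral>\<^sup>+w. (\<Sum>c\<in>R. h c (c * w)) \<partial>lborel)"
    by (intro nn_integral_mono)
  also have "\<dots> = (\<Sum>c\<in>R. \<integral>\<^sup>+w. h c (c * w) \<partial>lborel)"
    by (intro nn_integral_sum) measurable
  also have "\<dots> = (\<Sum>c\<in>R. \<integral>\<^sup>+w. h c w \<partial>lborel)"
    by (intro sum.cong refl nn_integral_rotate R1) measurable
  also have "\<dots> \<le> (\<Sum>c\<in>R. ennreal ((\<beta> + 1) / pi) * ennreal (2 * r * (2 powr \<bar>\<beta>\<bar> * (s powr (\<beta> + 1) / (\<beta> + 1)))))"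
    unfolding h_def
    by (intro sum_mono, subst nn_integral_cmult, measurable, intro mult_left_mono right_window_integral b r s, simp)
  also have "\<dots> = ennreal (?C * r * s powr (1 + \<beta>))"
    using finR b r
    by (simp add: ennreal_mult[symmetric] ennreal_of_nat_eq_real_of_nat[symmetric] flip: ennreal_numeral)
       (simp add: field_simps)
  finally show "emeasure (disc_measure \<beta>) ?E \<le> ennreal (?C * r * s powr (1 + \<beta>))"
    by (simp add: disc_measure_eq emeasure_density)
qed

lemma emeasure_disc_measure_outside:
  assumes "A \<in> sets borel"
  shows "emeasure (disc_measure \<beta>) A = emeasure (disc_measure \<beta>) (A \<inter> ball 0 1)"
proof -
  have "emeasure (disc_measure \<beta>) B = (\<integral>\<^sup>+w. ennreal (disc_weight \<beta> w) * indicator B w \<partial>lborel)"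
    if "B \<in> sets borel" for B
    unfolding disc_measure_eq by (rule emeasure_density) (use that in auto)
  moreover have "ennreal (disc_weight \<beta> w) * indicator A w = ennreal (disc_weight \<beta> w) * indicator (A \<inter> ball 0 1) w" for w
    by (auto simp: disc_weight_def split: split_indicator)
  ultimately show ?thesis using assms by simp
qed

text \<open>For negative \<beta> the density is unbounded, so the collar
  \<open>1 - (cmod w)\<^sup>2 \<le> 1/4\<close> is covered by the window estimate. Off the collar
  the density is bounded, with \<open>(1/4) powr (-\<bar>\<beta>\<bar>)\<close> serving both signs
  of \<beta>.\<close>

lemma finite_disc_measure:
  assumes b: "\<beta> > -1"
  shows "finite_measure (disc_measure \<beta>)"
proof
  obtain C where C: "C > 0"
    "\<And>a r s. r > 0 \<Longrightarrow> 0 < s \<Longrightarrow> s \<le> 1/4 \<Longrightarrow>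
      emeasure (disc_measure \<beta>) {w. cmod (w - a) \<le> r \<and> 1 - (cmod w)\<^sup>2 \<le> s} \<le> ennreal (C * r * s powr (1 + \<beta>))"
    using disc_measure_window[OF b] by blast
  let ?A = "{w. cmod (w - 0) \<le> 1 \<and> 1 - (cmod w)\<^sup>2 \<le> 1/4}" and ?B = "{w. cmod w < 1 \<and> 1/4 < 1 - (cmod w)\<^sup>2}"
  define K where "K = (\<beta> + 1) / pi * (1/4) powr (-\<bar>\<beta>\<bar>)"
  have "emeasure (disc_measure \<beta>) ?A \<le> ennreal (C * 1 * (1/4) powr (1 + \<beta>))"
    by (rule C) auto
  then have A: "emeasure (disc_measure \<beta>) ?A < \<infinity>" using le_less_trans ennreal_less_top by fastforce
  have le: "ennreal (disc_weight \<beta> w) * indicator ?B w \<le> ennreal K * indicator (ball 0 1) w" for w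
  proof (cases "w \<in> ?B")
    case True
    have "(1 - (cmod w)\<^sup>2) powr \<beta> \<le> (1/4) powr (-\<bar>\<beta>\<bar>)"
    proof (cases "\<beta> \<ge> 0")
      case T: True
      have "(1 - (cmod w)\<^sup>2) powr \<beta> \<le> 1 powr \<beta>"
        using True T by (intro powr_mono2) auto
      also have "1 powr \<beta> \<le> (1/4) powr (-\<bar>\<beta>\<bar>)" by (simp add: powr_minus_divide powr_divide ge_one_powr_ge_zero)
      finally show ?thesis .
    next
      case False
      then show ?thesis using True by (simp add: powr_mono2')
    qed
    then have "disc_weight \<beta> w \<le> K" using True b
      by (auto simp: disc_weight_def K_def intro!: mult_left_mono divide_right_mono)
    then show ?thesis using True by (simp add: ennreal_leI)
  qed auto
  have eq: "emeasure (disc_measure \<beta>) ?B = (\<integral>\<^sup>+w. ennreal (disc_weight \<beta> w) * indicator ?B w \<partial>lborel)"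
    unfolding disc_measure_eq by (rule emeasure_density) measurable
  have "emeasure (disc_measure \<beta>) ?B \<le> (\<integral>\<^sup>+(w::complex). ennreal K * indicator (ball 0 1) w \<partial>lborel)"
    unfolding eq by (intro nn_integral_mono le)
  also have "\<dots> = ennreal K * emeasure lborel (ball 0 1 :: complex set)"
    by (intro nn_integral_cmult_indicator) simp
  also have "\<dots> < \<infinity>"
    using emeasure_lborel_ball_finite[of "0::complex" 1] by (simp add: ennreal_mult_less_top)
  finally have B: "emeasure (disc_measure \<beta>) ?B < \<infinity>" .
  have "UNIV \<inter> ball (0::complex) 1 \<subseteq> ?A \<union> ?B" by auto
  then have "emeasure (disc_measure \<beta>) UNIV \<le> emeasure (disc_measure \<beta>) (?A \<union> ?B)"
    by (subst emeasure_disc_measure_outside) (auto intro!: emeasure_mono)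
  also have "\<dots> \<le> emeasure (disc_measure \<beta>) ?A + emeasure (disc_measure \<beta>) ?B"
    by (intro emeasure_subadditive) auto
  also have "\<dots> < \<infinity>" using A B by simp
  finally show "emeasure (disc_measure \<beta>) (space (disc_measure \<beta>)) \<noteq> \<infinity>" by simp
qed

text \<open>Beyond radius 1/4 the total mass gives the bound, because
  \<open>(4 * r) powr p \<ge> 1\<close>. The first part is for the spare coordinate, confined to a
  disc at the circle, and for the kernel integrals; the second is for the representatives, confined
  to annuli.\<close>

lemma disc_measure_ball_annulus:
  assumes b: "\<beta> > -1"
  shows "\<exists>C>0. (\<forall>a r. r > 0 \<longrightarrow>
      emeasure (disc_measure \<beta>) {w. cmod (w - a) \<le> r \<and> 1 - (cmod w)\<^sup>2 \<le> r} \<le> ennreal (C * r powr (2 + \<beta>))) \<and>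
    (\<forall>s>0. emeasure (disc_measure \<beta>) {w. 1 - (cmod w)\<^sup>2 \<le> s} \<le> ennreal (C * s powr (1 + \<beta>)))"
proof -
  interpret finite_measure "disc_measure \<beta>" by (rule finite_disc_measure[OF b])
  obtain C where C: "C > 0"
    "\<And>a r s. r > 0 \<Longrightarrow> 0 < s \<Longrightarrow> s \<le> 1/4 \<Longrightarrow>
      emeasure (disc_measure \<beta>) {w. cmod (w - a) \<le> r \<and> 1 - (cmod w)\<^sup>2 \<le> s} \<le> ennreal (C * r * s powr (1 + \<beta>))"
    using disc_measure_window[OF b] by blast
  define K where "K = measure (disc_measure \<beta>) UNIV * 4 powr (2 + \<beta>)"
  have K: "emeasure (disc_measure \<beta>) A \<le> ennreal (K * r powr p)" if "1/4 < r" "0 \<le> p" "p \<le> 2 + \<beta>" for A r p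
  proof -
    have "1 \<le> (4 * r) powr p" using that by (intro ge_one_powr_ge_zero) auto
    also have "\<dots> = 4 powr p * r powr p" using that by (simp add: powr_mult)
    also have "\<dots> \<le> 4 powr (2 + \<beta>) * r powr p" using that by (intro mult_right_mono powr_mono) auto
    finally have "measure (disc_measure \<beta>) UNIV * 1 \<le> K * r powr p"
      unfolding K_def by (simp only: mult.assoc) (intro mult_left_mono, auto)
    moreover have "emeasure (disc_measure \<beta>) A \<le> emeasure (disc_measure \<beta>) UNIV"
      by (metis emeasure_space disc_measure_space)
    ultimately show ?thesis
      unfolding emeasure_eq_measure by (metis dual_order.trans ennreal_leI mult.right_neutral)
  qed
  have K0: "K \<ge> 0" by (simp add: K_def)
  show ?thesis
  proof (intro exI conjI allI impI)
    show "C + K > 0 " using C K0 by simp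
    fix a :: complex and r :: real assume r: "r > 0"
    show "emeasure (disc_measure \<beta>) {w. cmod (w - a) \<le> r \<and> 1 - (cmod w)\<^sup>2 \<le> r} \<le> ennreal ((C + K) * r powr (2 + \<beta>))"
    proof (cases "r \<le> 1/4")
      case True
      have "r * r powr (1 + \<beta>) = r powr (2 + \<beta>)" using r
        by (metis add.assoc one_add_one powr_add powr_one less_imp_le)
      then have "emeasure (disc_measure \<beta>) {w. cmod (w - a) \<le> r \<and> 1 - (cmod w)\<^sup>2 \<le> r} \<le> ennreal (C * r powr (2 + \<beta>))"
        using C(2)[OF r r True, of a] by (simp add: mult.assoc)
      also have "\<dots> \<le> ennreal ((C + K) * r powr (2 + \<beta>))"
        using K0 by (intro ennreal_leI mult_right_mono) auto
      finally show ?thesis .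
    next
      case False
      then have "emeasure (disc_measure \<beta>) {w. cmod (w - a) \<le> r \<and> 1 - (cmod w)\<^sup>2 \<le> r} \<le> ennreal (K * r powr (2 + \<beta>))"
        using b by (intro K) auto
      also have "\<dots> \<le> ennreal ((C + K) * r powr (2 + \<beta>))"
        using C by (intro ennreal_leI mult_right_mono) auto
      finally show ?thesis .
    qed
  next
    fix s :: real assume s: "s > 0"
    show "emeasure (disc_measure \<beta>) {w. 1 - (cmod w)\<^sup>2 \<le> s} \<le> ennreal ((C + K) * s powr (1 + \<beta>))"
    proof (cases "s \<le> 1/4")
      case True
      have "emeasure (disc_measure \<beta>) {w. 1 - (cmod w)\<^sup>2 \<le> s}
          = emeasure (disc_measure \<beta>) ({w. 1 - (cmod w)\<^sup>2 \<le> s} \<inter> ball 0 1)"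
        by (rule emeasure_disc_measure_outside) measurable
      also have "\<dots> \<le> emeasure (disc_measure \<beta>) {w. cmod (w - 0) \<le> 1 \<and> 1 - (cmod w)\<^sup>2 \<le> s}"
        by (intro emeasure_mono) auto
      also have "\<dots> \<le> ennreal (C * 1 * s powr (1 + \<beta>))" using s True by (intro C) auto
      also have "\<dots> \<le> ennreal ((C + K) * s powr (1 + \<beta>))"
        using K0 by (intro ennreal_leI mult_right_mono) auto
      finally show ?thesis .
    next
      case False
      then have "emeasure (disc_measure \<beta>) {w. 1 - (cmod w)\<^sup>2 \<le> s} \<le> ennreal (K * s powr (1 + \<beta>))"
        using b by (intro K) auto
      also have "\<dots> \<le> ennreal ((C + K) * s powr (1 + \<beta>))"
        using C by (intro ennreal_leI mult_right_mono) auto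
      finally show ?thesis .
    qed
  qed
qed

lemma AE_disc_measure: "AE z in disc_measure \<beta>. cmod z < 1"
proof -
  have "AE z in lborel. 0 < ennreal (disc_weight \<beta> z) \<longrightarrow> cmod z < 1"
    by (intro AE_I2) (auto simp: disc_weight_def simp del: times_divide_eq_left split: split_indicator_asm)
  then show ?thesis
    unfolding disc_measure_eq by (subst AE_density) (auto simp: field_simps)
qed

text \<open>The denominator is at least the larger of \<open>t\<close> and
  \<open>cmod (z - \<xi>)\<close>. Discs around \<xi> of radii doubling from \<open>2 * t\<close>
  exhaust the unit disc, and the \<open>n\<close>-th contributes a constant times
  \<open>r n powr (-\<gamma>)\<close>: a geometric series of ratio
  \<open>2 powr (-\<gamma>)\<close>, convergent since the condition on \<open>N\<close> says
  \<gamma> > 0.\<close>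

lemma nn_integral_kernel_bound:
  assumes b: "\<beta> > -1" and N: "2 + \<beta> < 2 * real N"
  shows "\<exists>C>0. \<forall>\<xi> t. cmod \<xi> = 1 \<longrightarrow> 0 < t \<longrightarrow>
    (\<integral>\<^sup>+z. ennreal (1 / cmod (1 + of_real t - cnj \<xi> * z) ^ (2 * N)) \<partial>disc_measure \<beta>)
      \<le> ennreal (C * t powr (2 + \<beta> - 2 * real N))"
proof -
  obtain C where C: "C > 0" "\<And>a r. r > 0 \<Longrightarrow>
      emeasure (disc_measure \<beta>) {w. cmod (w - a) \<le> r \<and> 1 - (cmod w)\<^sup>2 \<le> r} \<le> ennreal (C * r powr (2 + \<beta>))"
    using disc_measure_ball_annulus[OF b] by blast
  define \<gamma> where "\<gamma> = 2 * real N - 2 - \<beta>"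
  have \<gamma>: "\<gamma> > 0" using N by (simp add: \<gamma>_def)
  define q where "q = 2 powr (-\<gamma>)"
  have q: "0 < q" "q < 1" using \<gamma> by (auto simp: q_def powr_less_one)
  define D where "D = 4 ^ (2 * N) * C * 2 powr (-\<gamma>) * (1 / (1 - q))"
  have "(\<integral>\<^sup>+z. ennreal (1 / cmod (1 + of_real t - cnj \<xi> * z) ^ (2 * N)) \<partial>disc_measure \<beta>)
      \<le> ennreal (D * t powr (2 + \<beta> - 2 * real N))" if \<xi>: "cmod \<xi> = 1" and t: "0 < t" for \<xi> t
  proof -
    \<comment> \<open>The exponent \<open>n + 1\<close> pays for the factor 2 in
      \<open>1 - (cmod z)\<^sup>2 \<le> 2 * cmod (z - \<xi>)\<close>, so that a point at distance at
      most \<open>2 ^ n * t\<close> from \<xi> lies in \<open>E n\<close>.\<close>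
    define r where "r n = 2 ^ (n + 1) * t" for n :: nat
    have r: "r n > 0" for n using t by (simp add: r_def)
    define E where "E n = {w. cmod (w - \<xi>) \<le> r n \<and> 1 - (cmod w)\<^sup>2 \<le> r n}" for n
    have [measurable]: "E n \<in> sets borel" for n unfolding E_def by measurable
    have le: "ennreal (1 / cmod (1 + of_real t - cnj \<xi> * z) ^ (2 * N)) \<le> (\<Sum>n. ennreal ((4 / r n) ^ (2 * N)) * indicator (E n) z)"
      if z: "cmod z < 1" for z
    proof -
      define k where "k = cmod (1 + of_real t - cnj \<xi> * z)"
      define u where "u = 1 - cnj \<xi> * z"
      have "cmod u = cmod (cnj \<xi> * (\<xi> - z))"
        using \<xi> by (simp add: u_def algebra_simps complex_norm_square[symmetric])
      then have cu: "cmod u = cmod (z - \<xi>)"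
        using \<xi> by (simp add: norm_mult norm_minus_commute)
      have "Re (cnj \<xi> * z) \<le> cmod (cnj \<xi> * z)" by (rule complex_Re_le_cmod)
      also have "\<dots> \<le> 1" using \<xi> z by (simp add: norm_mult)
      finally have Reu: "0 \<le> Re u" by (simp add: u_def)
      have ku: "k = cmod (u + of_real t)" by (simp add: k_def u_def algebra_simps)
      have "t \<le> Re (u + of_real t)" using Reu by simp
      also have "\<dots> \<le> k" unfolding ku by (rule complex_Re_le_cmod)
      finally have kt: "t \<le> k" .
      have "(cmod u)\<^sup>2 \<le> k\<^sup>2"
        unfolding ku cmod_power2 using Reu t by (simp add: power_mono)
      then have kz: "cmod (z - \<xi>) \<le> k"
        unfolding cu[symmetric] by (rule power2_le_imp_le) (use kt t in auto)
      obtain m where "cmod (z - \<xi>) / t < 2 ^ m"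
        using real_arch_pow[of 2 "cmod (z - \<xi>) / t"] by auto
      then have "cmod (z - \<xi>) \<le> 2 ^ m * t" using t by (simp add: field_simps)
      then have ex: "\<exists>m. cmod (z - \<xi>) \<le> 2 ^ m * t" by blast
      \<comment> \<open>Minimality bounds the denominator below by \<open>r n / 4\<close>; for
        \<open>n = 0\<close> the bound \<open>t \<le> k\<close> takes its place.\<close>
      define n where "n = (LEAST m. cmod (z - \<xi>) \<le> 2 ^ m * t)"
      have n: "cmod (z - \<xi>) \<le> 2 ^ n * t" unfolding n_def using ex by (rule LeastI_ex)
      have rk: "r n / 4 \<le> k"
      proof (cases n)
        case 0
        then show ?thesis using kt t by (simp add: r_def)
      next
        case (Suc j)
        then have "\<not> cmod (z - \<xi>) \<le> 2 ^ j * t"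
          using not_less_Least[of j "\<lambda>m. cmod (z - \<xi>) \<le> 2 ^ m * t"] by (simp add: n_def)
        then show ?thesis using kz Suc by (simp add: r_def)
      qed
      have "1 / k \<le> 4 / r n" using rk r[of n] by (simp add: field_simps)
      then have "(1 / k) ^ (2 * N) \<le> (4 / r n) ^ (2 * N)"
        using kt t by (intro power_mono) auto
      then have val: "1 / k ^ (2 * N) \<le> (4 / r n) ^ (2 * N)" by (simp add: power_one_over)
      have "1 - cmod z \<le> cmod (z - \<xi>)"
        using norm_triangle_ineq2[of \<xi> z] \<xi> by (simp add: norm_minus_commute)
      moreover have "1 - (cmod z)\<^sup>2 = (1 + cmod z) * (1 - cmod z)"
        by (simp add: power2_eq_square algebra_simps)
      moreover have "(1 + cmod z) * (1 - cmod z) \<le> 2 * (1 - cmod z)"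
        using z by (intro mult_right_mono) auto
      ultimately have "1 - (cmod z)\<^sup>2 \<le> r n" using n by (simp add: r_def)
      moreover have "cmod (z - \<xi>) \<le> r n" using n t zero_le_power[of "2::real" n]
        by (auto simp: r_def intro: order_trans)
      ultimately have "z \<in> E n" by (simp add: E_def)
      then have "ennreal (1 / k ^ (2 * N)) \<le> ennreal ((4 / r n) ^ (2 * N)) * indicator (E n) z"
        using val by (simp add: ennreal_leI)
      also have "\<dots> \<le> (\<Sum>n. ennreal ((4 / r n) ^ (2 * N)) * indicator (E n) z)"
      proof -
        define f where "f n = ennreal ((4 / r n) ^ (2 * N)) * indicator (E n) z" for n
        have "(\<Sum>i\<in>{n}. f i) \<le> suminf f" by (intro sum_le_suminf summableI) auto
        then show ?thesis unfolding f_def by (simp only: sum.insert sum.empty finite.emptyI empty_iff not_False_eq_True add_0_right)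
      qed
      finally show ?thesis by (simp add: k_def)
    qed
    have "(\<integral>\<^sup>+z. ennreal (1 / cmod (1 + of_real t - cnj \<xi> * z) ^ (2 * N)) \<partial>disc_measure \<beta>)
        \<le> (\<integral>\<^sup>+z. (\<Sum>n. ennreal ((4 / r n) ^ (2 * N)) * indicator (E n) z) \<partial>disc_measure \<beta>)"
      by (rule nn_integral_mono_AE, rule AE_mp[OF AE_disc_measure], intro AE_I2 impI le)
    also have "\<dots> = (\<Sum>n. \<integral>\<^sup>+z. ennreal ((4 / r n) ^ (2 * N)) * indicator (E n) z \<partial>disc_measure \<beta>)"
      by (intro nn_integral_suminf) measurable
    also have "\<dots> = (\<Sum>n. ennreal ((4 / r n) ^ (2 * N)) * emeasure (disc_measure \<beta>) (E n))"
      by (intro suminf_cong nn_integral_cmult_indicator) simp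
    also have "\<dots> \<le> (\<Sum>n. ennreal (4 ^ (2 * N) * C * (2 * t) powr (-\<gamma>) * q ^ n))"
    proof (intro suminf_le summableI)
      fix n
      have "r n powr (2 * real N) = r n ^ (2 * N)"
        using r[of n] powr_realpow[of "r n" "2 * N"] by simp
      then have "(4 / r n) ^ (2 * N) * r n powr (2 + \<beta>) = 4 ^ (2 * N) * (r n powr (2 + \<beta>) / r n powr (2 * real N))"
        by (simp add: power_divide)
      also have "r n powr (2 + \<beta>) / r n powr (2 * real N) = r n powr (-\<gamma>)"
        by (simp add: powr_diff[symmetric] \<gamma>_def algebra_simps)
      also have "r n powr (-\<gamma>) = (2 * t) powr (-\<gamma>) * q ^ n"
      proof -
        have "(2 ^ n) powr (-\<gamma>) = q ^ n"
          by (simp add: q_def powr_realpow[symmetric] powr_powr mult.commute)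
        moreover have "r n = (2 * t) * 2 ^ n" by (simp add: r_def)
        ultimately show ?thesis using t by (simp only: powr_mult)
      qed
      finally have eq: "(4 / r n) ^ (2 * N) * (C * r n powr (2 + \<beta>)) = 4 ^ (2 * N) * C * (2 * t) powr (-\<gamma>) * q ^ n"
        by (simp add: mult_ac)
      have "ennreal ((4 / r n) ^ (2 * N)) * emeasure (disc_measure \<beta>) (E n)
          \<le> ennreal ((4 / r n) ^ (2 * N)) * ennreal (C * r n powr (2 + \<beta>))"
        unfolding E_def by (intro mult_left_mono C r) auto
      also have "\<dots> = ennreal (4 ^ (2 * N) * C * (2 * t) powr (-\<gamma>) * q ^ n)"
        unfolding eq[symmetric] using r[of n] C by (intro ennreal_mult[symmetric]) auto
      finally show "ennreal ((4 / r n) ^ (2 * N)) * emeasure (disc_measure \<beta>) (E n)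
          \<le> ennreal (4 ^ (2 * N) * C * (2 * t) powr (-\<gamma>) * q ^ n)" .
    qed
    also have "\<dots> = ennreal (4 ^ (2 * N) * C * (2 * t) powr (-\<gamma>) * (1 / (1 - q)))"
      using q C by (intro suminf_ennreal_eq sums_mult geometric_sums) auto
    also have "4 ^ (2 * N) * C * (2 * t) powr (-\<gamma>) * (1 / (1 - q)) = D * t powr (2 + \<beta> - 2 * real N)"
      using t by (simp add: D_def powr_mult \<gamma>_def algebra_simps)
    finally show ?thesis .
  qed
  moreover have "D > 0" using C q by (simp add: D_def)
  ultimately show ?thesis by blast
qed

subsection \<open>The weighted measure on the polydisc\<close>

lemma borel_measurable_vec_lambda [measurable]:
  fixes f :: "'n::finite \<Rightarrow> 'a \<Rightarrow> complex"
  assumes [measurable]: "\<And>k. f k \<in> borel_measurable M"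
  shows "(\<lambda>x. \<chi> k. f k x) \<in> borel_measurable M"
proof (subst borel_measurable_euclidean_space, rule ballI)
  fix b :: "complex ^ 'n" assume "b \<in> Basis"
  then obtain k u where b: "b = axis k u" by (auto simp: Basis_vec_def)
  have "(\<lambda>x. (\<chi> k. f k x) \<bullet> b) = (\<lambda>x. f k x \<bullet> u)"
    by (simp add: b inner_axis)
  then show "(\<lambda>x. (\<chi> k. f k x) \<bullet> b) \<in> borel_measurable M" by simp
qed

lemma borel_measurable_vec_nth [measurable]:
  fixes f :: "'a \<Rightarrow> complex ^ 'n"
  assumes [measurable]: "f \<in> borel_measurable M"
  shows "(\<lambda>x. f x $ k) \<in> borel_measurable M"
proof -
  have "(\<lambda>z::complex ^ 'n. z $ k) \<in> borel_measurable borel"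
    by (intro borel_measurable_continuous_onI continuous_intros)
  from measurable_compose[OF assms this] show ?thesis .
qed

lemma product_sigma_finite_disc_measure:
  "\<beta> > -1 \<Longrightarrow> product_sigma_finite (\<lambda>_. disc_measure \<beta>)"
  by (simp add: product_sigma_finite_def finite_measure.sigma_finite_measure finite_disc_measure)

lemma product_sigma_finite_lborel_const:
  "product_sigma_finite (\<lambda>_. lborel :: 'a::euclidean_space measure)"
  by unfold_locales

lemma space_polydisc_measure [simp]: "space (polydisc_measure \<beta>) = UNIV"
  by (simp add: polydisc_measure_def)

lemma sets_polydisc_measure [simp, measurable_cong]: "sets (polydisc_measure \<beta>) = sets borel"
  by (simp add: polydisc_measure_def)

lemma sets_PiM_disc_measure [measurable_cong]:
  "sets (PiM I (\<lambda>_. disc_measure \<beta>)) = sets (PiM I (\<lambda>_. borel))"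
  by (intro sets_PiM_cong) auto

lemma sets_PiM_lborel [measurable_cong]:
  "sets (PiM I (\<lambda>_. lborel)) = sets (PiM I (\<lambda>_. borel))"
  by (intro sets_PiM_cong) auto

lemma nn_integral_polydisc_measure:
  fixes h :: "complex ^ 'n \<Rightarrow> ennreal"
  assumes [measurable]: "h \<in> borel_measurable borel"
  shows "(\<integral>\<^sup>+z. h z \<partial>polydisc_measure \<beta>) = (\<integral>\<^sup>+x. h (\<chi> k. x k) \<partial>PiM UNIV (\<lambda>_. disc_measure \<beta>))"
  unfolding polydisc_measure_def by (subst nn_integral_distr) auto

lemma nn_integral_polydisc_prod:
  fixes f :: "'n::finite \<Rightarrow> complex \<Rightarrow> ennreal"
  assumes b: "\<beta> > -1" and [measurable]: "\<And>k. f k \<in> borel_measurable borel"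
  shows "(\<integral>\<^sup>+z. (\<Prod>k\<in>UNIV. f k (z $ k)) \<partial>polydisc_measure \<beta>) = (\<Prod>k\<in>UNIV. \<integral>\<^sup>+z. f k z \<partial>disc_measure \<beta>)"
proof -
  interpret product_sigma_finite "\<lambda>_::'n. disc_measure \<beta>" by (rule product_sigma_finite_disc_measure[OF b])
  show ?thesis
    by (subst nn_integral_polydisc_measure, measurable) (simp add: product_nn_integral_prod)
qed

lemma emeasure_polydisc_box:
  fixes A :: "'n::finite \<Rightarrow> complex set"
  assumes b: "\<beta> > -1" and [measurable]: "\<And>k. A k \<in> sets borel"
  shows "emeasure (polydisc_measure \<beta>) {z. \<forall>k. z $ k \<in> A k} = (\<Prod>k\<in>UNIV. emeasure (disc_measure \<beta>) (A k))"
proof -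
  have [measurable]: "{z::complex^'n. \<forall>k. z $ k \<in> A k} \<in> sets borel" by measurable
  have "emeasure (polydisc_measure \<beta>) {z. \<forall>k. z $ k \<in> A k}
      = (\<integral>\<^sup>+z. indicator {z. \<forall>k. z $ k \<in> A k} z \<partial>polydisc_measure \<beta>)"
    by simp
  also have "\<dots> = (\<integral>\<^sup>+z. (\<Prod>k\<in>UNIV. indicator (A k) (z $ k)) \<partial>polydisc_measure \<beta>)"
    by (intro nn_integral_cong) (auto simp: indicator_def prod_zero_iff)
  also have "\<dots> = (\<Prod>k\<in>UNIV. \<integral>\<^sup>+z. indicator (A k) z \<partial>disc_measure \<beta>)"
    by (intro nn_integral_polydisc_prod b) measurable
  finally show ?thesis by simp
qed

lemma finite_polydisc_measure:
  assumes b: "\<beta> > -1"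
  shows "finite_measure (polydisc_measure \<beta> :: (complex ^ 'n) measure)"
proof
  interpret finite_measure "disc_measure \<beta>" by (rule finite_disc_measure[OF b])
  have "emeasure (polydisc_measure \<beta>) (UNIV :: (complex ^ 'n) set) = (\<Prod>k\<in>(UNIV::'n set). emeasure (disc_measure \<beta>) UNIV)"
    using emeasure_polydisc_box[OF b, of "\<lambda>_. UNIV"] by simp
  also have "\<dots> < \<infinity>" by (simp add: emeasure_eq_measure ennreal_power)
  finally show "emeasure (polydisc_measure \<beta>) (space (polydisc_measure \<beta> :: (complex ^ 'n) measure)) \<noteq> \<infinity>" by simp
qed

text \<open>The mean value argument needs a measure invariant under rotations about arbitrary
  centres, hence unweighted Lebesgue measure; passing to a density brings its result back to the
  weighted measure.\<close>

lemma nn_integral_polydisc_lborel: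
  fixes h :: "complex ^ 'n \<Rightarrow> ennreal"
  assumes b: "\<beta> > -1" and [measurable]: "h \<in> borel_measurable borel"
  shows "(\<integral>\<^sup>+z. h z \<partial>polydisc_measure \<beta>)
      = (\<integral>\<^sup>+x. ennreal (\<Prod>k\<in>UNIV. disc_weight \<beta> (x k)) * h (\<chi> k. x k) \<partial>PiM UNIV (\<lambda>_. lborel))"
proof -
  interpret D: product_sigma_finite "\<lambda>_::'n. disc_measure \<beta>" by (rule product_sigma_finite_disc_measure[OF b])
  interpret L: product_sigma_finite "\<lambda>_::'n. lborel :: complex measure" by (rule product_sigma_finite_lborel_const)
  let ?w = "\<lambda>x. ennreal (\<Prod>k\<in>(UNIV::'n set). disc_weight \<beta> (x k))"
  let ?L = "PiM (UNIV::'n set) (\<lambda>_. lborel :: complex measure)"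
  have w: "?w x = (\<Prod>k\<in>UNIV. ennreal (disc_weight \<beta> (x k)))" for x
    by (simp add: prod_ennreal disc_weight_nonneg[OF b])
  have "density ?L ?w = PiM UNIV (\<lambda>_. disc_measure \<beta>)"
  proof (rule D.PiM_eqI)
    show "sets (density ?L ?w) = sets (PiM UNIV (\<lambda>_. disc_measure \<beta>))"
      by (simp add: sets_PiM_disc_measure sets_PiM_lborel)
    fix A :: "'n \<Rightarrow> complex set" assume "\<And>i. i \<in> UNIV \<Longrightarrow> A i \<in> sets (disc_measure \<beta>)"
    then have [measurable]: "A i \<in> sets borel" for i by simp
    have "emeasure (density ?L ?w) (Pi\<^sub>E UNIV A) = (\<integral>\<^sup>+x. ?w x * indicator (Pi\<^sub>E UNIV A) x \<partial>?L)"
      by (rule emeasure_density) auto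
    also have "\<dots> = (\<integral>\<^sup>+x. (\<Prod>k\<in>UNIV. ennreal (disc_weight \<beta> (x k)) * indicator (A k) (x k)) \<partial>?L)"
      by (intro nn_integral_cong) (auto simp: w indicator_def prod_zero_iff prod.distrib PiE_def Pi_def)
    also have "\<dots> = (\<Prod>k\<in>UNIV. \<integral>\<^sup>+x. ennreal (disc_weight \<beta> x) * indicator (A k) x \<partial>lborel)"
      by (intro L.product_nn_integral_prod) auto
    also have "\<dots> = (\<Prod>k\<in>UNIV. emeasure (disc_measure \<beta>) (A k))"
      unfolding disc_measure_eq by (intro prod.cong refl emeasure_density[symmetric]) auto
    finally show "emeasure (density ?L ?w) (Pi\<^sub>E UNIV A) = (\<Prod>k\<in>UNIV. emeasure (disc_measure \<beta>) (A k))" .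
  qed simp
  then have "(\<integral>\<^sup>+x. h (\<chi> k. x k) \<partial>PiM UNIV (\<lambda>_. disc_measure \<beta>)) = (\<integral>\<^sup>+x. h (\<chi> k. x k) \<partial>density ?L ?w)" by simp
  also have "\<dots> = (\<integral>\<^sup>+x. ?w x * h (\<chi> k. x k) \<partial>?L)"
    by (intro nn_integral_density) auto
  finally show ?thesis by (simp add: nn_integral_polydisc_measure)
qed

lemma open_polydisc [simp]: "open (polydisc :: (complex ^ 'n) set)"
proof -
  have "polydisc = (\<Inter>k\<in>UNIV. {z::complex^'n. cmod (z $ k) < 1})" by (auto simp: polydisc_def)
  also have "open \<dots>" by (intro open_INT ballI open_Collect_less continuous_intros) auto
  finally show ?thesis .
qed

lemma polydisc_borel [measurable]: "(polydisc :: (complex ^ 'n) set) \<in> sets borel"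
  by simp

lemma AE_polydisc:
  assumes b: "\<beta> > -1"
  shows "AE z in polydisc_measure \<beta>. z \<in> (polydisc :: (complex ^ 'n) set)"
proof (rule AE_I)
  interpret product_sigma_finite "\<lambda>_::'n. disc_measure \<beta>" by (rule product_sigma_finite_disc_measure[OF b])
  let ?A = "\<lambda>k j. if j = k then {z::complex. \<not> cmod z < 1} else UNIV"
  have [measurable]: "?A k j \<in> sets borel" for k j :: 'n by auto
  have "emeasure (disc_measure \<beta>) {z. \<not> cmod z < 1} = 0"
    using AE_disc_measure[of \<beta>] by (subst (asm) AE_iff_measurable[OF _ refl]) auto
  then have "emeasure (polydisc_measure \<beta>) {z. \<forall>j. z $ j \<in> ?A k j} = 0" for k :: 'n
    by (subst emeasure_polydisc_box[OF b]) (auto simp: prod_zero_iff)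
  then have N: "{z. \<forall>j. z $ j \<in> ?A k j} \<in> null_sets (polydisc_measure \<beta>)" for k :: 'n
    by (intro null_setsI) auto
  have "(\<Union>k::'n\<in>UNIV. {z. \<forall>j. z $ j \<in> ?A k j}) \<in> null_sets (polydisc_measure \<beta>)"
    by (rule null_sets_UN'[OF _ N]) simp
  then show "emeasure (polydisc_measure \<beta>) (\<Union>k::'n\<in>UNIV. {z. \<forall>j. z $ j \<in> ?A k j}) = 0"
    "(\<Union>k::'n\<in>UNIV. {z. \<forall>j. z $ j \<in> ?A k j}) \<in> sets (polydisc_measure \<beta>)" by blast+
  show "{z \<in> space (polydisc_measure \<beta>). z \<notin> polydisc} \<subseteq> (\<Union>k::'n\<in>UNIV. {z. \<forall>j. z $ j \<in> ?A k j})"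
    by (auto simp: polydisc_def split: if_splits)
qed

lemma emeasure_polydisc_section_le:
  fixes E :: "(complex ^ 'n) set"
  assumes b: "\<beta> > -1" and [measurable]: "E \<in> sets borel" "\<And>k. A k \<in> sets borel"
    and sub: "\<And>z k. z \<in> E \<Longrightarrow> k \<noteq> k0 \<Longrightarrow> z $ k \<in> A k"
    and sec: "\<And>z. emeasure (disc_measure \<beta>) {w. (\<chi> k. if k = k0 then w else z $ k) \<in> E} \<le> c"
  shows "emeasure (polydisc_measure \<beta>) E \<le> c * (\<Prod>k\<in>UNIV - {k0}. emeasure (disc_measure \<beta>) (A k))"
proof -
  interpret product_sigma_finite "\<lambda>_::'n. disc_measure \<beta>" by (rule product_sigma_finite_disc_measure[OF b])
  let ?I = "UNIV - {k0}"
  let ?D = "disc_measure \<beta>"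
  have U: "(UNIV :: 'n set) = insert k0 ?I" by auto
  have "emeasure (polydisc_measure \<beta>) E = (\<integral>\<^sup>+z. indicator E z \<partial>polydisc_measure \<beta>)" by simp
  also have "\<dots> = (\<integral>\<^sup>+x. indicator E (\<chi> k. x k) \<partial>PiM UNIV (\<lambda>_. ?D))"
    by (rule nn_integral_polydisc_measure) simp
  also have "\<dots> = (\<integral>\<^sup>+x. indicator E (\<chi> k. x k) \<partial>PiM (insert k0 ?I) (\<lambda>_. ?D))"
    by (simp add: insert_absorb)
  also have "\<dots> = (\<integral>\<^sup>+x. (\<integral>\<^sup>+y. indicator E (\<chi> k. (x(k0 := y)) k) \<partial>?D) \<partial>PiM ?I (\<lambda>_. ?D))"
  proof (rule product_nn_integral_insert)
    show "(\<lambda>x. indicator E (\<chi> k. x k)) \<in> borel_measurable (PiM (insert k0 ?I) (\<lambda>_. ?D))"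
      unfolding U[symmetric] by measurable
  qed auto
  also have "\<dots> \<le> (\<integral>\<^sup>+x. c * (\<Prod>k\<in>?I. indicator (A k) (x k)) \<partial>PiM ?I (\<lambda>_. ?D))"
  proof (rule nn_integral_mono)
    fix x :: "'n \<Rightarrow> complex"
    define z where "z = (\<chi> k. x k)"
    have xz: "x k = z $ k" for k by (simp add: z_def)
    have eq: "(\<chi> k. (x(k0 := y)) k) = (\<chi> k. if k = k0 then y else z $ k)" for y
      by (simp add: vec_eq_iff xz)
    let ?S = "{w. (\<chi> k. if k = k0 then w else z $ k) \<in> E}"
    have [measurable]: "?S \<in> sets borel" 
    proof -
      have "(\<lambda>w::complex. \<chi> k. if k = k0 then w else z $ k) \<in> borel_measurable borel"
        by measurable
      from measurable_sets[OF this assms(2)] show ?thesis by (simp add: vimage_def)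
    qed
    have "(\<integral>\<^sup>+y. indicator E (\<chi> k. (x(k0 := y)) k) \<partial>?D) = (\<integral>\<^sup>+y. indicator ?S y \<partial>?D)"
      unfolding eq by (intro nn_integral_cong) (simp add: indicator_def)
    also have "\<dots> = emeasure ?D ?S" by simp
    also have "\<dots> \<le> c * (\<Prod>k\<in>?I. indicator (A k) (x k))"
    proof (cases "\<forall>k\<in>?I. x k \<in> A k")
      case True
      then show ?thesis using sec[of z] by simp
    next
      case False
      then obtain k where k: "k \<noteq> k0" "x k \<notin> A k" by auto
      then have "(\<chi> k. if k = k0 then w else z $ k) \<notin> E" for w
        using sub[of "\<chi> k. if k = k0 then w else z $ k" k] by (auto simp: xz)
      then show ?thesis by simp
    qed
    finally show "(\<integral>\<^sup>+y. indicator E (\<chi> k. (x(k0 := y)) k) \<partial>?D) \<le> c * (\<Prod>k\<in>?I. indicator (A k) (x k))" .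
  qed
  also have "\<dots> = c * (\<integral>\<^sup>+x. (\<Prod>k\<in>?I. indicator (A k) (x k)) \<partial>PiM ?I (\<lambda>_. ?D))"
    by (intro nn_integral_cmult) measurable
  also have "(\<integral>\<^sup>+x. (\<Prod>k\<in>?I. indicator (A k) (x k)) \<partial>PiM ?I (\<lambda>_. ?D)) = (\<Prod>k\<in>?I. \<integral>\<^sup>+x. indicator (A k) x \<partial>?D)"
    by (intro product_nn_integral_prod) auto
  finally show ?thesis by simp
qed

subsection \<open>The area mean value inequality\<close>

lemma distr_lborel_rotate_translate:
  fixes a c :: complex
  assumes c: "cmod c = 1"
  shows "distr lborel lborel (\<lambda>z. a + c * z) = lborel"
proof (rule measure_eqI)
  fix A assume "A \<in> sets (distr lborel lborel (\<lambda>z. a + c * z))"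
  then have [measurable]: "A \<in> sets borel" by simp
  have "emeasure (distr lborel lborel (\<lambda>z. a + c * z)) A = (\<integral>\<^sup>+z. indicator A z \<partial>distr lborel lborel (\<lambda>z. a + c * z))"
    by simp
  also have "\<dots> = (\<integral>\<^sup>+z. indicator A (a + c * z) \<partial>lborel)"
    by (intro nn_integral_distr) measurable
  also have "\<dots> = (\<integral>\<^sup>+z. indicator A (a + z) \<partial>lborel)"
    by (rule nn_integral_rotate[OF _ c, of "\<lambda>z. indicator A (a + z)"]) measurable
  also have "\<dots> = (\<integral>\<^sup>+z. indicator A z \<partial>distr lborel borel ((+) a))"
    by (intro nn_integral_distr[symmetric]) measurable
  also have "\<dots> = emeasure lborel A" by (simp add: lborel_distr_plus)
  finally show "emeasure (distr lborel lborel (\<lambda>z. a + c * z)) A = emeasure lborel A" .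
qed simp

lemma nn_integral_PiM_map:
  fixes T :: "'n::finite \<Rightarrow> 'a \<Rightarrow> 'a"
  assumes M: "product_sigma_finite (\<lambda>_::'n. M)"
    and [measurable]: "\<And>k. T k \<in> M \<rightarrow>\<^sub>M M" and T: "\<And>k. distr M M (T k) = M"
    and h [measurable]: "h \<in> borel_measurable (PiM UNIV (\<lambda>_. M))"
  shows "(\<integral>\<^sup>+x. h (\<lambda>k. T k (x k)) \<partial>PiM UNIV (\<lambda>_. M)) = (\<integral>\<^sup>+x. h x \<partial>PiM UNIV (\<lambda>_. M))"
proof -
  interpret product_sigma_finite "\<lambda>_::'n. M" by (rule M)
  let ?P = "PiM (UNIV::'n set) (\<lambda>_. M)" and ?T = "\<lambda>x k. T k (x k)"
  have [measurable]: "?T \<in> ?P \<rightarrow>\<^sub>M ?P"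
  proof (rule measurable_PiM_single')
    show "(\<lambda>x. T i (x i)) \<in> ?P \<rightarrow>\<^sub>M M" for i by measurable
    show "?T \<in> space ?P \<rightarrow> (\<Pi>\<^sub>E i\<in>UNIV. space M)"
      using measurable_space[OF assms(2)] by (auto simp: space_PiM PiE_def Pi_def)
  qed
  have "distr ?P ?P ?T = ?P"
  proof (rule PiM_eqI)
    fix A :: "'n \<Rightarrow> 'a set" assume A': "\<And>i. i \<in> UNIV \<Longrightarrow> A i \<in> sets M"
    then have A[measurable]: "A i \<in> sets M" for i by simp
    have "emeasure (distr ?P ?P ?T) (Pi\<^sub>E UNIV A) = emeasure ?P (?T -` (Pi\<^sub>E UNIV A) \<inter> space ?P)"
      by (intro emeasure_distr) measurable
    also have "?T -` (Pi\<^sub>E UNIV A) \<inter> space ?P = (\<Pi>\<^sub>E k\<in>UNIV. T k -` A k \<inter> space M)"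
      by (auto simp: space_PiM PiE_def Pi_def)
    also have "emeasure ?P \<dots> = (\<Prod>k\<in>UNIV. emeasure M (T k -` A k \<inter> space M))"
      by (intro emeasure_PiM) (auto intro: measurable_sets)
    also have "\<dots> = (\<Prod>k\<in>UNIV. emeasure M (A k))"
    proof (intro prod.cong refl)
      fix k
      have "emeasure M (T k -` A k \<inter> space M) = emeasure (distr M M (T k)) (A k)"
        by (intro emeasure_distr[symmetric]) auto
      then show "emeasure M (T k -` A k \<inter> space M) = emeasure M (A k)" by (simp add: T)
    qed
    finally show "emeasure (distr ?P ?P ?T) (Pi\<^sub>E UNIV A) = (\<Prod>i\<in>UNIV. emeasure M (A i))" .
  qed auto
  then have "(\<integral>\<^sup>+x. h x \<partial>?P) = (\<integral>\<^sup>+x. h x \<partial>distr ?P ?P ?T)" by simp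
  also have "\<dots> = (\<integral>\<^sup>+x. h (?T x) \<partial>?P)" by (intro nn_integral_distr) measurable
  finally show ?thesis ..
qed

text \<open>Restriction to complex lines is the bridge to one-variable theory: the mean value
  property, Schwarz-Pick and the Lipschitz bounds are all applied to such slices.\<close>

lemma holomorphic_several_slice:
  fixes f :: "complex ^ 'n \<Rightarrow> complex"
  assumes f: "holomorphic_several_on f S" and S: "\<And>l. l \<in> U \<Longrightarrow> a + l *s v \<in> S"
  shows "(\<lambda>l. f (a + l *s v)) holomorphic_on U"
  unfolding holomorphic_on_def
proof
  fix l assume "l \<in> U"
  then obtain D where D: "(f has_derivative D) (at (a + l *s v))" "\<And>c v. D (c *s v) = c * D v"
    using f S unfolding holomorphic_several_on_def by meson
  have "linear (\<lambda>h::complex. h *s v)"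
    by (rule linearI) (auto simp: vec_eq_iff algebra_simps)
  then have "bounded_linear (\<lambda>h::complex. h *s v)" by (simp add: linear_conv_bounded_linear)
  then have "((\<lambda>l. l *s v) has_derivative (\<lambda>h. h *s v)) (at l within U)"
    by (rule bounded_linear_imp_has_derivative)
  then have "((\<lambda>l. a + l *s v) has_derivative (\<lambda>h. h *s v)) (at l within U)"
    using has_derivative_add_const[of "\<lambda>l. l *s v" "\<lambda>h. h *s v" "at l within U" a] by (simp add: add.commute)
  from has_derivative_compose[OF this D(1)]
  have "((\<lambda>l. f (a + l *s v)) has_derivative (\<lambda>h. D (h *s v))) (at l within U)" .
  moreover have "(\<lambda>h. D (h *s v)) = (*) (D v)"
    by (simp add: D(2) fun_eq_iff mult.commute)
  ultimately show "(\<lambda>l. f (a + l *s v)) field_differentiable at l within U"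
    unfolding field_differentiable_def has_field_derivative_def by auto
qed

lemma holomorphic_several_continuous_on:
  "holomorphic_several_on f S \<Longrightarrow> continuous_on S f"
  unfolding holomorphic_several_on_def continuous_on_eq_continuous_within
  by (meson has_derivative_continuous continuous_at_imp_continuous_at_within)

text \<open>Cauchy's formula is applied to the square of \<open>g\<close>, so the mean of the
  squared modulus appears directly.\<close>

lemma circle_mean_le:
  assumes g: "g holomorphic_on cball 0 1"
  shows "ennreal ((cmod (g 0))\<^sup>2) \<le> (\<integral>\<^sup>+t. ennreal ((cmod (g (cis (2 * pi * t))))\<^sup>2) * indicator {0..1} t \<partial>lborel)"
proof -
  let ?c = "\<lambda>t. cis (2 * pi * t)"
  have "(\<lambda>z. (g z)\<^sup>2) holomorphic_on cball 0 1" by (intro holomorphic_intros g)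
  from Cauchy_integral_circlepath_simple[OF this, of 0]
  have "((\<lambda>u. (g u)\<^sup>2 / (u - 0)) has_contour_integral 2 * of_real pi * \<i> * (g 0)\<^sup>2) (circlepath 0 1)" by simp
  then have "((\<lambda>x. (g (circlepath 0 1 x))\<^sup>2 / (circlepath 0 1 x - 0) * vector_derivative (circlepath 0 1) (at x within {0..1}))
      has_integral 2 * of_real pi * \<i> * (g 0)\<^sup>2) {0..1}"
    unfolding has_contour_integral_def .
  then have "((\<lambda>t. 2 * of_real pi * \<i> * (g (?c t))\<^sup>2) has_integral 2 * of_real pi * \<i> * (g 0)\<^sup>2) {0..1}"
  proof (rule has_integral_eq[rotated])
    fix t :: real assume t: "t \<in> {0..1}"
    have e: "exp (2 * of_real pi * \<i> * of_real t) = ?c t"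
      by (simp add: cis_conv_exp mult_ac)
    then have "circlepath 0 1 t = ?c t" by (simp add: circlepath)
    moreover have "vector_derivative (circlepath 0 1) (at t within {0..1}) = 2 * of_real pi * \<i> * ?c t"
      using t e by (simp add: vector_derivative_circlepath01)
    ultimately show "(g (circlepath 0 1 t))\<^sup>2 / (circlepath 0 1 t - 0) * vector_derivative (circlepath 0 1) (at t within {0..1})
        = 2 * of_real pi * \<i> * (g (?c t))\<^sup>2"
      by simp
  qed
  from has_integral_mult_right[OF this, of "1 / (2 * of_real pi * \<i>)"]
  have int: "((\<lambda>t. (g (?c t))\<^sup>2) has_integral (g 0)\<^sup>2) {0..1}" by simp
  have cont: "continuous_on {0..1} (\<lambda>t. g (?c t))"
    by (rule continuous_on_compose2[OF holomorphic_on_imp_continuous_on[OF g]]) (auto intro!: continuous_intros)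
  then have "(\<lambda>t. (cmod (g (?c t)))\<^sup>2) integrable_on {0..1}"
    by (intro integrable_continuous_real continuous_intros)
  then obtain J where J: "((\<lambda>t. (cmod (g (?c t)))\<^sup>2) has_integral J) {0..1}" by blast
  have "(cmod (g 0))\<^sup>2 = cmod (integral {0..1} (\<lambda>t. (g (?c t))\<^sup>2))"
    using int by (simp add: integral_unique norm_power)
  also have "\<dots> \<le> integral {0..1} (\<lambda>t. (cmod (g (?c t)))\<^sup>2)"
    using int J by (intro integral_norm_bound_integral) (auto simp: norm_power)
  also have "\<dots> = J" using J by (simp add: integral_unique)
  finally have "ennreal ((cmod (g 0))\<^sup>2) \<le> ennreal J" by (rule ennreal_leI)
  also have "\<dots> = (\<integral>\<^sup>+t. ennreal ((cmod (g (?c t)))\<^sup>2) * indicator {0..1} t \<partial>lborel)"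
    by (intro nn_integral_has_integral_lebesgue'[symmetric] J) auto
  finally show ?thesis .
qed

text \<open>Half the distance to the circle as radius keeps 1 - |z(k)| and 1 - |w(k)| comparable on
  the box. The box is centred at \<open>w\<close>; where weights at \<open>w\<close> have to become
  weights at \<open>z\<close>, this comparability does it.\<close>

definition whitney :: "complex ^ 'n \<Rightarrow> (complex ^ 'n) set" where
  "whitney w = {z. \<forall>k. cmod (z $ k - w $ k) < (1 - cmod (w $ k)) / 2}"

lemma open_whitney: "open (whitney (w :: complex ^ 'n))"
proof -
  have "whitney w = (\<Inter>k\<in>UNIV. {z. cmod (z $ k - w $ k) < (1 - cmod (w $ k)) / 2})" by (auto simp: whitney_def)
  also have "open \<dots>" by (intro open_INT ballI open_Collect_less continuous_intros) auto
  finally show ?thesis .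
qed

lemma whitney_borel [measurable]: "whitney (w :: complex ^ 'n) \<in> sets borel"
  by (rule borel_open[OF open_whitney])

lemma whitney_bounds:
  fixes z w :: "complex ^ 'n"
  assumes "z \<in> whitney w"
  shows "(1 - cmod (w $ k)) / 2 < 1 - cmod (z $ k)" "1 - cmod (z $ k) < 3 / 2 * (1 - cmod (w $ k))"
proof -
  have z: "cmod (z $ k - w $ k) < (1 - cmod (w $ k)) / 2" using assms by (simp add: whitney_def)
  show "(1 - cmod (w $ k)) / 2 < 1 - cmod (z $ k)"
    using z norm_triangle_ineq2[of "z $ k" "w $ k"] by simp
  show "1 - cmod (z $ k) < 3 / 2 * (1 - cmod (w $ k))"
    using z norm_triangle_ineq2[of "w $ k" "z $ k"] by (simp add: norm_minus_commute)
qed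

text \<open>For \<open>u\<close> in the product of the discs of radii \<open>r k\<close>, the circle
  of points \<open>w + l *s u\<close> with \<open>cmod l = 1\<close> stays in the box, and
  \<open>circle_mean_le\<close> applies on it. One rotation \<open>l\<close> acts on all coordinates
  at once, and integration over \<open>u\<close> makes \<open>l\<close> disappear, because rotations
  and translations preserve Lebesgue measure.\<close>

lemma mean_value_lborel:
  fixes f :: "complex ^ 'n \<Rightarrow> complex"
  assumes f: "holomorphic_several_on f polydisc" and [measurable]: "f \<in> borel_measurable borel"
    and w: "w \<in> polydisc"
  shows "(\<Prod>k\<in>UNIV. ennreal (pi * ((1 - cmod (w $ k)) / 2)\<^sup>2)) * ennreal ((cmod (f w))\<^sup>2)
    \<le> (\<integral>\<^sup>+x. indicator (whitney w) (\<chi> k. x k) * ennreal ((cmod (f (\<chi> k. x k)))\<^sup>2) \<partial>PiM UNIV (\<lambda>_. lborel))"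
proof -
  interpret product_sigma_finite "\<lambda>_::'n. lborel :: complex measure" by (rule product_sigma_finite_lborel_const)
  let ?L = "PiM (UNIV::'n set) (\<lambda>_. lborel :: complex measure)"
  interpret L: sigma_finite_measure ?L by (rule sigma_finite) simp
  interpret LT: pair_sigma_finite ?L "lborel :: real measure" by unfold_locales
  define r where "r k = (1 - cmod (w $ k)) / 2" for k
  have r: "r k > 0" for k using w by (simp add: r_def polydisc_def)
  define H where "H u = indicator (whitney w) (\<chi> k. u k) * ennreal ((cmod (f (\<chi> k. u k)))\<^sup>2)" for u :: "'n \<Rightarrow> complex"
  have [measurable]: "H \<in> borel_measurable ?L" unfolding H_def by measurable
  define G where "G c u = H (\<lambda>k. w $ k + c * u k)" for c u
  have Gint: "(\<integral>\<^sup>+u. G c u \<partial>?L) = (\<integral>\<^sup>+u. H u \<partial>?L)" if "cmod c = 1" for c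
    unfolding G_def
    by (rule nn_integral_PiM_map[OF product_sigma_finite_lborel_const, of "\<lambda>k z. w $ k + c * z"])
       (use that in \<open>auto simp: distr_lborel_rotate_translate\<close>)
  have le: "(\<Prod>k\<in>UNIV. indicator (ball 0 (r k)) (u k)) * ennreal ((cmod (f w))\<^sup>2)
      \<le> (\<integral>\<^sup>+t. G (cis (2 * pi * t)) u * indicator {0..1} t \<partial>lborel)" for u
  proof (cases "\<forall>k. u k \<in> ball 0 (r k)")
    case True
    define v where "v = (\<chi> k. u k)"
    have inw: "w + l *s v \<in> whitney w" if "cmod l \<le> 1" for l
    proof -
      have "cmod (l * u k) < r k" for k
        using True[rule_format, of k] that mult_right_mono[of "cmod l" 1 "cmod (u k)"]
        by (simp add: norm_mult)
      then show ?thesis by (simp add: whitney_def r_def v_def)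
    qed
    have in_disc: "w + l *s v \<in> polydisc" if "l \<in> cball 0 1" for l
    proof -
      have "l *s v + w \<in> whitney w" using inw[of l] that by (simp add: add.commute)
      then have "cmod ((w + l *s v) $ k) < 1" for k
        using whitney_bounds(1)[of "l *s v + w" w k] r[of k] by (simp add: r_def add.commute)
      then show ?thesis by (simp add: polydisc_def)
    qed
    have "(\<lambda>l. f (w + l *s v)) holomorphic_on cball 0 1"
      using f in_disc by (rule holomorphic_several_slice)
    from circle_mean_le[OF this]
    have "ennreal ((cmod (f w))\<^sup>2) \<le> (\<integral>\<^sup>+t. ennreal ((cmod (f (w + cis (2 * pi * t) *s v)))\<^sup>2) * indicator {0..1} t \<partial>lborel)"
      by simp
    also have "\<dots> = (\<integral>\<^sup>+t. G (cis (2 * pi * t)) u * indicator {0..1} t \<partial>lborel)"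
    proof (intro nn_integral_cong arg_cong2[of _ _ _ _ "(*)"] refl)
      fix t :: real
      have "(\<chi> k. w $ k + cis (2 * pi * t) * u k) = w + cis (2 * pi * t) *s v"
        by (simp add: vec_eq_iff v_def)
      then show "ennreal ((cmod (f (w + cis (2 * pi * t) *s v)))\<^sup>2) = G (cis (2 * pi * t)) u"
        unfolding G_def H_def using inw[of "cis (2 * pi * t)"] by simp
    qed
    finally show ?thesis using True by simp
  next
    case False
    then have "(\<Prod>k\<in>UNIV. indicator (ball 0 (r k)) (u k)) = (0::ennreal)" by (auto simp: prod_zero_iff indicator_def)
    then show ?thesis by (simp only: mult_zero_left zero_le)
  qed
  have "(\<Prod>k\<in>UNIV. ennreal (pi * (r k)\<^sup>2)) = (\<Prod>k\<in>UNIV. \<integral>\<^sup>+z. indicator (ball 0 (r k)) z \<partial>(lborel :: complex measure))"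
    using r by (intro prod.cong refl) (simp add: emeasure_ball less_imp_le unit_ball_vol_2)
  also have "\<dots> = (\<integral>\<^sup>+u. (\<Prod>k\<in>UNIV. indicator (ball 0 (r k)) (u k)) \<partial>?L)"
    by (intro product_nn_integral_prod[symmetric] borel_measurable_indicator) simp_all
  finally have "(\<Prod>k\<in>UNIV. ennreal (pi * (r k)\<^sup>2)) * ennreal ((cmod (f w))\<^sup>2)
      = (\<integral>\<^sup>+u. (\<Prod>k\<in>UNIV. indicator (ball 0 (r k)) (u k)) * ennreal ((cmod (f w))\<^sup>2) \<partial>?L)"
  proof (simp only:, intro nn_integral_multc[symmetric])
    have [measurable]: "ball (0::complex) (r k) \<in> sets borel" for k by simp
    show "(\<lambda>u. \<Prod>k\<in>UNIV. indicator (ball 0 (r k)) (u k) :: ennreal) \<in> borel_measurable ?L" by measurable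
  qed
  also have "\<dots> \<le> (\<integral>\<^sup>+u. \<integral>\<^sup>+t. G (cis (2 * pi * t)) u * indicator {0..1} t \<partial>lborel \<partial>?L)"
    by (intro nn_integral_mono le)
  also have "\<dots> = (\<integral>\<^sup>+t. \<integral>\<^sup>+u. G (cis (2 * pi * t)) u * indicator {0..1} t \<partial>?L \<partial>lborel)"
    by (rule LT.Fubini'[symmetric]) (unfold G_def H_def cis_conv_exp, measurable)
  also have "\<dots> = (\<integral>\<^sup>+t. (\<integral>\<^sup>+u. H u \<partial>?L) * indicator {0..1::real} t \<partial>lborel)"
  proof (intro nn_integral_cong)
    fix t :: real
    have "(\<integral>\<^sup>+u. G (cis (2 * pi * t)) u * indicator {0..1} t \<partial>?L) = (\<integral>\<^sup>+u. G (cis (2 * pi * t)) u \<partial>?L) * indicator {0..1} t"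
      by (intro nn_integral_multc) (unfold G_def H_def, measurable)
    then show "(\<integral>\<^sup>+u. G (cis (2 * pi * t)) u * indicator {0..1} t \<partial>?L) = (\<integral>\<^sup>+u. H u \<partial>?L) * indicator {0..1} t"
      by (simp add: Gint)
  qed
  also have "\<dots> = (\<integral>\<^sup>+u. H u \<partial>?L)" by (simp add: nn_integral_cmult)
  finally show ?thesis by (simp add: r_def H_def)
qed

text \<open>On the box the density is at least a multiple of
  \<open>(1 - cmod (w $ k)) powr \<beta>\<close> in each coordinate; together with the areas of the
  discs this gives the exponent 2 + \<beta>. The integral is kept over the box: Fubini exploits this
  for sufficiency, and for necessity the mass in a box tends to 0 at the boundary.\<close>

lemma mean_value_polydisc:
  assumes b: "\<beta> > -1"
  shows "\<exists>C>0. \<forall>(f :: complex ^ 'n \<Rightarrow> complex) w. holomorphic_several_on f polydisc \<longrightarrow> f \<in> borel_measurable borel \<longrightarrow> w \<in> polydisc \<longrightarrow>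
    ennreal ((cmod (f w))\<^sup>2)
      \<le> ennreal (C * (\<Prod>k\<in>UNIV. (1 - cmod (w $ k)) powr (- 2 - \<beta>)))
        * (\<integral>\<^sup>+z. indicator (whitney w) z * ennreal ((cmod (f z))\<^sup>2) \<partial>polydisc_measure \<beta>)"
proof -
  \<comment> \<open>The minimum covers both signs of \<beta>: on the box
    \<open>1 - (cmod (z $ k))\<^sup>2\<close> lies between 1/2 and 3 times
    \<open>1 - cmod (w $ k)\<close>, and the lower end decides for \<beta> \<ge> 0, the upper one
    for \<beta> < 0. \<open>K\<close> below inverts one factor \<open>c * pi / 4\<close> per
    coordinate.\<close>
  define c where "c = (\<beta> + 1) / pi * min ((1/2) powr \<beta>) (3 powr \<beta>)"
  have c: "c > 0" using b by (simp add: c_def)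
  define K where "K = 4 / pi / c"
  have K: "K > 0" using c by (simp add: K_def)
  have "ennreal ((cmod (f w))\<^sup>2) \<le> ennreal (K ^ CARD('n) * (\<Prod>k\<in>UNIV. (1 - cmod (w $ k)) powr (- 2 - \<beta>)))
        * (\<integral>\<^sup>+z. indicator (whitney w) z * ennreal ((cmod (f z))\<^sup>2) \<partial>polydisc_measure \<beta>)"
    if f: "holomorphic_several_on f polydisc" and [measurable]: "f \<in> borel_measurable borel" and w: "w \<in> polydisc"
    for f :: "complex ^ 'n \<Rightarrow> complex" and w
  proof -
    let ?L = "PiM (UNIV::'n set) (\<lambda>_. lborel :: complex measure)"
    let ?s = "\<lambda>k. 1 - cmod (w $ k)"
    have s: "?s k > 0" for k using w by (simp add: polydisc_def)
    have weight: "c * ?s k powr \<beta> \<le> disc_weight \<beta> (z $ k)" if z: "z \<in> whitney w" for z k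
    proof -
      have zk: "?s k / 2 < 1 - cmod (z $ k)" "1 - cmod (z $ k) < 3 / 2 * ?s k"
        using whitney_bounds[OF z] by auto
      have z1: "cmod (z $ k) < 1" using zk s[of k] by simp
      define y where "y = 1 - (cmod (z $ k))\<^sup>2"
      have y: "y = (1 + cmod (z $ k)) * (1 - cmod (z $ k))"
        by (simp add: y_def power2_eq_square algebra_simps)
      have "1 * (1 - cmod (z $ k)) \<le> y" "y \<le> 2 * (1 - cmod (z $ k))"
        unfolding y using z1 by (intro mult_right_mono; simp)+
      then have y: "1 / 2 * ?s k \<le> y" "y \<le> 3 * ?s k" using zk by auto
      have "min ((1/2) powr \<beta>) (3 powr \<beta>) * ?s k powr \<beta> \<le> y powr \<beta>"
      proof (cases "\<beta> \<ge> 0")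
        case True
        have "min ((1/2) powr \<beta>) (3 powr \<beta>) * ?s k powr \<beta> \<le> (1/2) powr \<beta> * ?s k powr \<beta>"
          by (intro mult_right_mono) auto
        also have "\<dots> = (1 / 2 * ?s k) powr \<beta>" using s[of k] by (simp only: powr_mult)
        also have "\<dots> \<le> y powr \<beta>" using y s[of k] True by (intro powr_mono2) auto
        finally show ?thesis .
      next
        case False
        have "min ((1/2) powr \<beta>) (3 powr \<beta>) * ?s k powr \<beta> \<le> 3 powr \<beta> * ?s k powr \<beta>"
          by (intro mult_right_mono) auto
        also have "\<dots> = (3 * ?s k) powr \<beta>" using s[of k] by (simp only: powr_mult)
        also have "\<dots> \<le> y powr \<beta>" using y s[of k] False by (intro powr_mono2') auto
        finally show ?thesis .
      qed
      then have "(\<beta> + 1) / pi * (min ((1/2) powr \<beta>) (3 powr \<beta>) * ?s k powr \<beta>) \<le> (\<beta> + 1) / pi * y powr \<beta>"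
        using b by (intro mult_left_mono) auto
      then show ?thesis using z1 by (simp add: disc_weight_def c_def y_def mult_ac)
    qed
    define W where "W = (\<Prod>k\<in>UNIV. c * ?s k powr \<beta>)"
    define P where "P = (\<Prod>k\<in>UNIV. pi * (?s k / 2)\<^sup>2)"
    have pos: "c * ?s k powr \<beta> > 0" "pi * (?s k / 2)\<^sup>2 > 0" for k
      using c s[of k] by (auto simp del: zero_less_mult_iff intro!: mult_pos_pos)
    have WP: "W > 0" "P > 0" unfolding W_def P_def using pos by (intro prod_pos; simp)+
    have "ennreal P * ennreal ((cmod (f w))\<^sup>2)
        \<le> (\<integral>\<^sup>+x. indicator (whitney w) (\<chi> k. x k) * ennreal ((cmod (f (\<chi> k. x k)))\<^sup>2) \<partial>?L)"
      using mean_value_lborel[OF f _ w] by (simp add: P_def prod_ennreal)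
    then have "ennreal W * (ennreal P * ennreal ((cmod (f w))\<^sup>2))
        \<le> ennreal W * (\<integral>\<^sup>+x. indicator (whitney w) (\<chi> k. x k) * ennreal ((cmod (f (\<chi> k. x k)))\<^sup>2) \<partial>?L)"
      by (rule mult_left_mono) simp
    also have "\<dots> = (\<integral>\<^sup>+x. ennreal W * (indicator (whitney w) (\<chi> k. x k) * ennreal ((cmod (f (\<chi> k. x k)))\<^sup>2)) \<partial>?L)"
      by (intro nn_integral_cmult[symmetric]) measurable
    also have "\<dots> \<le> (\<integral>\<^sup>+x. ennreal (\<Prod>k\<in>UNIV. disc_weight \<beta> (x k)) * (indicator (whitney w) (\<chi> k. x k) * ennreal ((cmod (f (\<chi> k. x k)))\<^sup>2)) \<partial>?L)"
    proof (intro nn_integral_mono)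
      fix x :: "'n \<Rightarrow> complex"
      show "ennreal W * (indicator (whitney w) (\<chi> k. x k) * ennreal ((cmod (f (\<chi> k. x k)))\<^sup>2))
        \<le> ennreal (\<Prod>k\<in>UNIV. disc_weight \<beta> (x k)) * (indicator (whitney w) (\<chi> k. x k) * ennreal ((cmod (f (\<chi> k. x k)))\<^sup>2))"
      proof (cases "(\<chi> k. x k) \<in> whitney w")
        case True
        have "W \<le> (\<Prod>k\<in>UNIV. disc_weight \<beta> (x k))"
          unfolding W_def
        proof (intro prod_mono conjI)
          fix k
          show "0 \<le> c * ?s k powr \<beta>" using pos(1)[of k] by simp
          show "c * ?s k powr \<beta> \<le> disc_weight \<beta> (x k)" using weight[OF True, of k] by simp
        qed
        then show ?thesis by (intro mult_right_mono ennreal_leI) auto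
      qed simp
    qed
    also have "\<dots> = (\<integral>\<^sup>+z. indicator (whitney w) z * ennreal ((cmod (f z))\<^sup>2) \<partial>polydisc_measure \<beta>)"
      by (rule nn_integral_polydisc_lborel[OF b, symmetric]) measurable
    finally have le: "ennreal W * (ennreal P * ennreal ((cmod (f w))\<^sup>2))
        \<le> (\<integral>\<^sup>+z. indicator (whitney w) z * ennreal ((cmod (f z))\<^sup>2) \<partial>polydisc_measure \<beta>)" .
    have "K ^ CARD('n) * (\<Prod>k\<in>UNIV. ?s k powr (- 2 - \<beta>)) * (W * P)
        = (\<Prod>k\<in>(UNIV::'n set). (K * ?s k powr (- 2 - \<beta>)) * ((c * ?s k powr \<beta>) * (pi * (?s k / 2)\<^sup>2)))"
      by (simp add: W_def P_def prod.distrib)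
    also have "\<dots> = (\<Prod>k\<in>(UNIV::'n set). 1)"
    proof (intro prod.cong refl)
      fix k
      have "(K * ?s k powr (- 2 - \<beta>)) * ((c * ?s k powr \<beta>) * (pi * (?s k / 2)\<^sup>2))
          = ?s k powr (- 2 - \<beta>) * ?s k powr \<beta> * ?s k powr 2"
        using c s[of k] by (simp add: K_def power_divide powr_numeral)
      also have "\<dots> = 1" using s[of k] by (simp only: powr_add[symmetric]) simp
      finally show "(K * ?s k powr (- 2 - \<beta>)) * ((c * ?s k powr \<beta>) * (pi * (?s k / 2)\<^sup>2)) = 1" .
    qed
    finally have one: "K ^ CARD('n) * (\<Prod>k\<in>UNIV. ?s k powr (- 2 - \<beta>)) * (W * P) = 1" by simp
    have nn: "0 \<le> K ^ CARD('n) * (\<Prod>k\<in>UNIV. ?s k powr (- 2 - \<beta>))"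
      using K by (intro mult_nonneg_nonneg prod_nonneg) auto
    have mult3: "ennreal (X * (W * P)) * y = ennreal X * (ennreal W * (ennreal P * y))" if "0 \<le> X" for X y
      using that WP by (simp add: ennreal_mult less_imp_le mult.assoc)
    have "ennreal ((cmod (f w))\<^sup>2) = ennreal (K ^ CARD('n) * (\<Prod>k\<in>UNIV. ?s k powr (- 2 - \<beta>)) * (W * P)) * ennreal ((cmod (f w))\<^sup>2)"
      unfolding one by simp
    also have "\<dots> = ennreal (K ^ CARD('n) * (\<Prod>k\<in>UNIV. ?s k powr (- 2 - \<beta>))) * (ennreal W * (ennreal P * ennreal ((cmod (f w))\<^sup>2)))"
      using nn by (rule mult3)
    also have "\<dots> \<le> ennreal (K ^ CARD('n) * (\<Prod>k\<in>UNIV. ?s k powr (- 2 - \<beta>)))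
        * (\<integral>\<^sup>+z. indicator (whitney w) z * ennreal ((cmod (f z))\<^sup>2) \<partial>polydisc_measure \<beta>)"
      by (rule mult_left_mono[OF le]) simp
    finally show ?thesis .
  qed
  moreover have "K ^ CARD('n) > 0" using K by simp
  ultimately show ?thesis by blast
qed

subsection \<open>Schwarz-Pick estimates up to the boundary\<close>

text \<open>Both follow from the Schwarz lemma for \<open>g\<close> followed by the disc
  automorphism that sends \<open>g 0\<close> to 0. The first is a quantitative Hopf estimate; the
  second forces \<open>g l = g 0\<close> once \<open>g 0\<close> becomes unimodular. They are
  non-strict and free of denominators, so that they survive limits at the boundary.\<close>

lemma schwarz_pick_disc:
  assumes g: "g holomorphic_on ball 0 1" and less: "\<And>z. cmod z < 1 \<Longrightarrow> cmod (g z) < 1" and l: "cmod l < 1"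
  shows "(1 - (cmod l)\<^sup>2) * (1 - cmod (g 0)) \<le> 2 * (1 - (cmod (g l))\<^sup>2)"
    and "cmod (g l - g 0) * (1 - cmod l) \<le> cmod l * (1 - (cmod (g 0))\<^sup>2)"
proof -
  define a where "a = g 0"
  define u where "u = g l"
  define r where "r = cmod l"
  have a: "cmod a < 1" and u: "cmod u < 1" using less l by (auto simp: a_def u_def)
  have r: "0 \<le> r" "r < 1" using l by (auto simp: r_def)
  have ident: "(cmod (1 - cnj a * v))\<^sup>2 - (cmod (v - a))\<^sup>2 = (1 - (cmod a)\<^sup>2) * (1 - (cmod v)\<^sup>2)" for v
    by (simp add: cmod_power2) (simp add: power2_eq_square algebra_simps)
  have ne: "1 - cnj a * v \<noteq> 0" if "cmod v < 1" for v
  proof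
    assume "1 - cnj a * v = 0"
    then have "cmod a * cmod v = 1" by (metis complex_mod_cnj norm_mult norm_one right_minus_eq)
    moreover have "cmod a * cmod v < 1 * 1" using a that by (intro mult_strict_mono') auto
    ultimately show False by simp
  qed
  define h where "h z = (g z - a) / (1 - cnj a * g z)" for z
  have hol: "h holomorphic_on ball 0 1"
    unfolding h_def using ne less by (intro holomorphic_intros g) auto
  have h0: "h 0 = 0" by (simp add: h_def a_def)
  have h1: "cmod (h z) < 1" if "cmod z < 1" for z
  proof -
    have v: "cmod (g z) < 1" using less that by simp
    have "0 < (1 - (cmod a)\<^sup>2) * (1 - (cmod (g z))\<^sup>2)"
      using a v by (intro mult_pos_pos) (auto simp: abs_square_less_1)
    then have "(cmod (g z - a))\<^sup>2 < (cmod (1 - cnj a * g z))\<^sup>2" using ident[of "g z"] by simp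
    then have "cmod (g z - a) < cmod (1 - cnj a * g z)" by (rule power2_less_imp_less) simp
    then show ?thesis using ne[OF v] by (simp add: h_def norm_divide)
  qed
  have "cmod (h l) \<le> cmod l" by (rule Schwarz_Lemma(1)[OF hol h0 h1 l])
  then have le: "cmod (u - a) \<le> r * cmod (1 - cnj a * u)"
    using ne[OF u] by (simp add: h_def norm_divide u_def r_def field_simps)
  then have "(cmod (u - a))\<^sup>2 \<le> (r * cmod (1 - cnj a * u))\<^sup>2" by (intro power_mono) auto
  then have "(1 - r\<^sup>2) * (cmod (1 - cnj a * u))\<^sup>2 \<le> (1 - (cmod a)\<^sup>2) * (1 - (cmod u)\<^sup>2)"
    using ident[of u] by (simp add: power_mult_distrib algebra_simps)
  moreover have "1 - cmod a \<le> cmod (1 - cnj a * u)"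
  proof -
    have "cmod (cnj a * u) \<le> cmod a * 1" using u by (simp only: norm_mult complex_mod_cnj) (intro mult_left_mono; simp)
    then show ?thesis using norm_triangle_ineq2[of 1 "cnj a * u"] by simp
  qed
  then have "(1 - r\<^sup>2) * (1 - cmod a)\<^sup>2 \<le> (1 - r\<^sup>2) * (cmod (1 - cnj a * u))\<^sup>2"
    using a r by (intro mult_left_mono power_mono) (auto simp: abs_square_le_1)
  ultimately have "(1 - cmod a) * ((1 - r\<^sup>2) * (1 - cmod a)) \<le> (1 - cmod a) * ((1 + cmod a) * (1 - (cmod u)\<^sup>2))"
    by (simp add: power2_eq_square algebra_simps)
  then have "(1 - r\<^sup>2) * (1 - cmod a) \<le> (1 + cmod a) * (1 - (cmod u)\<^sup>2)" using a by simp
  also have "\<dots> \<le> 2 * (1 - (cmod u)\<^sup>2)"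
    using a u by (intro mult_right_mono) (auto simp: abs_square_le_1)
  finally show "(1 - (cmod l)\<^sup>2) * (1 - cmod (g 0)) \<le> 2 * (1 - (cmod (g l))\<^sup>2)"
    by (simp add: a_def u_def r_def)
  have "1 - cnj a * u = of_real (1 - (cmod a)\<^sup>2) - cnj a * (u - a)"
    by (simp add: algebra_simps complex_norm_square[symmetric])
  then have "cmod (1 - cnj a * u) \<le> cmod (of_real (1 - (cmod a)\<^sup>2)) + cmod (cnj a * (u - a))"
    by (metis norm_triangle_ineq4)
  also have "\<dots> \<le> (1 - (cmod a)\<^sup>2) + 1 * cmod (u - a)"
    unfolding norm_mult norm_of_real complex_mod_cnj
    using a by (intro add_mono mult_right_mono) (auto simp: abs_square_le_1)
  finally have "r * cmod (1 - cnj a * u) \<le> r * ((1 - (cmod a)\<^sup>2) + cmod (u - a))"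
    using r by (intro mult_left_mono) auto
  then have "cmod (u - a) \<le> r * ((1 - (cmod a)\<^sup>2) + cmod (u - a))" using le by simp
  then show "cmod (g l - g 0) * (1 - cmod l) \<le> cmod l * (1 - (cmod (g 0))\<^sup>2)"
    by (simp add: a_def u_def r_def algebra_simps)
qed

section \<open>The closed polydisc and limits along dilations\<close>

lemma cpolydisc_scale:
  assumes "z \<in> cpolydisc" "0 \<le> r" "r < 1"
  shows "r *\<^sub>R z \<in> polydisc"
proof -
  have "r * cmod (z $ k) < 1" for k
    using assms mult_left_mono[of "cmod (z $ k)" 1 r] by (auto simp: cpolydisc_def)
  then show ?thesis using assms(2) by (simp add: polydisc_def)
qed

lemma polydisc_subset_cpolydisc: "polydisc \<subseteq> cpolydisc"
  by (auto simp: polydisc_def cpolydisc_def less_imp_le)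

lemma closed_cpolydisc: "closed (cpolydisc :: (complex ^ 'n) set)"
proof -
  have "cpolydisc = (\<Inter>k\<in>UNIV. {z::complex^'n. cmod (z $ k) \<le> 1})" by (auto simp: cpolydisc_def)
  also have "closed \<dots>" by (intro closed_INT ballI closed_Collect_le continuous_intros)
  finally show ?thesis .
qed

lemma compact_cpolydisc: "compact (cpolydisc :: (complex ^ 'n) set)"
proof -
  have "norm z \<le> real CARD('n)" if "z \<in> cpolydisc" for z :: "complex ^ 'n"
  proof -
    have "norm z \<le> (\<Sum>k\<in>UNIV. cmod (z $ k))" unfolding norm_vec_def by (rule L2_set_le_sum) simp
    also have "\<dots> \<le> (\<Sum>k\<in>(UNIV::'n set). 1)" using that by (intro sum_mono) (auto simp: cpolydisc_def)
    finally show ?thesis by simp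
  qed
  then have "bounded (cpolydisc :: (complex ^ 'n) set)" by (auto simp: bounded_iff)
  with closed_cpolydisc show ?thesis by (simp add: compact_eq_bounded_closed)
qed

text \<open>Inequalities at boundary points are proved for the dilates \<open>r *\<^sub>R z\<close>
  with \<open>r < 1\<close>, which lie in the open polydisc, and transferred here to
  \<open>r = 1\<close>.\<close>

lemma nonpos_at_1:
  fixes h :: "real \<Rightarrow> real"
  assumes h: "continuous_on {0..1} h" and ev: "\<forall>\<^sub>F r in at_left 1. h r \<le> 0"
  shows "h 1 \<le> 0"
proof -
  have "(h \<longlongrightarrow> h 1) (at 1 within {0..1})" using h by (auto simp: continuous_on_def)
  then have "(h \<longlongrightarrow> h 1) (at_left 1)" by (simp add: at_within_Icc_at_left)
  then show ?thesis by (rule tendsto_upperbound[OF _ ev]) simp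
qed

lemma eventually_at_left_1: "(\<And>r::real. 0 < r \<Longrightarrow> r < 1 \<Longrightarrow> P r) \<Longrightarrow> \<forall>\<^sub>F r in at_left 1. P r"
  by (auto simp: eventually_at_left[of 0 "1::real"] intro!: exI[of _ 0])

text \<open>One component of the map. On the boundary only the continuous extensions
  \<open>g\<close> of the partial derivatives exist, so first order statements there are expressed
  through \<open>g\<close> and obtained as limits from inside.\<close>

locale C1_disc_function =
  fixes f :: "complex ^ 'n \<Rightarrow> complex" and g :: "'n \<Rightarrow> complex ^ 'n \<Rightarrow> complex"
  assumes hol: "holomorphic_several_on f polydisc"
    and bound: "\<And>z. z \<in> polydisc \<Longrightarrow> cmod (f z) < 1"
    and cont: "continuous_on cpolydisc f"
    and gcont: "\<And>k. continuous_on cpolydisc (g k)"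
    and gpart: "\<And>k z. z \<in> polydisc \<Longrightarrow> g k z = complex_partial k f z"
begin

lemma continuous_on_scaled: "z \<in> cpolydisc \<Longrightarrow> continuous_on {0..1} (\<lambda>r. f (r *\<^sub>R z))"
proof (rule continuous_on_compose2[OF cont])
  assume z: "z \<in> cpolydisc"
  show "(\<lambda>r. r *\<^sub>R z) ` {0..1} \<subseteq> cpolydisc"
  proof
    fix y assume "y \<in> (\<lambda>r. r *\<^sub>R z) ` {0..1}"
    then obtain r where r: "y = r *\<^sub>R z" "r \<in> {0..1}" by blast
    then show "y \<in> cpolydisc" using z
      by (auto simp: cpolydisc_def intro: mult_le_one)
  qed
qed (auto intro!: continuous_intros)

lemma cbound: 
  assumes z: "z \<in> cpolydisc"
  shows "cmod (f z) \<le> 1"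
proof -
  have "\<forall>\<^sub>F r in at_left 1. cmod (f (r *\<^sub>R z)) - 1 \<le> 0"
    using bound[OF cpolydisc_scale[OF z]] by (intro eventually_at_left_1) (simp add: less_imp_le)
  moreover have "continuous_on {0..1} (\<lambda>r. cmod (f (r *\<^sub>R z)) - 1)"
    by (intro continuous_intros continuous_on_scaled z)
  ultimately show ?thesis using nonpos_at_1 by fastforce
qed

text \<open>The disc of points \<open>a + l *s v\<close> may lie in the boundary, where
  \<open>f\<close> is merely continuous; its dilates lie inside, where the slice is
  holomorphic.\<close>

lemma schwarz_pick:
  assumes cp: "\<And>l. cmod l \<le> 1 \<Longrightarrow> a + l *s v \<in> cpolydisc" and l: "cmod l < 1"
  shows "(1 - (cmod l)\<^sup>2) * (1 - cmod (f a)) \<le> 2 * (1 - (cmod (f (a + l *s v)))\<^sup>2)"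
    and "cmod (f (a + l *s v) - f a) * (1 - cmod l) \<le> cmod l * (1 - (cmod (f a))\<^sup>2)"
proof -
  have a: "a \<in> cpolydisc" using cp[of 0] by simp
  have al: "a + l *s v \<in> cpolydisc" using cp[of l] l by simp
  note C = continuous_on_scaled[OF a] continuous_on_scaled[OF al]
  have "(1 - (cmod l)\<^sup>2) * (1 - cmod (f (r *\<^sub>R a))) \<le> 2 * (1 - (cmod (f (r *\<^sub>R (a + l *s v))))\<^sup>2) \<and>
     cmod (f (r *\<^sub>R (a + l *s v)) - f (r *\<^sub>R a)) * (1 - cmod l) \<le> cmod l * (1 - (cmod (f (r *\<^sub>R a)))\<^sup>2)"
    if r: "0 < r" "r < 1" for r
  proof -
    have eq: "r *\<^sub>R (a + l *s v) = r *\<^sub>R a + l *s (r *\<^sub>R v)" for l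
      by (simp add: vec_eq_iff algebra_simps)
    have inp: "r *\<^sub>R a + l *s (r *\<^sub>R v) \<in> polydisc" if "cmod l < 1" for l
      using cpolydisc_scale[OF cp[of l], of r] r that by (simp add: eq)
    have h: "(\<lambda>l. f (r *\<^sub>R a + l *s (r *\<^sub>R v))) holomorphic_on ball 0 1"
      by (rule holomorphic_several_slice[OF hol]) (use inp in auto)
    from schwarz_pick_disc[OF h _ l] bound[OF inp] show ?thesis by (simp add: eq)
  qed
  then have ev: "\<forall>\<^sub>F r in at_left 1. (1 - (cmod l)\<^sup>2) * (1 - cmod (f (r *\<^sub>R a))) - 2 * (1 - (cmod (f (r *\<^sub>R (a + l *s v))))\<^sup>2) \<le> 0"
    "\<forall>\<^sub>F r in at_left 1. cmod (f (r *\<^sub>R (a + l *s v)) - f (r *\<^sub>R a)) * (1 - cmod l) - cmod l * (1 - (cmod (f (r *\<^sub>R a)))\<^sup>2) \<le> 0"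
    by (auto intro!: eventually_at_left_1)
  show "(1 - (cmod l)\<^sup>2) * (1 - cmod (f a)) \<le> 2 * (1 - (cmod (f (a + l *s v)))\<^sup>2)"
  proof -
    have "continuous_on {0..1} (\<lambda>r. (1 - (cmod l)\<^sup>2) * (1 - cmod (f (r *\<^sub>R a))) - 2 * (1 - (cmod (f (r *\<^sub>R (a + l *s v))))\<^sup>2))"
      by (intro continuous_intros C)
    from nonpos_at_1[OF this ev(1)] show ?thesis by simp
  qed
  show "cmod (f (a + l *s v) - f a) * (1 - cmod l) \<le> cmod l * (1 - (cmod (f a))\<^sup>2)"
  proof -
    have "continuous_on {0..1} (\<lambda>r. cmod (f (r *\<^sub>R (a + l *s v)) - f (r *\<^sub>R a)) * (1 - cmod l) - cmod l * (1 - (cmod (f (r *\<^sub>R a)))\<^sup>2))"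
      by (intro continuous_intros C)
    from nonpos_at_1[OF this ev(2)] show ?thesis by simp
  qed
qed

lemma has_derivative_partials:
  assumes z: "z \<in> polydisc"
  shows "(f has_derivative (\<lambda>v. \<Sum>k\<in>UNIV. g k z * v $ k)) (at z)"
proof -
  obtain D where D: "(f has_derivative D) (at z)" "\<And>c v. D (c *s v) = c * D v"
    using hol z unfolding holomorphic_several_on_def by meson
  have Dax: "D (axis k 1) = g k z" for k
  proof -
    have up: "(\<chi> i. if i = k then w else z $ i) = (z - (z $ k) *s axis k 1) + w *s axis k 1" for w
      by (simp add: vec_eq_iff axis_def)
    have lin: "linear (\<lambda>h::complex. h *s (axis k 1 :: complex ^ 'n))"
      by (rule linearI) (auto simp: vec_eq_iff algebra_simps)
    then have "((\<lambda>w. w *s axis k (1::complex)) has_derivative (\<lambda>h. h *s axis k 1)) (at (z $ k))"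
      by (simp add: linear_conv_bounded_linear bounded_linear_imp_has_derivative)
    then have "((\<lambda>w. (\<chi> i. if i = k then w else z $ i)) has_derivative (\<lambda>h. h *s axis k 1)) (at (z $ k))"
      unfolding up by (auto intro!: derivative_eq_intros)
    moreover have "(\<chi> i. if i = k then z $ k else z $ i) = z" by (simp add: vec_eq_iff)
    ultimately have "((\<lambda>w. f (\<chi> i. if i = k then w else z $ i)) has_derivative (\<lambda>h. D (h *s axis k 1))) (at (z $ k))"
      using has_derivative_compose[of "\<lambda>w. (\<chi> i. if i = k then w else z $ i)" _ "z $ k" UNIV f D] D(1) by simp
    moreover have "(\<lambda>h. D (h *s axis k 1)) = (*) (D (axis k 1))"
      by (simp add: D(2) fun_eq_iff mult.commute)
    ultimately have "((\<lambda>w. f (\<chi> i. if i = k then w else z $ i)) has_field_derivative D (axis k 1)) (at (z $ k))"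
      by (simp add: has_field_derivative_def)
    then show ?thesis using gpart[OF z] by (simp add: complex_partial_def DERIV_imp_deriv)
  qed
  have "D v = (\<Sum>k\<in>UNIV. v $ k * D (axis k 1))" for v
  proof -
    have "v = (\<Sum>k\<in>UNIV. (v $ k) *s axis k 1)"
      by (simp add: vec_eq_iff axis_def if_distrib[of "\<lambda>x. _ * x"] cong: if_cong)
    then have "D v = D (\<Sum>k\<in>UNIV. (v $ k) *s axis k 1)" by simp
    also have "\<dots> = (\<Sum>k\<in>UNIV. D ((v $ k) *s axis k 1))"
      using has_derivative_bounded_linear[OF D(1)] by (simp add: bounded_linear.linear linear_sum)
    finally show ?thesis by (simp add: D(2))
  qed
  then have "D = (\<lambda>v. \<Sum>k\<in>UNIV. g k z * v $ k)" unfolding Dax by (intro ext) (simp only: mult.commute)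
  then show ?thesis using D(1) by simp
qed

lemma convex_polydisc: "convex (polydisc :: (complex ^ 'n) set)"
proof -
  have "polydisc = (\<Inter>k\<in>UNIV. (\<lambda>z::complex^'n. z $ k) -` ball 0 1)" by (auto simp: polydisc_def)
  also have "convex \<dots>"
    by (intro convex_INT convex_linear_vimage convex_ball linearI) auto
  finally show ?thesis .
qed

text \<open>The mean value inequality along a segment, for \<open>f\<close> minus a fixed linear
  form. With \<open>c\<close> the values of \<open>g\<close> at one point it is a first order
  expansion with uniform error; with \<open>c = 0\<close> it is a Lipschitz bound.\<close>

lemma mean_value_interior:
  assumes U: "convex U" and c: "\<And>u k. u \<in> U \<Longrightarrow> u \<in> cpolydisc \<Longrightarrow> cmod (g k u - c k) \<le> e"
    and w: "w \<in> U" "w \<in> polydisc" and w': "w' \<in> U" "w' \<in> polydisc"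
  shows "cmod (f w - f w' - (\<Sum>k\<in>UNIV. c k * (w $ k - w' $ k))) \<le> e * (\<Sum>k\<in>UNIV. cmod (w $ k - w' $ k))"
proof -
  let ?p = "\<lambda>t. w' + t *\<^sub>R (w - w')"
  let ?F = "\<lambda>t. f (?p t) - (\<Sum>k\<in>UNIV. c k * (?p t $ k))"
  let ?D = "\<lambda>t (h::real). (\<Sum>k\<in>UNIV. g k (?p t) * (h *\<^sub>R (w - w')) $ k) - (\<Sum>k\<in>UNIV. c k * (h *\<^sub>R (w - w')) $ k)"
  let ?B = "e * (\<Sum>k\<in>UNIV. cmod (w $ k - w' $ k))"
  have p: "?p t \<in> U \<inter> polydisc" if "t \<in> {0..1}" for t
  proof -
    have "convex (U \<inter> polydisc)" using U convex_polydisc by (rule convex_Int)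
    then have "(1 - t) *\<^sub>R w' + t *\<^sub>R w \<in> U \<inter> polydisc"
      using w w' that by (intro convexD) auto
    then show ?thesis by (simp add: algebra_simps)
  qed
  have "norm (?F 1 - ?F 0) \<le> ?B * norm (1 - 0 :: real)"
  proof (rule differentiable_bound[of "{0..1::real}" ?F ?D])
    fix t :: real assume t: "t \<in> {0..1}"
    have dp: "(?p has_derivative (\<lambda>h. h *\<^sub>R (w - w'))) (at t within {0..1})"
      by (auto intro!: derivative_eq_intros)
    have "((\<lambda>t. f (?p t)) has_derivative (\<lambda>h. \<Sum>k\<in>UNIV. g k (?p t) * (h *\<^sub>R (w - w')) $ k)) (at t within {0..1})"
      using p[OF t] by (intro has_derivative_compose[OF dp] has_derivative_partials) auto
    moreover have "((\<lambda>t. \<Sum>k\<in>UNIV. c k * (?p t $ k)) has_derivative (\<lambda>h. \<Sum>k\<in>UNIV. c k * (h *\<^sub>R (w - w')) $ k)) (at t within {0..1})"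
    proof (intro has_derivative_sum has_derivative_mult_right)
      fix k
      have "bounded_linear (\<lambda>z::complex^'n. z $ k)" by (rule bounded_linear_vec_nth)
      from bounded_linear.has_derivative[OF this dp]
      show "((\<lambda>t. ?p t $ k) has_derivative (\<lambda>h. (h *\<^sub>R (w - w')) $ k)) (at t within {0..1})" .
    qed
    ultimately show "(?F has_derivative ?D t) (at t within {0..1})" by (rule has_derivative_diff)
    show "onorm (?D t) \<le> ?B"
    proof (rule onorm_le)
      fix h :: real
      have "?D t h = (\<Sum>k\<in>UNIV. (g k (?p t) - c k) * (h *\<^sub>R (w - w')) $ k)"
        by (simp add: sum_subtractf[symmetric] left_diff_distrib scaleR_diff_right)
      also have "norm \<dots> \<le> (\<Sum>k\<in>UNIV. e * (\<bar>h\<bar> * cmod (w $ k - w' $ k)))"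
      proof (rule sum_norm_le)
        fix k
        have "?p t \<in> cpolydisc" using p[OF t] polydisc_subset_cpolydisc by auto
        then have "cmod (g k (?p t) - c k) \<le> e" using c[of "?p t" k] p[OF t] by simp
        then have "cmod (g k (?p t) - c k) * (\<bar>h\<bar> * cmod (w $ k - w' $ k)) \<le> e * (\<bar>h\<bar> * cmod (w $ k - w' $ k))"
          by (intro mult_right_mono) auto
        then show "norm ((g k (?p t) - c k) * (h *\<^sub>R (w - w')) $ k) \<le> e * (\<bar>h\<bar> * cmod (w $ k - w' $ k))"
          by (simp add: norm_mult mult.left_commute)
      qed
      also have "\<dots> = ?B * norm h" by (simp add: sum_distrib_left sum_distrib_right mult_ac)
      finally show "norm (?D t h) \<le> ?B * norm h" .
    qed
  qed auto
  then show ?thesis by (simp add: sum_subtractf right_diff_distrib algebra_simps)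
qed

text \<open>\<open>U\<close> is open so that the dilates of both points still belong to it for
  \<open>r\<close> close to 1.\<close>

lemma mean_value:
  assumes U: "convex U" "open U" and c: "\<And>u k. u \<in> U \<Longrightarrow> u \<in> cpolydisc \<Longrightarrow> cmod (g k u - c k) \<le> e"
    and w: "w \<in> U" "w \<in> cpolydisc" and w': "w' \<in> U" "w' \<in> cpolydisc"
  shows "cmod (f w - f w' - (\<Sum>k\<in>UNIV. c k * (w $ k - w' $ k))) \<le> e * (\<Sum>k\<in>UNIV. cmod (w $ k - w' $ k))"
proof -
  let ?h = "\<lambda>r. cmod (f (r *\<^sub>R w) - f (r *\<^sub>R w') - (\<Sum>k\<in>UNIV. c k * ((r *\<^sub>R w) $ k - (r *\<^sub>R w') $ k)))
    - e * (\<Sum>k\<in>UNIV. cmod ((r *\<^sub>R w) $ k - (r *\<^sub>R w') $ k))"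
  have ev: "\<forall>\<^sub>F r in at_left (1::real). r *\<^sub>R x \<in> U" if "x \<in> U" for x
  proof -
    have "((\<lambda>r. r *\<^sub>R x) \<longlongrightarrow> 1 *\<^sub>R x) (at_left 1)" by (intro tendsto_intros)
    then show ?thesis using topological_tendstoD[OF _ U(2), of "\<lambda>r. r *\<^sub>R x"] that by simp
  qed
  have "\<forall>\<^sub>F r in at_left (1::real). 0 < r \<and> r < 1" by (intro eventually_at_left_1) auto
  with ev[OF w(1)] ev[OF w'(1)] have "\<forall>\<^sub>F r in at_left 1. ?h r \<le> 0"
  proof eventually_elim
    case (elim r)
    then show ?case
      using mean_value_interior[OF U(1) c, of "r *\<^sub>R w" "r *\<^sub>R w'"]
        cpolydisc_scale[OF w(2), of r] cpolydisc_scale[OF w'(2), of r] by (auto simp del: vector_scaleR_component)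
  qed
  then have "?h 1 \<le> 0"
    by (rule nonpos_at_1[rotated])
       (intro continuous_intros continuous_on_scaled w w')
  then show ?thesis by simp
qed

lemma partials_near:
  assumes z: "z \<in> cpolydisc" and e: "e > 0"
  obtains d where "d > 0" "\<And>u k. u \<in> ball z d \<Longrightarrow> u \<in> cpolydisc \<Longrightarrow> cmod (g k u - g k z) \<le> e"
proof -
  have "\<exists>d>0. \<forall>u\<in>cpolydisc. dist u z < d \<longrightarrow> dist (g k u) (g k z) < e" for k
    using gcont[of k] z e unfolding continuous_on_iff by blast
  then obtain d where d: "\<And>k. d k > 0" "\<And>k u. u\<in>cpolydisc \<Longrightarrow> dist u z < d k \<Longrightarrow> dist (g k u) (g k z) < e"
    by metis
  define m where "m = Min (range d)"
  have "m > 0" using d(1) by (auto simp: m_def)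
  moreover have "cmod (g k u - g k z) \<le> e" if "u \<in> ball z m" "u \<in> cpolydisc" for u k
  proof -
    have "m \<le> d k" by (simp add: m_def)
    then show ?thesis using d(2)[of u k] that by (auto simp: dist_norm norm_minus_commute)
  qed
  ultimately show ?thesis using that by blast
qed

text \<open>If a coordinate slice through \<open>z\<close> had modulus one at its centre it would be constant, by the
  second Schwarz-Pick estimate, and the partial derivative at \<open>z\<close> would vanish.\<close>

lemma slice_center_less_1:
  assumes z: "z \<in> cpolydisc" and nz: "g k z \<noteq> 0"
  shows "cmod (f (\<chi> i. if i = k then 0 else z $ i)) < 1"
proof (rule ccontr)
  let ?u = "\<lambda>l. (\<chi> i. if i = k then l else z $ i)"
  have u: "?u l \<in> cpolydisc" if "cmod l \<le> 1" for l using z that by (auto simp: cpolydisc_def)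
  assume "\<not> ?thesis"
  then have one: "cmod (f (?u 0)) = 1" using cbound[OF u[of 0]] by simp
  have eq: "?u 0 + l *s axis k 1 = ?u l" for l by (simp add: vec_eq_iff axis_def)
  have const: "f (?u l) = f (?u 0)" if "cmod l < 1" for l
  proof -
    have "cmod (f (?u l) - f (?u 0)) * (1 - cmod l) \<le> 0"
      using schwarz_pick(2)[of "?u 0" "axis k 1" l] u that one by (simp add: eq)
    then have "cmod (f (?u l) - f (?u 0)) \<le> 0" using that by (simp add: mult_le_0_iff)
    then show ?thesis by simp
  qed
  \<comment> \<open>Any interior point other than \<open>z $ k\<close> would do: the segment
    \<open>y\<close> from \<open>z $ k\<close> to \<open>m\<close> lies in the open disc except
    perhaps for its start, whether or not \<open>z $ k\<close> is unimodular.\<close>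
  define m :: complex where "m = (if z $ k = 0 then 1/2 else 0)"
  have m: "m \<noteq> z $ k" "cmod m < 1" by (auto simp: m_def)
  have zk: "cmod (z $ k) \<le> 1" using z by (simp add: cpolydisc_def)
  define y where "y t = z $ k + of_real t * (m - z $ k)" for t :: real
  have y: "cmod (y t) < 1" if t: "0 < t" "t \<le> 1" for t
  proof -
    have "y t = of_real (1 - t) * z $ k + of_real t * m" by (simp add: y_def algebra_simps)
    then have "cmod (y t) \<le> (1 - t) * cmod (z $ k) + t * cmod m"
      using t by (metis norm_triangle_le norm_mult norm_of_real abs_of_nonneg diff_ge_0_iff_ge less_imp_le order_refl)
    also have "\<dots> < (1 - t) * 1 + t * 1"
      using t m zk by (intro add_le_less_mono mult_left_mono) auto
    finally show ?thesis by simp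
  qed
  have uz: "?u (z $ k) = z" by (simp add: vec_eq_iff)
  \<comment> \<open>Constancy is known on the open slice only; continuity along the segment carries
    it to \<open>z\<close> itself.\<close>
  have fz: "f z = f (?u 0)"
  proof (rule ccontr)
    assume ne: "f z \<noteq> f (?u 0)"
    have "continuous_on {0..1} (\<lambda>t. f (?u (y t)))"
    proof (rule continuous_on_compose2[OF cont])
      show "continuous_on {0..1} (\<lambda>t. ?u (y t))"
        unfolding y_def
      proof (rule continuous_on_vec_lambda)
        fix i
        show "continuous_on {0..1} (\<lambda>t. if i = k then z $ k + of_real t * (m - z $ k) else z $ i)"
          by (cases "i = k") (auto intro!: continuous_intros)
      qed
      show "(\<lambda>t. ?u (y t)) ` {0..1} \<subseteq> cpolydisc"
      proof
        fix x assume "x \<in> (\<lambda>t. ?u (y t)) ` {0..1}"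
        then obtain t where t: "x = ?u (y t)" "0 \<le> t" "t \<le> 1" by auto
        have "cmod (y t) \<le> 1" using y[of t] t zk by (cases "t = 0") (auto simp: y_def less_imp_le)
        then show "x \<in> cpolydisc" unfolding t(1) by (rule u)
      qed
    qed
    then have "continuous_on {0..1} (\<lambda>t. cmod (f (?u 0) - f z) - cmod (f (?u (y (1 - t))) - f z))"
      by (intro continuous_intros continuous_on_compose2[where g = "\<lambda>t. f (?u (y t))" and f = "\<lambda>t. 1 - t"]) auto
    then have *: "continuous_on {0..1} (\<lambda>t. cmod (f (?u 0) - f z) - cmod (f (?u (y (1 - t))) - f z))" .
    have "\<forall>\<^sub>F r in at_left (1::real). cmod (f (?u 0) - f z) - cmod (f (?u (y (1 - r))) - f z) \<le> 0"
      using const[OF y] by (intro eventually_at_left_1) auto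
    from nonpos_at_1[OF * this] have "cmod (f (?u 0) - f z) \<le> cmod (f (?u (y 0)) - f z)" by (simp cong: if_cong)
    also have "y 0 = z $ k" by (simp add: y_def)
    finally show False using ne by (simp add: uz)
  qed
  have "cmod (g k z) / 2 > 0" using nz by simp
  then obtain d where d: "d > 0" "\<And>u j. u \<in> ball z d \<Longrightarrow> u \<in> cpolydisc \<Longrightarrow> cmod (g j u - g j z) \<le> cmod (g k z) / 2"
    using partials_near[OF z] by metis
  define t where "t = min 1 (d / 4)"
  have t: "0 < t" "t \<le> 1" "t \<le> d / 4" using d(1) by (auto simp: t_def)
  have diff: "?u (y t) - z = axis k (y t - z $ k)" by (simp add: vec_eq_iff axis_def)
  have "norm (?u (y t) - z) = cmod (y t - z $ k)"
    unfolding diff by (simp add: norm_eq_sqrt_inner inner_axis_axis)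
  also have "\<dots> = t * cmod (m - z $ k)" using t by (simp add: y_def norm_mult)
  also have "\<dots> \<le> t * 2" using t m zk norm_triangle_ineq4[of m "z $ k"] by (intro mult_left_mono) auto
  also have "\<dots> < d" using t d(1) by simp
  finally have inb: "?u (y t) \<in> ball z d" by (simp add: dist_norm norm_minus_commute)
  \<comment> \<open>As \<open>f\<close> does not change along the segment, the expansion leaves only
    its linear term, which cannot be bounded by half of itself.\<close>
  have "cmod (f (?u (y t)) - f z - (\<Sum>j\<in>UNIV. g j z * (?u (y t) $ j - z $ j)))
      \<le> cmod (g k z) / 2 * (\<Sum>j\<in>UNIV. cmod (?u (y t) $ j - z $ j))"
    using inb u[of "y t"] y[of t] t d z by (intro mean_value[of "ball z d"]) (auto simp: less_imp_le)
  also have "f (?u (y t)) = f z" using const[OF y[of t]] t fz by simp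
  also have "(\<Sum>j\<in>UNIV. g j z * (?u (y t) $ j - z $ j)) = g k z * (y t - z $ k)"
    by (subst sum.remove[of UNIV k]) (auto intro!: sum.neutral)
  also have "(\<Sum>j\<in>UNIV. cmod (?u (y t) $ j - z $ j)) = cmod (y t - z $ k)"
    by (subst sum.remove[of UNIV k]) (auto intro!: sum.neutral)
  finally have "cmod (g k z) * cmod (y t - z $ k) \<le> cmod (g k z) / 2 * cmod (y t - z $ k)"
    by (simp add: norm_mult)
  moreover have "cmod (y t - z $ k) > 0" using t m by (simp add: y_def)
  ultimately show False using nz by simp
qed

text \<open>This is Hopf's lemma: along the radius of the slice that scales the coordinates in \<open>K\<close> the
  modulus would otherwise decrease at a linear rate, although the derivative vanishes.\<close>

lemma zeroed_unimodular:
  assumes z: "z \<in> cpolydisc" and one: "cmod (f z) = 1" and K: "\<And>k. k \<in> K \<Longrightarrow> g k z = 0"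
  shows "cmod (f (\<chi> i. if i \<in> K then 0 else z $ i)) = 1"
proof (rule ccontr)
  define a where "a = (\<chi> i. if i \<in> K then 0 else z $ i)"
  define v where "v = z - a"
  have cp: "a + l *s v \<in> cpolydisc" if "cmod l \<le> 1" for l
    using z that by (auto simp: cpolydisc_def a_def v_def norm_mult intro: mult_le_one)
  assume "\<not> ?thesis"
  then have less: "cmod (f a) < 1" using cbound[OF cp[of 0]] by (simp add: a_def)
  \<comment> \<open>The chain at the end produces a factor 4, two from Schwarz-Pick and two from
    \<open>1 + cmod (f w) \<le> 2\<close>; the 8 then bounds a positive number by half of
    itself.\<close>
  define e where "e = (1 - cmod (f a)) / (8 * real CARD('n))"
  have e: "e > 0" using less by (simp add: e_def)
  obtain d where d: "d > 0" "\<And>u j. u \<in> ball z d \<Longrightarrow> u \<in> cpolydisc \<Longrightarrow> cmod (g j u - g j z) \<le> e"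
    using partials_near[OF z e] by metis
  define t where "t = min (1/2) (d / (2 * (norm v + 1)))"
  have t: "0 < t" "t < 1" using d(1) by (auto simp: t_def add_nonneg_pos)
  have tv: "t * norm v < d"
  proof -
    have "t * norm v \<le> d / (2 * (norm v + 1)) * norm v" by (intro mult_right_mono) (auto simp: t_def)
    also have "\<dots> = d * (norm v / (2 * (norm v + 1)))" by simp
    also have "\<dots> < d * 1"
    proof (rule mult_strict_left_mono)
      have *: "x / (2 * (x + 1)) < 1" if "x \<ge> 0" for x :: real
        using that by (simp add: divide_less_eq)
      show "norm v / (2 * (norm v + 1)) < 1" by (rule *) simp
    qed (use d(1) in simp)
    finally show ?thesis by simp
  qed
  define w where "w = a + of_real (1 - t) *s v"
  have cl: "cmod (of_real (1 - t)) = 1 - t" using t by (simp del: of_real_diff)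
  have wc: "w \<in> cpolydisc" unfolding w_def using cl t by (intro cp) simp
  have zw: "z - w = t *\<^sub>R v" by (simp add: vec_eq_iff w_def v_def) (simp add: algebra_simps scaleR_conv_of_real)
  have inb: "w \<in> ball z d" using tv t by (simp add: dist_norm zw)
  have "cmod (f z - f w - (\<Sum>j\<in>UNIV. g j z * (z $ j - w $ j))) \<le> e * (\<Sum>j\<in>UNIV. cmod (z $ j - w $ j))"
    using inb wc d z by (intro mean_value[of "ball z d"]) auto
  \<comment> \<open>\<open>v\<close> vanishes outside \<open>K\<close> and the partials vanish on
    \<open>K\<close>, so no linear term is left and \<open>f\<close> moves by no more than a small
    multiple of \<open>t\<close>.\<close>
  also have "(\<Sum>j\<in>UNIV. g j z * (z $ j - w $ j)) = 0"
  proof (rule sum.neutral, rule ballI)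
    fix j
    have "z $ j - w $ j = t *\<^sub>R v $ j" using zw by (metis vector_minus_component vector_scaleR_component)
    then show "g j z * (z $ j - w $ j) = 0" using K[of j] by (cases "j \<in> K") (auto simp: v_def a_def)
  qed
  also have "(\<Sum>j\<in>UNIV. cmod (z $ j - w $ j)) \<le> (\<Sum>j\<in>(UNIV::'n set). t)"
  proof (rule sum_mono)
    fix j
    have "z $ j - w $ j = t *\<^sub>R v $ j" using zw by (metis vector_minus_component vector_scaleR_component)
    moreover have "cmod (v $ j) \<le> 1" using z by (auto simp: v_def a_def cpolydisc_def)
    ultimately show "cmod (z $ j - w $ j) \<le> t" using t mult_left_mono[of "cmod (v $ j)" 1 t] by simp
  qed
  finally have fd: "cmod (f z - f w) \<le> e * (real CARD('n) * t)" using e by simp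
  have "t * (1 - cmod (f a)) \<le> (1 - (1 - t)\<^sup>2) * (1 - cmod (f a))"
    using t less by (intro mult_right_mono) (auto simp: power2_eq_square algebra_simps)
  also have "\<dots> \<le> 2 * (1 - (cmod (f w))\<^sup>2)"
    using schwarz_pick(1)[of a v "of_real (1 - t)"] cp cl t by (simp add: w_def)
  also have "1 - (cmod (f w))\<^sup>2 = (1 + cmod (f w)) * (1 - cmod (f w))" by (simp add: power2_eq_square algebra_simps)
  also have "2 * \<dots> \<le> 2 * (2 * (1 - cmod (f w)))"
    using cbound[OF wc] by (intro mult_left_mono mult_right_mono) auto
  also have "1 - cmod (f w) \<le> cmod (f z - f w)" using one norm_triangle_ineq2[of "f z" "f w"] by simp
  also have "\<dots> \<le> e * (real CARD('n) * t)" by (rule fd)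
  finally have "t * (1 - cmod (f a)) \<le> 4 * (e * (real CARD('n) * t))" by simp
  also have "\<dots> = t * (1 - cmod (f a)) / 2" by (simp add: e_def)
  finally show False using t less by (simp add: mult_le_0_iff)
qed

text \<open>Phrased with one large constant \<open>M\<close> so that finitely many instances can be combined.\<close>

lemma boundary_distance_near:
  assumes z: "z \<in> cpolydisc" and nz: "g k z \<noteq> 0"
  shows "\<forall>\<^sub>F M in at_top. \<forall>w \<in> polydisc \<inter> ball z (1 / M). 1 - (cmod (w $ k))\<^sup>2 \<le> M * (1 - cmod (f w))"
proof -
  let ?z0 = "\<lambda>w. (\<chi> i. if i = k then 0 else w $ i) :: complex ^ 'n"
  \<comment> \<open>Half the gap at the centre of the slice through \<open>z\<close>; by continuity
    the slices through nearby \<open>w\<close> keep the gap \<open>e\<close> at their centres. The 4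
    in \<open>4 / e\<close> is 2 from Schwarz-Pick times 2 from
    \<open>1 + cmod (f w)\<close>.\<close>
  define e where "e = (1 - cmod (f (?z0 z))) / 2"
  have e: "e > 0" using slice_center_less_1[OF z nz] by (simp add: e_def)
  have z0c: "?z0 w \<in> cpolydisc" if "w \<in> cpolydisc" for w using that by (auto simp: cpolydisc_def)
  have "continuous_on cpolydisc (\<lambda>w. f (?z0 w))"
  proof (rule continuous_on_compose2[OF cont])
    show "continuous_on cpolydisc ?z0"
    proof (rule continuous_on_vec_lambda)
      fix i
      show "continuous_on cpolydisc (\<lambda>w. if i = k then 0 else w $ i)"
        by (cases "i = k") (auto intro!: continuous_intros)
    qed
  qed (use z0c in auto)
  then obtain d where d: "d > 0" "\<And>w. w \<in> cpolydisc \<Longrightarrow> dist w z < d \<Longrightarrow> dist (f (?z0 w)) (f (?z0 z)) < e"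
    using z e unfolding continuous_on_iff by blast
  have "\<forall>w \<in> polydisc \<inter> ball z (1 / M). 1 - (cmod (w $ k))\<^sup>2 \<le> M * (1 - cmod (f w))" if M: "M \<ge> max (1 / d) (4 / e)" for M
  proof
    fix w assume w: "w \<in> polydisc \<inter> ball z (1 / M)"
    have "1 / d > 0" using d(1) by simp
    then have Mp: "M > 0" by (rule less_le_trans) (use M in simp)
    have "1 / M \<le> d" using M Mp d(1) by (simp add: field_simps)
    then have dw: "dist w z < d" using w by (simp add: dist_commute)
    have wc: "w \<in> cpolydisc" and wp: "w \<in> polydisc" using w polydisc_subset_cpolydisc by auto
    have "cmod (f (?z0 w)) \<le> cmod (f (?z0 z)) + e"
      using d(2)[OF wc dw] norm_triangle_ineq2[of "f (?z0 w)" "f (?z0 z)"] by (simp add: dist_norm)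
    then have ew: "e \<le> 1 - cmod (f (?z0 w))" by (simp add: e_def field_simps)
    have eq: "?z0 w + l *s axis k 1 = (\<chi> i. if i = k then l else w $ i)" for l by (simp add: vec_eq_iff axis_def)
    have in_c: "(\<chi> i. if i = k then l else w $ i) \<in> cpolydisc" if "cmod l \<le> 1" for l
      using that wc by (auto simp: cpolydisc_def)
    have weq: "(\<chi> i. if i = k then w $ k else w $ i) = w" by (simp add: vec_eq_iff)
    have wk: "cmod (w $ k) < 1" using wp by (simp add: polydisc_def)
    have "(1 - (cmod (w $ k))\<^sup>2) * e \<le> (1 - (cmod (w $ k))\<^sup>2) * (1 - cmod (f (?z0 w)))"
      using ew wk by (intro mult_left_mono) (auto simp: abs_square_le_1)
    also have "\<dots> \<le> 2 * (1 - (cmod (f w))\<^sup>2)"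
      using schwarz_pick(1)[of "?z0 w" "axis k 1" "w $ k"] in_c wk by (simp add: eq weq)
    also have "1 - (cmod (f w))\<^sup>2 = (1 + cmod (f w)) * (1 - cmod (f w))"
      by (simp add: power2_eq_square algebra_simps)
    also have "2 * \<dots> \<le> 2 * (2 * (1 - cmod (f w)))"
      using bound[OF wp] by (intro mult_left_mono mult_right_mono) auto
    finally have "1 - (cmod (w $ k))\<^sup>2 \<le> 4 / e * (1 - cmod (f w))" using e by (simp add: field_simps)
    also have "\<dots> \<le> M * (1 - cmod (f w))" using bound[OF wp] M by (intro mult_right_mono) auto
    finally show "1 - (cmod (w $ k))\<^sup>2 \<le> M * (1 - cmod (f w))" .
  qed
  then show ?thesis unfolding eventually_at_top_linorder by blast
qed

text \<open>The two points differ in coordinate \<open>k\<close> alone, so only the term with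
  \<open>g k z\<close> survives in the first order expansion, and an error of half its size leaves a
  lower bound for the difference of the values. This yields the disc for the spare
  coordinate.\<close>

lemma coordinate_injective_near:
  assumes z: "z \<in> cpolydisc" and nz: "g k z \<noteq> 0"
  shows "\<forall>\<^sub>F M in at_top. \<forall>w \<in> polydisc \<inter> ball z (1 / M). \<forall>w' \<in> polydisc \<inter> ball z (1 / M).
    (\<forall>l. l \<noteq> k \<longrightarrow> w $ l = w' $ l) \<longrightarrow> cmod (w $ k - w' $ k) \<le> M * cmod (f w - f w')"
proof -
  have "cmod (g k z) / 2 > 0" using nz by simp
  then obtain d where d: "d > 0" "\<And>u j. u \<in> ball z d \<Longrightarrow> u \<in> cpolydisc \<Longrightarrow> cmod (g j u - g j z) \<le> cmod (g k z) / 2"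
    using partials_near[OF z] by metis
  have "\<forall>w \<in> polydisc \<inter> ball z (1 / M). \<forall>w' \<in> polydisc \<inter> ball z (1 / M).
    (\<forall>l. l \<noteq> k \<longrightarrow> w $ l = w' $ l) \<longrightarrow> cmod (w $ k - w' $ k) \<le> M * cmod (f w - f w')"
    if M: "M \<ge> max (1 / d) (2 / cmod (g k z))" for M
  proof (intro ballI impI)
    fix w w' assume w: "w \<in> polydisc \<inter> ball z (1 / M)" "w' \<in> polydisc \<inter> ball z (1 / M)"
      and same: "\<forall>l. l \<noteq> k \<longrightarrow> w $ l = w' $ l"
    have "1 / d > 0" using d(1) by simp
    then have Mp: "M > 0" by (rule less_le_trans) (use M in simp)
    have "1 / M \<le> d" using M Mp d(1) by (simp add: field_simps)
    then have "w \<in> ball z d" "w' \<in> ball z d" using w by auto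
    then have "cmod (f w - f w' - (\<Sum>j\<in>UNIV. g j z * (w $ j - w' $ j))) \<le> cmod (g k z) / 2 * (\<Sum>j\<in>UNIV. cmod (w $ j - w' $ j))"
      using w d(2) polydisc_subset_cpolydisc by (intro mean_value[of "ball z d"]) auto
    also have "(\<Sum>j\<in>UNIV. g j z * (w $ j - w' $ j)) = g k z * (w $ k - w' $ k)"
      using same by (subst sum.remove[of UNIV k]) (auto intro!: sum.neutral)
    also have "(\<Sum>j\<in>UNIV. cmod (w $ j - w' $ j)) = cmod (w $ k - w' $ k)"
      using same by (subst sum.remove[of UNIV k]) (auto intro!: sum.neutral)
    finally have "cmod (g k z * (w $ k - w' $ k)) - cmod (f w - f w') \<le> cmod (g k z) / 2 * cmod (w $ k - w' $ k)"
      using norm_triangle_ineq2[of "g k z * (w $ k - w' $ k)" "f w - f w'"] by (simp add: norm_minus_commute)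
    then have "cmod (g k z) * cmod (w $ k - w' $ k) \<le> 2 * cmod (f w - f w')"
      unfolding norm_mult by simp
    then have "cmod (w $ k - w' $ k) \<le> 2 / cmod (g k z) * cmod (f w - f w')"
      using nz by (simp add: field_simps)
    also have "\<dots> \<le> M * cmod (f w - f w')" using M by (intro mult_right_mono) auto
    finally show "cmod (w $ k - w' $ k) \<le> M * cmod (f w - f w')" .
  qed
  then show ?thesis unfolding eventually_at_top_linorder by blast
qed

lemma away_from_circle_near:
  assumes z: "z \<in> cpolydisc" and less: "cmod (f z) \<noteq> 1"
  shows "\<forall>\<^sub>F M in at_top. \<forall>w \<in> polydisc \<inter> ball z (1 / M). 1 \<le> M * (1 - cmod (f w))"
proof -
  define e where "e = (1 - cmod (f z)) / 2"
  have e: "e > 0" using less cbound[OF z] by (simp add: e_def)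
  obtain d where d: "d > 0" "\<And>w. w \<in> cpolydisc \<Longrightarrow> dist w z < d \<Longrightarrow> dist (f w) (f z) < e"
    using z e cont unfolding continuous_on_iff by blast
  have "\<forall>w \<in> polydisc \<inter> ball z (1 / M). 1 \<le> M * (1 - cmod (f w))" if M: "M \<ge> max (1 / d) (1 / e)" for M
  proof
    fix w assume w: "w \<in> polydisc \<inter> ball z (1 / M)"
    have "1 / d > 0" using d(1) by simp
    then have Mp: "M > 0" by (rule less_le_trans) (use M in simp)
    have "1 / M \<le> d" using M Mp d(1) by (simp add: field_simps)
    then have dw: "dist w z < d" using w by (simp add: dist_commute)
    have wc: "w \<in> cpolydisc" using w polydisc_subset_cpolydisc by auto
    have "cmod (f w) \<le> cmod (f z) + e"
      using d(2)[OF wc dw] norm_triangle_ineq2[of "f w" "f z"] by (simp add: dist_norm)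
    then have ew: "e \<le> 1 - cmod (f w)" by (simp add: e_def field_simps)
    have "1 = 1 / e * e" using e by simp
    also have "\<dots> \<le> M * (1 - cmod (f w))" using ew M e Mp by (intro mult_mono) auto
    finally show "1 \<le> M * (1 - cmod (f w))" .
  qed
  then show ?thesis unfolding eventually_at_top_linorder by blast
qed

end

subsection \<open>The vanishing Carleson condition\<close>

text \<open>Weaker than Hall's theorem, since \<open>i\<close> may be represented by an element of any \<open>S i'\<close> with
  \<open>\<delta> i' \<le> \<delta> i\<close>; a greedy choice in the order of increasing \<open>\<delta>\<close> therefore suffices.\<close>

lemma greedy_representatives:
  fixes \<delta> :: "'a \<Rightarrow> real" and S :: "'a \<Rightarrow> 'b set"
  assumes "finite J" and "\<And>i. i \<in> J \<Longrightarrow> finite (S i)"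
    and "\<And>Q. Q \<subseteq> J \<Longrightarrow> Q \<noteq> {} \<Longrightarrow> card Q \<le> card (\<Union> (S ` Q))"
  shows "\<exists>\<sigma>. inj_on \<sigma> J \<and> (\<forall>i\<in>J. \<exists>i'\<in>J. \<delta> i' \<le> \<delta> i \<and> \<sigma> i \<in> S i')"
  using assms
proof (induction J rule: finite_ranking_induct[where f = \<delta>])
  case (insert x J)
  show ?case
  proof (cases "x \<in> J")
    case True
    then show ?thesis using insert by (simp add: insert_absorb)
  next
    case False
    obtain \<sigma> where \<sigma>: "inj_on \<sigma> J" "\<forall>i\<in>J. \<exists>i'\<in>J. \<delta> i' \<le> \<delta> i \<and> \<sigma> i \<in> S i'"
      using insert.IH insert.prems by (metis insertI2 order_trans subset_insertI)
    have "card (\<sigma> ` J) < card (insert x J)" using insert.hyps False \<sigma>(1) by (simp add: card_image)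
    also have "\<dots> \<le> card (\<Union> (S ` insert x J))" using insert.prems(2)[of "insert x J"] by simp
    finally have "\<not> \<Union> (S ` insert x J) \<subseteq> \<sigma> ` J"
      using insert.hyps by (meson card_mono finite_imageI not_le)
    then obtain k where k: "k \<in> \<Union> (S ` insert x J)" "k \<notin> \<sigma> ` J" by blast
    then obtain i' where i': "i' \<in> insert x J" "k \<in> S i'" by blast
    let ?\<sigma> = "\<sigma>(x := k)"
    have eq: "?\<sigma> i = \<sigma> i" if "i \<in> J" for i using that False by auto
    have "inj_on ?\<sigma> (insert x J)"
      using \<sigma>(1) k(2) False by (auto simp: inj_on_def)
    moreover have "\<exists>i'\<in>insert x J. \<delta> i' \<le> \<delta> i \<and> ?\<sigma> i \<in> S i'" if "i \<in> insert x J" for i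
    proof (cases "i = x")
      case True
      \<comment> \<open>Elements enter in the order of increasing \<delta>, so every member of
        \<open>insert x J\<close> is an admissible \<open>i'\<close> for \<open>x\<close>.\<close>
      then show ?thesis using i' insert.hyps(2) by (intro bexI[of _ i']) auto
    next
      case False
      then show ?thesis using that \<sigma>(2) by auto
    qed
    ultimately show ?thesis by blast
  qed
qed simp

lemma prod_mono_ennreal:
  fixes f g :: "'a \<Rightarrow> ennreal"
  assumes "\<And>i. i \<in> A \<Longrightarrow> f i \<le> g i"
  shows "prod f A \<le> prod g A"
  using assms by (induction A rule: infinite_finite_induct) (auto intro!: mult_mono)

section \<open>Unimodular coordinates and the sets pulled back from Whitney boxes\<close>

definition num_unimodular :: "complex ^ 'n \<Rightarrow> nat" where
  "num_unimodular z = card {k. cmod (z $ k) = 1}"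

text \<open>The box is centred at \<open>\<phi> w\<close> because the mean value inequality is
  applied there; after Fubini \<open>z\<close> is fixed and the centre varies with \<open>w\<close>.
  The restriction to \<open>polydisc\<close> discards the arbitrary values of \<phi>
  outside.\<close>

definition preimage_whitney :: "(complex ^ 'n \<Rightarrow> complex ^ 'n) \<Rightarrow> complex ^ 'n \<Rightarrow> (complex ^ 'n) set" where
  "preimage_whitney \<phi> z = {w \<in> polydisc. z \<in> whitney (\<phi> w)}"

lemma holomorphic_self_map_continuous_on:
  assumes "holomorphic_self_map \<phi>"
  shows "continuous_on polydisc \<phi>"
proof -
  have "continuous_on polydisc (\<lambda>z. \<chi> k. \<phi> z $ k)"
    using assms unfolding holomorphic_self_map_def
    by (intro continuous_on_vec_lambda holomorphic_several_continuous_on) auto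
  then show ?thesis by simp
qed

lemma open_preimage_whitney:
  assumes "holomorphic_self_map \<phi>"
  shows "open (preimage_whitney \<phi> z)"
proof -
  have "{y. z \<in> whitney y} = (\<Inter>k\<in>UNIV. {y. cmod (z $ k - y $ k) < (1 - cmod (y $ k)) / 2})"
    by (auto simp: whitney_def)
  also have "open \<dots>" by (intro open_INT ballI open_Collect_less continuous_intros) auto
  finally have "open (polydisc \<inter> \<phi> -` {y. z \<in> whitney y})"
    by (intro continuous_open_preimage holomorphic_self_map_continuous_on assms) simp_all
  then show ?thesis by (simp add: preimage_whitney_def vimage_def Int_def)
qed

lemma C1_disc_function_components:
  fixes \<phi> :: "complex ^ 'n \<Rightarrow> complex ^ 'n"
  assumes hol: "holomorphic_self_map \<phi>" and C1: "C1_closed_polydisc \<phi>"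
  shows "\<exists>g. \<forall>i. C1_disc_function (\<lambda>w. \<phi> w $ i) (g i)"
proof -
  have "\<forall>k l. \<exists>g. continuous_on cpolydisc g \<and> (\<forall>z\<in>polydisc. g z = complex_partial l (\<lambda>w. \<phi> w $ k) z)"
    using C1 by (simp add: C1_closed_polydisc_def)
  then obtain g where g: "\<And>k l. continuous_on cpolydisc (g k l)"
    "\<And>k l z. z\<in>polydisc \<Longrightarrow> g k l z = complex_partial l (\<lambda>w. \<phi> w $ k) z" by metis
  have "C1_disc_function (\<lambda>w. \<phi> w $ i) (g i)" for i
  proof
    show "holomorphic_several_on (\<lambda>w. \<phi> w $ i) polydisc" using hol by (simp add: holomorphic_self_map_def)
    show "continuous_on cpolydisc (\<lambda>w. \<phi> w $ i)"
      using C1 by (intro continuous_intros) (simp add: C1_closed_polydisc_def)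
    show "cmod (\<phi> z $ i) < 1" if "z \<in> polydisc" for z
      using hol that by (auto simp: holomorphic_self_map_def polydisc_def)
  qed (use g in auto)
  then show ?thesis by blast
qed

text \<open>\<open>U\<close> is chosen before \<open>e\<close>, because the finite cover extracted
  later must be fixed before the error is divided among its members. Smallness of 1 - |z(i)| at a
  single index suffices: if the set is nonempty, that index belongs to \<open>J\<close>.\<close>

lemma local_vanishing_carleson:
  fixes \<phi> :: "complex ^ 'n \<Rightarrow> complex ^ 'n"
  assumes hol: "holomorphic_self_map \<phi>" and C1: "C1_closed_polydisc \<phi>"
    and b: "\<beta> > -1" and bd: "real CARD('n) - 3 < \<beta>"
    and cond: "\<And>z. z \<in> cpolydisc \<Longrightarrow> num_unimodular (\<phi> z) > 0 \<Longrightarrow> num_unimodular (\<phi> z) < num_unimodular z"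
    and z0: "z0 \<in> cpolydisc"
  shows "\<exists>U. open U \<and> z0 \<in> U \<and> (\<forall>e>0. \<exists>\<eta>>0. \<forall>z\<in>polydisc. (\<exists>i. 1 - cmod (z $ i) \<le> \<eta>) \<longrightarrow>
    emeasure (polydisc_measure \<beta>) (preimage_whitney \<phi> z \<inter> U) \<le> ennreal (e * (\<Prod>k\<in>UNIV. (1 - cmod (z $ k)) powr (2 + \<beta>))))"
proof -
  obtain g where g: "\<And>i. C1_disc_function (\<lambda>w. \<phi> w $ i) (g i)"
    using C1_disc_function_components[OF hol C1] by blast
  interpret F: C1_disc_function "\<lambda>w. \<phi> w $ i" "g i" for i by (rule g)
  define J where "J = {i. cmod (\<phi> z0 $ i) = 1}"
  define S where "S i = {k. g i k z0 \<noteq> 0}" for i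
  \<comment> \<open>Zeroing the coordinates outside the union keeps every component in
    \<open>Q\<close> unimodular. The boundary condition is applied at the zeroed point, whose
    unimodular coordinates all lie in the union.\<close>
  have hall: "card Q < card (\<Union> (S ` Q))" if Q: "Q \<subseteq> J" "Q \<noteq> {}" for Q
  proof -
    let ?S = "\<Union> (S ` Q)"
    let ?z = "\<chi> i. if i \<in> - ?S then 0 else z0 $ i"
    have "?z \<in> cpolydisc" using z0 by (auto simp: cpolydisc_def)
    have one: "cmod (\<phi> ?z $ i) = 1" if "i \<in> Q" for i
      using Q that by (intro F.zeroed_unimodular z0) (auto simp: J_def S_def)
    have "card Q \<le> num_unimodular (\<phi> ?z)" unfolding num_unimodular_def
      using one by (intro card_mono) auto
    moreover have "card Q > 0" using Q by (simp add: card_gt_0_iff)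
    ultimately have "card Q < num_unimodular ?z" using cond[OF \<open>?z \<in> cpolydisc\<close>] by linarith
    also have "\<dots> \<le> card ?S" unfolding num_unimodular_def
      by (intro card_mono) (auto split: if_splits)
    finally show ?thesis .
  qed
  define P1 where "P1 M \<longleftrightarrow> (\<forall>i\<in>J. \<forall>k\<in>S i. \<forall>w \<in> polydisc \<inter> ball z0 (1 / M). 1 - (cmod (w $ k))\<^sup>2 \<le> M * (1 - cmod (\<phi> w $ i)))" for M
  define P2 where "P2 M \<longleftrightarrow> (\<forall>i\<in>J. \<forall>k\<in>S i. \<forall>w \<in> polydisc \<inter> ball z0 (1 / M). \<forall>w' \<in> polydisc \<inter> ball z0 (1 / M).
    (\<forall>l. l \<noteq> k \<longrightarrow> w $ l = w' $ l) \<longrightarrow> cmod (w $ k - w' $ k) \<le> M * cmod (\<phi> w $ i - \<phi> w' $ i))" for M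
  define P3 where "P3 M \<longleftrightarrow> (\<forall>i\<in>-J. \<forall>w \<in> polydisc \<inter> ball z0 (1 / M). 1 \<le> M * (1 - cmod (\<phi> w $ i)))" for M
  have "eventually P1 at_top" unfolding P1_def
    by (intro eventually_ball_finite ballI F.boundary_distance_near[OF z0] finite) (auto simp: S_def)
  moreover have "eventually P2 at_top" unfolding P2_def
    by (intro eventually_ball_finite ballI F.coordinate_injective_near[OF z0] finite) (auto simp: S_def)
  moreover have "eventually P3 at_top" unfolding P3_def
    by (intro eventually_ball_finite ballI F.away_from_circle_near[OF z0] finite) (auto simp: J_def)
  moreover have "\<forall>\<^sub>F M in at_top. M \<ge> (1::real)" by (rule eventually_ge_at_top)
  ultimately have "\<forall>\<^sub>F M in at_top. P1 M \<and> P2 M \<and> P3 M \<and> M \<ge> 1" by (simp add: eventually_conj_iff)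
  then have "\<exists>M. P1 M \<and> P2 M \<and> P3 M \<and> M \<ge> 1" by (intro eventually_happens'[OF trivial_limit_at_top_linorder])
  then obtain M where PM: "P1 M" "P2 M" "P3 M" and M: "M \<ge> 1" by blast
  define U where "U = ball z0 (1 / M)"
  have near: "1 - (cmod (w $ k))\<^sup>2 \<le> M * (1 - cmod (\<phi> w $ i))" if "i \<in> J" "k \<in> S i" "w \<in> polydisc \<inter> U" for i k w
    using PM(1)[unfolded P1_def, rule_format, of i k w] that by (simp add: U_def)
  have inj: "cmod (w $ k - w' $ k) \<le> M * cmod (\<phi> w $ i - \<phi> w' $ i)"
    if "i \<in> J" "k \<in> S i" "w \<in> polydisc \<inter> U" "w' \<in> polydisc \<inter> U" "\<And>l. l \<noteq> k \<Longrightarrow> w $ l = w' $ l" for i k w w'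
    using PM(2)[unfolded P2_def, rule_format, of i k w w'] that by (simp add: U_def)
  have away: "1 \<le> M * (1 - cmod (\<phi> w $ i))" if "i \<notin> J" "w \<in> polydisc \<inter> U" for i w
    using PM(3)[unfolded P3_def, rule_format, of i w] that by (simp add: U_def)
  interpret finite_measure "disc_measure \<beta>" by (rule finite_disc_measure[OF b])
  obtain C where C: "C > 0" "\<And>a r. r > 0 \<Longrightarrow>
      emeasure (disc_measure \<beta>) {w. cmod (w - a) \<le> r \<and> 1 - (cmod w)\<^sup>2 \<le> r} \<le> ennreal (C * r powr (2 + \<beta>))"
    "\<And>s. s > 0 \<Longrightarrow> emeasure (disc_measure \<beta>) {w. 1 - (cmod w)\<^sup>2 \<le> s} \<le> ennreal (C * s powr (1 + \<beta>))"
    using disc_measure_ball_annulus[OF b] by blast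
  let ?d = "CARD('n)"
  \<comment> \<open>\<open>Q\<close> collects the constants from the radii
    \<open>2 * M * \<delta> i\<close>, \<open>B\<close> dominates the constant of any single
    coordinate, and \<kappa> is 2 + \<beta> - (d - 1), the smallest exponent that can be left
    over.\<close>
  define Q where "Q = (2 * M) powr (2 + \<beta>)"
  define B where "B = max 1 (max (C * Q) (measure (disc_measure \<beta>) UNIV))"
  define \<kappa> where "\<kappa> = \<beta> + 3 - real ?d"
  define A where "A = B ^ ?d * Q ^ ?d"
  have Q1: "Q \<ge> 1" using M b by (simp add: Q_def ge_one_powr_ge_zero)
  have B1: "B \<ge> 1" "C * Q \<le> B" "measure (disc_measure \<beta>) UNIV \<le> B" by (auto simp: B_def)
  have \<kappa>: "\<kappa> > 0" using bd by (simp add: \<kappa>_def)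
  have A0: "A > 0" using Q1 B1(1) by (simp add: A_def)
  have "\<exists>\<eta>>0. \<forall>z\<in>polydisc. (\<exists>i. 1 - cmod (z $ i) \<le> \<eta>) \<longrightarrow>
    emeasure (polydisc_measure \<beta>) (preimage_whitney \<phi> z \<inter> U) \<le> ennreal (e * (\<Prod>k\<in>UNIV. (1 - cmod (z $ k)) powr (2 + \<beta>)))"
    if e: "e > 0" for e
  proof -
    \<comment> \<open>The first entry places the index with small \<delta> in \<open>J\<close>; the
      second makes \<open>A * \<eta> powr \<kappa> \<le> e\<close>.\<close>
    define \<eta> where "\<eta> = min (1 / (4 * M)) ((e / A) powr (1 / \<kappa>))"
    have \<eta>: "\<eta> > 0" "\<eta> \<le> 1 / (4 * M)" "\<eta> \<le> (e / A) powr (1 / \<kappa>)"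
      using M A0 e by (auto simp: \<eta>_def)
    have "1 / (4 * M) \<le> 1" using M by simp
    then have \<eta>1: "\<eta> \<le> 1" using \<eta>(2) by linarith
    have "\<eta> powr \<kappa> \<le> ((e / A) powr (1 / \<kappa>)) powr \<kappa>" using \<eta> \<kappa> by (intro powr_mono2) auto
    also have "\<dots> = e / A" using \<kappa> A0 e by (simp add: powr_powr)
    finally have A\<eta>: "A * \<eta> powr \<kappa> \<le> e" using A0 by (simp add: field_simps)
    have "emeasure (polydisc_measure \<beta>) (preimage_whitney \<phi> z \<inter> U) \<le> ennreal (e * (\<Prod>k\<in>UNIV. (1 - cmod (z $ k)) powr (2 + \<beta>)))"
      if z: "z \<in> polydisc" and ex: "\<exists>i. 1 - cmod (z $ i) \<le> \<eta>" for z
    proof (cases "preimage_whitney \<phi> z \<inter> U = {}")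
      case False
      define E where "E = preimage_whitney \<phi> z \<inter> U"
      define \<delta> where "\<delta> i = 1 - cmod (z $ i)" for i
      have \<delta>: "0 < \<delta> i" "\<delta> i \<le> 1" for i using z by (auto simp: \<delta>_def polydisc_def)
      obtain w0 where w0: "w0 \<in> E" using False by (auto simp: E_def)
      obtain i0 where i0: "\<delta> i0 \<le> \<eta>" using ex by (auto simp: \<delta>_def)
      have EU: "w \<in> polydisc \<inter> U" if "w \<in> E" for w using that by (auto simp: E_def preimage_whitney_def)
      have wb: "1 - cmod (\<phi> w $ i) < 2 * \<delta> i" "cmod (z $ i - \<phi> w $ i) < \<delta> i" if "w \<in> E" for w i
      proof -
        have "z \<in> whitney (\<phi> w)" using that by (simp add: E_def preimage_whitney_def)
        then show "1 - cmod (\<phi> w $ i) < 2 * \<delta> i" "cmod (z $ i - \<phi> w $ i) < \<delta> i"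
          using whitney_bounds(1)[of z "\<phi> w" i] by (auto simp: \<delta>_def whitney_def dest!: spec[of _ i])
      qed
      \<comment> \<open>The point \<open>w0\<close> ties \<open>z\<close> to \<phi>: components
        outside \<open>J\<close> stay off the circle on \<open>U\<close>, hence so do the
        corresponding coordinates of \<open>z\<close>.\<close>
      have notJ: "1 \<le> 2 * M * \<delta> i" if "i \<notin> J" for i
      proof -
        have "1 \<le> M * (1 - cmod (\<phi> w0 $ i))" by (rule away[OF that EU[OF w0]])
        also have "\<dots> \<le> M * (2 * \<delta> i)" using wb(1)[OF w0, of i] M by (intro mult_left_mono) auto
        finally show ?thesis by simp
      qed
      have "i0 \<in> J"
      proof (rule ccontr)
        assume "i0 \<notin> J"
        then have "1 \<le> 2 * M * \<delta> i0" by (rule notJ)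
        also have "\<dots> \<le> 2 * M * (1 / (4 * M))" using i0 \<eta> M by (intro mult_left_mono) auto
        also have "\<dots> = 1 / 2" using M by simp
        finally show False by simp
      qed
      have "Min (\<delta> ` J) \<in> \<delta> ` J" using \<open>i0 \<in> J\<close> by (intro Min_in) auto
      then obtain i1 where i1: "i1 \<in> J" "\<delta> i1 = Min (\<delta> ` J)" by auto
      have min: "\<delta> i1 \<le> \<delta> i" if "i \<in> J" for i unfolding i1(2) using that by (intro Min_le) auto
      have \<delta>1: "\<delta> i1 \<le> \<eta>" using min[OF \<open>i0 \<in> J\<close>] i0 by simp
      \<comment> \<open>Any coordinate on which component \<open>i1\<close> depends to first order
        can be the spare one.\<close>
      have "0 < card (S i1)" using hall[of "{i1}"] i1 by simp
      then obtain k0 where k0: "k0 \<in> S i1" by (auto simp: card_gt_0_iff)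
      \<comment> \<open>Removing \<open>k0\<close> shrinks a union by at most one element, which the
        strict inequality of \<open>hall\<close> affords.\<close>
      have "\<exists>\<sigma>. inj_on \<sigma> J \<and> (\<forall>i\<in>J. \<exists>i'\<in>J. \<delta> i' \<le> \<delta> i \<and> \<sigma> i \<in> S i' - {k0})"
      proof (rule greedy_representatives)
        fix T assume T: "T \<subseteq> J" "T \<noteq> {}"
        have "\<Union> ((\<lambda>i. S i - {k0}) ` T) = \<Union> (S ` T) - {k0}" by auto
        then have "card (\<Union> (S ` T)) - 1 \<le> card (\<Union> ((\<lambda>i. S i - {k0}) ` T))"
          by (simp add: diff_card_le_card_Diff[of "{k0}", simplified])
        then show "card T \<le> card (\<Union> ((\<lambda>i. S i - {k0}) ` T))" using hall[OF T] by linarith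
      qed auto
      then obtain \<sigma> where \<sigma>: "inj_on \<sigma> J" "\<And>i. i \<in> J \<Longrightarrow> \<exists>i'\<in>J. \<delta> i' \<le> \<delta> i \<and> \<sigma> i \<in> S i' - {k0}" by blast
      have \<sigma>k: "\<sigma> ` J \<subseteq> UNIV - {k0}" using \<sigma>(2) by blast
      define p where "p = card J"
      have "p = card (\<sigma> ` J)" using \<sigma>(1) by (simp add: p_def card_image)
      also have "\<dots> \<le> card (UNIV - {k0})" using \<sigma>k by (intro card_mono) auto
      also have "\<dots> = ?d - 1" by simp
      finally have pd: "p + 1 \<le> ?d" using zero_less_card_finite[where 'a='n] by linarith
      define s where "s k = 2 * M * \<delta> (inv_into J \<sigma> k)" for k
      define T where "T k = (if k \<in> \<sigma> ` J then {w::complex. 1 - (cmod w)\<^sup>2 \<le> s k} else UNIV)" for k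
      have [measurable]: "T k \<in> sets borel" for k
      proof -
        have "{w::complex. 1 - (cmod w)\<^sup>2 \<le> s k} \<in> sets borel" by measurable
        then show ?thesis by (simp add: T_def)
      qed
      have "open E" unfolding E_def U_def by (intro open_Int open_preimage_whitney hol open_ball)
      then have E_borel: "E \<in> sets borel" by simp
      have sub: "w $ k \<in> T k" if w: "w \<in> E" and "k \<noteq> k0" for w k
      proof (cases "k \<in> \<sigma> ` J")
        case True
        then obtain i where i: "i \<in> J" "k = \<sigma> i" by blast
        obtain i' where i': "i' \<in> J" "\<delta> i' \<le> \<delta> i" "\<sigma> i \<in> S i'" using \<sigma>(2)[OF i(1)] by blast
        have "1 - (cmod (w $ k))\<^sup>2 \<le> M * (1 - cmod (\<phi> w $ i'))"
          using near[OF i'(1) i'(3) EU[OF w]] i by simp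
        also have "\<dots> \<le> M * (2 * \<delta> i)" using wb(1)[OF w, of i'] i'(2) M by (intro mult_left_mono) auto
        finally show ?thesis using True i \<sigma>(1) by (simp add: T_def s_def)
      qed (simp add: T_def)
      \<comment> \<open>At two points of one section, component \<open>i1\<close> of \<phi> is
        within \<open>\<delta> i1\<close> of \<open>z $ i1\<close>; so \<open>inj\<close> keeps
        their \<open>k0\<close> coordinates within \<open>2 * M * \<delta> i1\<close> of each other,
        and \<open>near\<close> puts them equally close to the circle.\<close>
      have sec: "emeasure (disc_measure \<beta>) {y. (\<chi> k. if k = k0 then y else w $ k) \<in> E} \<le> ennreal (C * (2 * M * \<delta> i1) powr (2 + \<beta>))" for w
      proof (cases "\<exists>y0. (\<chi> k. if k = k0 then y0 else w $ k) \<in> E")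
        case True
        let ?u = "\<lambda>y. \<chi> k. if k = k0 then y else w $ k"
        obtain y0 where y0: "?u y0 \<in> E" using True by blast
        have "{y. ?u y \<in> E} \<subseteq> {y. cmod (y - y0) \<le> 2 * M * \<delta> i1 \<and> 1 - (cmod y)\<^sup>2 \<le> 2 * M * \<delta> i1}"
        proof safe
          fix y assume y: "?u y \<in> E"
          have "cmod (\<phi> (?u y) $ i1 - \<phi> (?u y0) $ i1) \<le> 2 * \<delta> i1"
            using norm_triangle_ineq4[of "z $ i1 - \<phi> (?u y0) $ i1" "z $ i1 - \<phi> (?u y) $ i1"] wb(2)[OF y, of i1] wb(2)[OF y0, of i1]
            by simp
          then have "M * cmod (\<phi> (?u y) $ i1 - \<phi> (?u y0) $ i1) \<le> M * (2 * \<delta> i1)" using M by (intro mult_left_mono) auto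
          moreover have "cmod (?u y $ k0 - ?u y0 $ k0) \<le> M * cmod (\<phi> (?u y) $ i1 - \<phi> (?u y0) $ i1)"
            by (rule inj[OF i1(1) k0 EU[OF y] EU[OF y0]]) simp
          ultimately show "cmod (y - y0) \<le> 2 * M * \<delta> i1" by simp
          have "1 - (cmod (?u y $ k0))\<^sup>2 \<le> M * (1 - cmod (\<phi> (?u y) $ i1))"
            by (rule near[OF i1(1) k0 EU[OF y]])
          also have "\<dots> \<le> M * (2 * \<delta> i1)" using wb(1)[OF y, of i1] M by (intro mult_left_mono) auto
          finally show "1 - (cmod y)\<^sup>2 \<le> 2 * M * \<delta> i1" by simp
        qed
        then have "emeasure (disc_measure \<beta>) {y. ?u y \<in> E}
            \<le> emeasure (disc_measure \<beta>) {y. cmod (y - y0) \<le> 2 * M * \<delta> i1 \<and> 1 - (cmod y)\<^sup>2 \<le> 2 * M * \<delta> i1}"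
          by (intro emeasure_mono) auto
        also have "\<dots> \<le> ennreal (C * (2 * M * \<delta> i1) powr (2 + \<beta>))"
          using M \<delta>(1)[of i1] by (intro C) auto
        finally show ?thesis .
      qed simp
      define h where "h k = (if k \<in> \<sigma> ` J then \<delta> (inv_into J \<sigma> k) powr (1 + \<beta>) else 1)" for k
      have Tk: "emeasure (disc_measure \<beta>) (T k) \<le> ennreal (B * h k)" for k
      proof (cases "k \<in> \<sigma> ` J")
        case True
        have sp: "s k > 0" using M \<delta> by (simp add: s_def)
        have "C * s k powr (1 + \<beta>) = C * (2 * M) powr (1 + \<beta>) * h k"
          using True M \<delta> by (simp add: s_def h_def powr_mult)
        also have "\<dots> \<le> B * h k"
        proof (intro mult_right_mono)
          have "(2 * M) powr (1 + \<beta>) \<le> Q" using M by (auto simp: Q_def intro!: powr_mono)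
          then have "C * (2 * M) powr (1 + \<beta>) \<le> C * Q" using C(1) by (intro mult_left_mono) auto
          then show "C * (2 * M) powr (1 + \<beta>) \<le> B" using B1(2) by simp
        qed (simp add: h_def)
        finally have "ennreal (C * s k powr (1 + \<beta>)) \<le> ennreal (B * h k)" by (rule ennreal_leI)
        with C(3)[OF sp] show ?thesis using True by (simp add: T_def)
      next
        case False
        then show ?thesis using B1(3) by (simp add: T_def h_def emeasure_eq_measure ennreal_leI)
      qed
      have prodh: "(\<Prod>k\<in>UNIV - {k0}. h k) = (\<Prod>i\<in>J. \<delta> i powr (1 + \<beta>))"
      proof -
        have "(\<Prod>k\<in>UNIV - {k0}. h k) = (\<Prod>k\<in>\<sigma> ` J. h k)"
          using \<sigma>k by (intro prod.mono_neutral_right) (auto simp: h_def)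
        also have "\<dots> = (\<Prod>i\<in>J. h (\<sigma> i))" using \<sigma>(1) by (simp add: prod.reindex)
        also have "\<dots> = (\<Prod>i\<in>J. \<delta> i powr (1 + \<beta>))" using \<sigma>(1) by (intro prod.cong) (auto simp: h_def)
        finally show ?thesis .
      qed
      have h0: "0 \<le> h k" for k by (simp add: h_def)
      have "emeasure (polydisc_measure \<beta>) E
          \<le> ennreal (C * (2 * M * \<delta> i1) powr (2 + \<beta>)) * (\<Prod>k\<in>UNIV - {k0}. emeasure (disc_measure \<beta>) (T k))"
        by (rule emeasure_polydisc_section_le[OF b E_borel _ sub sec]) auto
      also have "\<dots> \<le> ennreal (C * (2 * M * \<delta> i1) powr (2 + \<beta>)) * (\<Prod>k\<in>UNIV - {k0}. ennreal (B * h k))"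
        by (intro mult_left_mono prod_mono_ennreal Tk) auto
      also have "\<dots> = ennreal (C * (2 * M * \<delta> i1) powr (2 + \<beta>) * (\<Prod>k\<in>UNIV - {k0}. B * h k))"
        using B1(1) h0 C(1) by (simp add: prod_ennreal ennreal_mult[symmetric] prod_nonneg)
      also have "C * (2 * M * \<delta> i1) powr (2 + \<beta>) * (\<Prod>k\<in>UNIV - {k0}. B * h k)
          = C * Q * B ^ (?d - 1) * (\<delta> i1 powr (2 + \<beta>) * (\<Prod>i\<in>J. \<delta> i powr (1 + \<beta>)))"
        using M \<delta>[of i1] by (simp add: powr_mult Q_def prod.distrib prodh mult_ac)
      also have "\<dots> \<le> e * (\<Prod>k\<in>UNIV. \<delta> k powr (2 + \<beta>))"
      proof -
        have "B ^ ?d = B * B ^ (?d - 1)" using pd by (cases "?d") auto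
        then have CB: "C * Q * B ^ (?d - 1) \<le> B ^ ?d" using B1 by (simp add: mult_right_mono)
        have "\<delta> i1 ^ p \<le> (\<Prod>i\<in>J. \<delta> i)"
        proof -
          have "\<delta> i1 ^ p = (\<Prod>i\<in>J. \<delta> i1)" by (simp add: p_def)
          also have "\<dots> \<le> (\<Prod>i\<in>J. \<delta> i)" using min \<delta>(1)[of i1] by (intro prod_mono) (auto simp: less_imp_le)
          finally show ?thesis .
        qed
        moreover have "\<delta> i1 powr (2 + \<beta> - real p) \<le> \<eta> powr \<kappa>"
        proof -
          have "\<delta> i1 powr (2 + \<beta> - real p) \<le> \<delta> i1 powr \<kappa>"
            using \<delta>[of i1] pd by (intro powr_mono') (auto simp: \<kappa>_def)
          also have "\<dots> \<le> \<eta> powr \<kappa>" using \<delta>[of i1] \<delta>1 \<kappa> by (intro powr_mono2) auto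
          finally show ?thesis .
        qed
        \<comment> \<open>The factor \<open>\<delta> i1 ^ p\<close> is spent on raising the
          exponents 1 + \<beta> to 2 + \<beta>, one unit for each index of \<open>J\<close>; the
          remaining exponent is at least \<kappa> because p \<le> d - 1.\<close>
        moreover have "\<delta> i1 powr (2 + \<beta>) = \<delta> i1 powr (2 + \<beta> - real p) * \<delta> i1 ^ p"
          using \<delta>(1)[of i1] by (simp add: powr_realpow[symmetric] powr_add[symmetric])
        ultimately have "\<delta> i1 powr (2 + \<beta>) \<le> \<eta> powr \<kappa> * (\<Prod>i\<in>J. \<delta> i)"
          using \<delta> by (simp add: mult_mono less_imp_le)
        then have le: "\<delta> i1 powr (2 + \<beta>) * (\<Prod>i\<in>J. \<delta> i powr (1 + \<beta>)) \<le> \<eta> powr \<kappa> * (\<Prod>i\<in>J. \<delta> i) * (\<Prod>i\<in>J. \<delta> i powr (1 + \<beta>))"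
          by (intro mult_right_mono prod_nonneg) auto
        have eqp: "(\<Prod>i\<in>J. \<delta> i) * (\<Prod>i\<in>J. \<delta> i powr (1 + \<beta>)) = (\<Prod>i\<in>J. \<delta> i powr (2 + \<beta>))"
          unfolding prod.distrib[symmetric]
        proof (intro prod.cong refl)
          fix i
          have "\<delta> i * \<delta> i powr (1 + \<beta>) = \<delta> i powr (1 + (1 + \<beta>))"
            unfolding powr_add using \<delta>(1)[of i] by simp
          then show "\<delta> i * \<delta> i powr (1 + \<beta>) = \<delta> i powr (2 + \<beta>)" by simp
        qed
        have 1: "\<delta> i1 powr (2 + \<beta>) * (\<Prod>i\<in>J. \<delta> i powr (1 + \<beta>)) \<le> \<eta> powr \<kappa> * (\<Prod>i\<in>J. \<delta> i powr (2 + \<beta>))"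
          using le unfolding eqp[symmetric] by (simp only: mult.assoc)
        \<comment> \<open>Outside \<open>J\<close> every \<open>2 * M * \<delta> i\<close> is at
          least 1, so the missing factors can be inserted at the price of a power of
          \<open>Q\<close>.\<close>
        have 2: "(\<Prod>i\<in>J. \<delta> i powr (2 + \<beta>)) \<le> Q ^ ?d * (\<Prod>i\<in>UNIV. \<delta> i powr (2 + \<beta>))"
        proof -
          have "1 \<le> (\<Prod>i\<in>-J. (2 * M * \<delta> i) powr (2 + \<beta>))"
            using notJ b by (intro prod_ge_1 ge_one_powr_ge_zero) auto
          also have "\<dots> = Q ^ card (-J) * (\<Prod>i\<in>-J. \<delta> i powr (2 + \<beta>))"
            using M \<delta> by (simp add: powr_mult Q_def prod.distrib less_imp_le)
          also have "\<dots> \<le> Q ^ ?d * (\<Prod>i\<in>-J. \<delta> i powr (2 + \<beta>))"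
            using Q1 by (intro mult_right_mono power_increasing prod_nonneg card_mono) auto
          finally have "(\<Prod>i\<in>J. \<delta> i powr (2 + \<beta>)) * 1 \<le> (\<Prod>i\<in>J. \<delta> i powr (2 + \<beta>)) * (Q ^ ?d * (\<Prod>i\<in>-J. \<delta> i powr (2 + \<beta>)))"
            by (intro mult_left_mono prod_nonneg) auto
          also have "\<dots> = Q ^ ?d * ((\<Prod>i\<in>J. \<delta> i powr (2 + \<beta>)) * (\<Prod>i\<in>-J. \<delta> i powr (2 + \<beta>)))" by simp
          also have "(\<Prod>i\<in>J. \<delta> i powr (2 + \<beta>)) * (\<Prod>i\<in>-J. \<delta> i powr (2 + \<beta>)) = (\<Prod>i\<in>J \<union> -J. \<delta> i powr (2 + \<beta>))"
            by (intro prod.union_disjoint[symmetric]) auto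
          finally show ?thesis by simp
        qed
        have "C * Q * B ^ (?d - 1) * (\<delta> i1 powr (2 + \<beta>) * (\<Prod>i\<in>J. \<delta> i powr (1 + \<beta>)))
            \<le> B ^ ?d * (\<eta> powr \<kappa> * (Q ^ ?d * (\<Prod>i\<in>UNIV. \<delta> i powr (2 + \<beta>))))"
        proof (intro mult_mono[OF CB])
          show "\<delta> i1 powr (2 + \<beta>) * (\<Prod>i\<in>J. \<delta> i powr (1 + \<beta>)) \<le> \<eta> powr \<kappa> * (Q ^ ?d * (\<Prod>i\<in>UNIV. \<delta> i powr (2 + \<beta>)))"
            by (rule order_trans[OF 1]) (intro mult_left_mono 2, simp)
        qed (use B1 in \<open>auto intro!: mult_nonneg_nonneg prod_nonneg\<close>)
        also have "\<dots> = A * \<eta> powr \<kappa> * (\<Prod>i\<in>UNIV. \<delta> i powr (2 + \<beta>))" by (simp add: A_def mult_ac)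
        also have "\<dots> \<le> e * (\<Prod>i\<in>UNIV. \<delta> i powr (2 + \<beta>))"
          using A\<eta> by (intro mult_right_mono prod_nonneg) auto
        finally show ?thesis .
      qed
      finally show ?thesis by (simp add: E_def \<delta>_def ennreal_leI)
    qed simp
    then show ?thesis using \<eta>(1) by blast
  qed
  moreover have "open U" "z0 \<in> U" using M by (auto simp: U_def)
  ultimately show ?thesis by blast
qed

text \<open>Compactness of the closed polydisc: the error is shared among the members of a finite
  cover, and \<eta> is the smallest of theirs.\<close>

lemma vanishing_carleson:
  fixes \<phi> :: "complex ^ 'n \<Rightarrow> complex ^ 'n"
  assumes hol: "holomorphic_self_map \<phi>" and C1: "C1_closed_polydisc \<phi>"
    and b: "\<beta> > -1" and bd: "real CARD('n) - 3 < \<beta>"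
    and cond: "\<And>z. z \<in> cpolydisc \<Longrightarrow> num_unimodular (\<phi> z) > 0 \<Longrightarrow> num_unimodular (\<phi> z) < num_unimodular z"
    and e: "e > 0"
  shows "\<exists>\<eta>>0. \<forall>z\<in>polydisc. (\<exists>i. 1 - cmod (z $ i) \<le> \<eta>) \<longrightarrow>
    emeasure (polydisc_measure \<beta>) (preimage_whitney \<phi> z) \<le> ennreal (e * (\<Prod>k\<in>UNIV. (1 - cmod (z $ k)) powr (2 + \<beta>)))"
proof -
  have "\<forall>z0\<in>cpolydisc. \<exists>U. open U \<and> z0 \<in> U \<and> (\<forall>e>0. \<exists>\<eta>>0. \<forall>z\<in>polydisc. (\<exists>i. 1 - cmod (z $ i) \<le> \<eta>) \<longrightarrow>
    emeasure (polydisc_measure \<beta>) (preimage_whitney \<phi> z \<inter> U) \<le> ennreal (e * (\<Prod>k\<in>UNIV. (1 - cmod (z $ k)) powr (2 + \<beta>))))"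
    using local_vanishing_carleson[OF hol C1 b bd cond] by blast
  then obtain U where U: "\<And>z0. z0 \<in> cpolydisc \<Longrightarrow> open (U z0)" "\<And>z0. z0 \<in> cpolydisc \<Longrightarrow> z0 \<in> U z0"
    and loc: "\<And>z0 e. z0 \<in> cpolydisc \<Longrightarrow> e > 0 \<Longrightarrow> \<exists>\<eta>>0. \<forall>z\<in>polydisc. (\<exists>i. 1 - cmod (z $ i) \<le> \<eta>) \<longrightarrow>
    emeasure (polydisc_measure \<beta>) (preimage_whitney \<phi> z \<inter> U z0) \<le> ennreal (e * (\<Prod>k\<in>UNIV. (1 - cmod (z $ k)) powr (2 + \<beta>)))"
    by metis
  obtain D where D: "D \<subseteq> cpolydisc" "finite D" "cpolydisc \<subseteq> (\<Union>z0\<in>D. U z0)"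
  proof (rule compactE_image[OF compact_cpolydisc, of cpolydisc U])
    show "cpolydisc \<subseteq> (\<Union>z0\<in>cpolydisc. U z0)" using U(2) by blast
  qed (use U(1) in auto)
  define N where "N = real (card D) + 1"
  have N: "N > 0" by (simp add: N_def)
  have "\<forall>z0\<in>D. \<exists>\<eta>>0. \<forall>z\<in>polydisc. (\<exists>i. 1 - cmod (z $ i) \<le> \<eta>) \<longrightarrow>
    emeasure (polydisc_measure \<beta>) (preimage_whitney \<phi> z \<inter> U z0) \<le> ennreal (e / N * (\<Prod>k\<in>UNIV. (1 - cmod (z $ k)) powr (2 + \<beta>)))"
    using loc D(1) e N by (meson divide_pos_pos subsetD)
  then obtain H where H: "\<And>z0. z0 \<in> D \<Longrightarrow> H z0 > 0"
    "\<And>z0 z. z0 \<in> D \<Longrightarrow> z \<in> polydisc \<Longrightarrow> \<exists>i. 1 - cmod (z $ i) \<le> H z0 \<Longrightarrow>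
    emeasure (polydisc_measure \<beta>) (preimage_whitney \<phi> z \<inter> U z0) \<le> ennreal (e / N * (\<Prod>k\<in>UNIV. (1 - cmod (z $ k)) powr (2 + \<beta>)))"
    by metis
  define \<eta> where "\<eta> = Min (insert 1 (H ` D))"
  have "\<eta> > 0" using H(1) D(2) by (auto simp: \<eta>_def)
  moreover have "emeasure (polydisc_measure \<beta>) (preimage_whitney \<phi> z) \<le> ennreal (e * (\<Prod>k\<in>UNIV. (1 - cmod (z $ k)) powr (2 + \<beta>)))"
    if z: "z \<in> polydisc" and ex: "\<exists>i. 1 - cmod (z $ i) \<le> \<eta>" for z :: "complex ^ 'n"
  proof -
    let ?p = "\<Prod>k\<in>UNIV. (1 - cmod (z $ k)) powr (2 + \<beta>)"
    have le: "\<eta> \<le> H z0" if "z0 \<in> D" for z0 using that D(2) by (simp add: \<eta>_def)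
    have op: "open (preimage_whitney \<phi> z)" by (rule open_preimage_whitney[OF hol])
    have "preimage_whitney \<phi> z \<subseteq> (\<Union>z0\<in>D. preimage_whitney \<phi> z \<inter> U z0)"
      using D(3) polydisc_subset_cpolydisc by (auto simp: preimage_whitney_def)
    then have "emeasure (polydisc_measure \<beta>) (preimage_whitney \<phi> z) \<le> emeasure (polydisc_measure \<beta>) (\<Union>z0\<in>D. preimage_whitney \<phi> z \<inter> U z0)"
      using op U(1) D(1) by (intro emeasure_mono) (auto intro!: borel_open open_UN open_Int)
    also have "\<dots> \<le> (\<Sum>z0\<in>D. emeasure (polydisc_measure \<beta>) (preimage_whitney \<phi> z \<inter> U z0))"
      using op U(1) D(1,2) by (intro emeasure_subadditive_finite) (auto intro!: borel_open open_Int)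
    also have "\<dots> \<le> (\<Sum>z0\<in>D. ennreal (e / N * ?p))"
      using ex le by (intro sum_mono H(2) z) (auto intro: order_trans)
    also have "\<dots> = ennreal (real (card D) * (e / N * ?p))"
      by (simp only: sum_constant ennreal_of_nat_eq_real_of_nat ennreal_mult' of_nat_0_le_iff)
    also have "\<dots> \<le> ennreal (e * ?p)"
    proof (rule ennreal_leI)
      have "real (card D) * (e / N) \<le> e" using e N by (simp add: N_def field_simps)
      then have "real (card D) * (e / N) * ?p \<le> e * ?p" by (intro mult_right_mono prod_nonneg) auto
      then show "real (card D) * (e / N * ?p) \<le> e * ?p" by simp
    qed
    finally show ?thesis .
  qed
  ultimately show ?thesis by blast
qed

subsection \<open>The Bergman space\<close>

lemma holomorphic_several_diff:
  assumes "holomorphic_several_on f S" "holomorphic_several_on g S"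
  shows "holomorphic_several_on (\<lambda>z. f z - g z) S"
  unfolding holomorphic_several_on_def
proof
  fix z assume "z \<in> S"
  then obtain D E where "(f has_derivative D) (at z)" "\<And>c v. D (c *s v) = c * D v"
    "(g has_derivative E) (at z)" "\<And>c v. E (c *s v) = c * E v"
    using assms unfolding holomorphic_several_on_def by meson
  then show "\<exists>D. ((\<lambda>z. f z - g z) has_derivative D) (at z) \<and> (\<forall>c v. D (c *s v) = c * D v)"
    by (intro exI[of _ "\<lambda>v. D v - E v"]) (auto intro: has_derivative_diff simp: algebra_simps)
qed

lemma holomorphic_several_mult:
  assumes "holomorphic_several_on f S" "holomorphic_several_on g S"
  shows "holomorphic_several_on (\<lambda>z. f z * g z) S"
  unfolding holomorphic_several_on_def
proof
  fix z assume "z \<in> S"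
  then obtain D E where "(f has_derivative D) (at z)" "\<And>c v. D (c *s v) = c * D v"
    "(g has_derivative E) (at z)" "\<And>c v. E (c *s v) = c * E v"
    using assms unfolding holomorphic_several_on_def by meson
  then show "\<exists>D. ((\<lambda>z. f z * g z) has_derivative D) (at z) \<and> (\<forall>c v. D (c *s v) = c * D v)"
    by (intro exI[of _ "\<lambda>v. f z * E v + D v * g z"] conjI has_derivative_mult) (auto simp: algebra_simps)
qed

lemma holomorphic_several_const: "holomorphic_several_on (\<lambda>z. c) S"
  unfolding holomorphic_several_on_def by (intro ballI exI[of _ "\<lambda>_. 0"]) auto

lemma holomorphic_several_add:
  assumes "holomorphic_several_on f S" "holomorphic_several_on g S"
  shows "holomorphic_several_on (\<lambda>z. f z + g z) S"
  using holomorphic_several_diff[OF assms(1) holomorphic_several_mult[OF holomorphic_several_const[of "-1"] assms(2)]]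
  by simp

lemma holomorphic_several_prod:
  "(\<And>i. i \<in> A \<Longrightarrow> holomorphic_several_on (f i) S) \<Longrightarrow> holomorphic_several_on (\<lambda>z. \<Prod>i\<in>A. f i z) S"
  by (induction A rule: infinite_finite_induct)
     (auto intro: holomorphic_several_mult holomorphic_several_const)

lemma holomorphic_several_transform:
  assumes "holomorphic_several_on f S" "open S" "\<And>z. z \<in> S \<Longrightarrow> f z = g z"
  shows "holomorphic_several_on g S"
  unfolding holomorphic_several_on_def
proof
  fix z assume z: "z \<in> S"
  then obtain D where D: "(f has_derivative D) (at z)" "\<And>c v. D (c *s v) = c * D v"
    using assms(1) unfolding holomorphic_several_on_def by meson
  have "(g has_derivative D) (at z)"
    by (rule has_derivative_transform_within_open[OF D(1) assms(2) z assms(3)])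
  with D(2) show "\<exists>D. (g has_derivative D) (at z) \<and> (\<forall>c v. D (c *s v) = c * D v)" by blast
qed

lemma holomorphic_several_compose:
  fixes \<phi> :: "complex ^ 'n \<Rightarrow> complex ^ 'n"
  assumes f: "holomorphic_several_on f T" and \<phi>: "\<And>k. holomorphic_several_on (\<lambda>z. \<phi> z $ k) S"
    and sub: "\<phi> ` S \<subseteq> T"
  shows "holomorphic_several_on (\<lambda>z. f (\<phi> z)) S"
  unfolding holomorphic_several_on_def
proof
  fix z assume z: "z \<in> S"
  have "\<forall>k. \<exists>D. ((\<lambda>z. \<phi> z $ k) has_derivative D) (at z) \<and> (\<forall>c v. D (c *s v) = c * D v)"
    using \<phi> z unfolding holomorphic_several_on_def by blast
  then obtain D where D: "\<And>k. ((\<lambda>z. \<phi> z $ k) has_derivative D k) (at z)" "\<And>k c v. D k (c *s v) = c * D k v"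
    by metis
  obtain E where E: "(f has_derivative E) (at (\<phi> z))" "\<And>c v. E (c *s v) = c * E v"
    using f sub z unfolding holomorphic_several_on_def by blast
  have "(\<phi> has_derivative (\<lambda>v. \<chi> k. D k v)) (at z)"
  proof (subst has_derivative_componentwise_within, rule ballI)
    fix b :: "complex ^ 'n" assume "b \<in> Basis"
    then obtain k u where b: "b = axis k u" by (auto simp: Basis_vec_def)
    have "((\<lambda>x. \<phi> x $ k \<bullet> u) has_derivative (\<lambda>v. D k v \<bullet> u)) (at z)"
      by (intro bounded_linear.has_derivative[OF bounded_linear_inner_left] D(1))
    then show "((\<lambda>x. \<phi> x \<bullet> b) has_derivative (\<lambda>v. (\<chi> k. D k v) \<bullet> b)) (at z)"
      by (simp add: b inner_axis)
  qed
  from has_derivative_compose[OF this E(1)]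
  have "((\<lambda>z. f (\<phi> z)) has_derivative (\<lambda>v. E (\<chi> k. D k v))) (at z)" .
  moreover have "(\<chi> k. D k (c *s v)) = c *s (\<chi> k. D k v)" for c v
    by (simp add: vec_eq_iff D(2))
  ultimately show "\<exists>D. ((\<lambda>z. f (\<phi> z)) has_derivative D) (at z) \<and> (\<forall>c v. D (c *s v) = c * D v)"
    by (intro exI[of _ "\<lambda>v. E (\<chi> k. D k v)"]) (auto simp: E(2))
qed

lemma holomorphic_several_measurable:
  fixes f :: "complex ^ 'n \<Rightarrow> complex"
  assumes "holomorphic_several_on f polydisc" "\<And>z. z \<notin> polydisc \<Longrightarrow> f z = 0"
  shows "f \<in> borel_measurable borel"
proof -
  have "(\<lambda>x. indicator polydisc x *\<^sub>R f x) \<in> borel_measurable borel"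
    by (intro borel_measurable_continuous_on_indicator holomorphic_several_continuous_on assms(1)) simp
  also have "(\<lambda>x. indicator polydisc x *\<^sub>R f x) = f"
    using assms(2) by (auto simp: fun_eq_iff indicator_def)
  finally show ?thesis .
qed

section \<open>Norm, point evaluations and metric of the space\<close>

lemma bergman_spaceD:
  assumes "f \<in> bergman_space \<beta>"
  shows "holomorphic_several_on f polydisc" "\<And>z. z \<notin> polydisc \<Longrightarrow> f z = 0" "f \<in> borel_measurable borel"
    "integrable (polydisc_measure \<beta>) (\<lambda>z. (cmod (f z))\<^sup>2)"
  using assms holomorphic_several_measurable[of f] by (auto simp: bergman_space_def)

lemma bergman_norm_nonneg: "0 \<le> bergman_norm \<beta> f"
  by (simp add: bergman_norm_def)

lemma bergman_norm_power2: "(bergman_norm \<beta> f)\<^sup>2 = (\<integral>z. (cmod (f z))\<^sup>2 \<partial>polydisc_measure \<beta>)"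
  by (simp add: bergman_norm_def)

lemma bergman_norm_nn_integral:
  assumes "f \<in> bergman_space \<beta>"
  shows "(\<integral>\<^sup>+z. ennreal ((cmod (f z))\<^sup>2) \<partial>polydisc_measure \<beta>) = ennreal ((bergman_norm \<beta> f)\<^sup>2)"
  unfolding bergman_norm_power2 by (intro nn_integral_eq_integral bergman_spaceD(4)[OF assms]) auto

lemma bergman_spaceI:
  assumes "holomorphic_several_on f polydisc" "\<And>z. z \<notin> polydisc \<Longrightarrow> f z = 0" and R: "0 \<le> R"
    and le: "(\<integral>\<^sup>+z. ennreal ((cmod (f z))\<^sup>2) \<partial>polydisc_measure \<beta>) \<le> ennreal (R\<^sup>2)"
  shows "f \<in> bergman_space \<beta>" "bergman_norm \<beta> f \<le> R"
proof -
  have [measurable]: "f \<in> borel_measurable borel" using holomorphic_several_measurable assms by blast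
  have "(\<integral>\<^sup>+z. ennreal ((cmod (f z))\<^sup>2) \<partial>polydisc_measure \<beta>) < \<infinity>" using le le_less_trans ennreal_less_top by fastforce
  then have "integrable (polydisc_measure \<beta>) (\<lambda>z. (cmod (f z))\<^sup>2)"
    by (intro integrableI_nonneg) auto
  with assms show *: "f \<in> bergman_space \<beta>" by (auto simp: bergman_space_def)
  have "(bergman_norm \<beta> f)\<^sup>2 \<le> R\<^sup>2"
    using le unfolding bergman_norm_nn_integral[OF *] by simp
  then show "bergman_norm \<beta> f \<le> R" using R by (rule power2_le_imp_le)
qed

lemma bergman_space_lincomb:
  assumes "f \<in> bergman_space \<beta>" "g \<in> bergman_space \<beta>"
  shows "(\<lambda>z. a * f z + b * g z) \<in> bergman_space \<beta>"
proof -
  note [measurable] = bergman_spaceD(3)[OF assms(1)] bergman_spaceD(3)[OF assms(2)]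
  have "integrable (polydisc_measure \<beta>) (\<lambda>z. 2 * ((cmod a)\<^sup>2 * (cmod (f z))\<^sup>2) + 2 * ((cmod b)\<^sup>2 * (cmod (g z))\<^sup>2))"
    using bergman_spaceD(4)[OF assms(1)] bergman_spaceD(4)[OF assms(2)] by (intro Bochner_Integration.integrable_add integrable_mult_right)
  then have "integrable (polydisc_measure \<beta>) (\<lambda>z. (cmod (a * f z + b * g z))\<^sup>2)"
  proof (rule Bochner_Integration.integrable_bound)
    have "(cmod (a * f z + b * g z))\<^sup>2 \<le> 2 * ((cmod a)\<^sup>2 * (cmod (f z))\<^sup>2) + 2 * ((cmod b)\<^sup>2 * (cmod (g z))\<^sup>2)" for z
    proof -
      define x y where "x = cmod (a * f z)" and "y = cmod (b * g z)"
      have "(cmod (a * f z + b * g z))\<^sup>2 \<le> (x + y)\<^sup>2"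
        unfolding x_def y_def by (intro power_mono norm_triangle_ineq) auto
      also have "\<dots> \<le> 2 * x\<^sup>2 + 2 * y\<^sup>2" using sum_squares_bound[of x y] by (simp add: power2_sum)
      finally show ?thesis by (simp add: x_def y_def norm_mult power_mult_distrib)
    qed
    then show "AE z in polydisc_measure \<beta>. norm ((cmod (a * f z + b * g z))\<^sup>2)
      \<le> norm (2 * ((cmod a)\<^sup>2 * (cmod (f z))\<^sup>2) + 2 * ((cmod b)\<^sup>2 * (cmod (g z))\<^sup>2))"
      by (intro AE_I2) (auto intro: order_trans)
  qed measurable
  moreover have "holomorphic_several_on (\<lambda>z. a * f z + b * g z) polydisc"
    using bergman_spaceD(1)[OF assms(1)] bergman_spaceD(1)[OF assms(2)]
    by (intro holomorphic_several_add holomorphic_several_mult holomorphic_several_const)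
  ultimately show ?thesis
    using bergman_spaceD(2)[OF assms(1)] bergman_spaceD(2)[OF assms(2)] by (simp add: bergman_space_def)
qed

lemma bergman_space_diff:
  "f \<in> bergman_space \<beta> \<Longrightarrow> g \<in> bergman_space \<beta> \<Longrightarrow> (\<lambda>z. f z - g z) \<in> bergman_space \<beta>"
  using bergman_space_lincomb[of f \<beta> g 1 "-1"] by simp

text \<open>Enlarging the box to the whole polydisc turns the mean value inequality into boundedness
  of point evaluations. This supplies definiteness of the norm and the local bounds for normal
  families.\<close>

lemma bergman_pointwise:
  assumes b: "\<beta> > -1"
  shows "\<exists>C>0. \<forall>(f :: complex ^ 'n \<Rightarrow> complex) w. f \<in> bergman_space \<beta> \<longrightarrow> w \<in> polydisc \<longrightarrow>
    (cmod (f w))\<^sup>2 \<le> C * (\<Prod>k\<in>UNIV. (1 - cmod (w $ k)) powr (- 2 - \<beta>)) * (bergman_norm \<beta> f)\<^sup>2"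
proof -
  obtain C where C: "C > 0" "\<And>(f :: complex ^ 'n \<Rightarrow> complex) w. holomorphic_several_on f polydisc \<Longrightarrow> f \<in> borel_measurable borel \<Longrightarrow> w \<in> polydisc \<Longrightarrow>
    ennreal ((cmod (f w))\<^sup>2)
      \<le> ennreal (C * (\<Prod>k\<in>UNIV. (1 - cmod (w $ k)) powr (- 2 - \<beta>)))
        * (\<integral>\<^sup>+z. indicator (whitney w) z * ennreal ((cmod (f z))\<^sup>2) \<partial>polydisc_measure \<beta>)"
    using mean_value_polydisc[OF b, where 'n='n] by blast
  have "(cmod (f w))\<^sup>2 \<le> C * (\<Prod>k\<in>UNIV. (1 - cmod (w $ k)) powr (- 2 - \<beta>)) * (bergman_norm \<beta> f)\<^sup>2"
    if f: "f \<in> bergman_space \<beta>" and w: "w \<in> polydisc" for f :: "complex ^ 'n \<Rightarrow> complex" and w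
  proof -
    let ?P = "C * (\<Prod>k\<in>UNIV. (1 - cmod (w $ k)) powr (- 2 - \<beta>))"
    have P: "0 \<le> ?P" using C(1) by (intro mult_nonneg_nonneg prod_nonneg) auto
    have "ennreal ((cmod (f w))\<^sup>2) \<le> ennreal ?P * (\<integral>\<^sup>+z. indicator (whitney w) z * ennreal ((cmod (f z))\<^sup>2) \<partial>polydisc_measure \<beta>)"
      by (intro C(2) bergman_spaceD[OF f] w)
    also have "\<dots> \<le> ennreal ?P * (\<integral>\<^sup>+z. ennreal ((cmod (f z))\<^sup>2) \<partial>polydisc_measure \<beta>)"
      by (intro mult_left_mono nn_integral_mono) (auto simp: indicator_def)
    also have "\<dots> = ennreal (?P * (bergman_norm \<beta> f)\<^sup>2)"
      unfolding bergman_norm_nn_integral[OF f] using P by (simp add: ennreal_mult)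
    finally show ?thesis using P by simp
  qed
  with C(1) show ?thesis by blast
qed

lemma bergman_norm_eq_0:
  fixes f :: "complex ^ 'n \<Rightarrow> complex"
  assumes "\<beta> > -1" "f \<in> bergman_space \<beta>" "bergman_norm \<beta> f = 0"
  shows "f z = 0"
proof (cases "z \<in> polydisc")
  case True
  then show ?thesis using bergman_pointwise[OF assms(1), where 'n='n] assms(2,3) by fastforce
qed (use bergman_spaceD(2)[OF assms(2)] in blast)

text \<open>The inequality \<open>2 * x * y \<le> c / a * x\<^sup>2 + a / c * y\<^sup>2\<close> is
  taken with the two norms as weights: after integration the right-hand sides add up to exactly
  \<open>(a + c)\<^sup>2\<close>. The weights need positive norms; a function of norm zero vanishes
  identically.\<close>

lemma bergman_norm_triangle:
  fixes f g :: "complex ^ 'n \<Rightarrow> complex"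
  assumes b: "\<beta> > -1" and f: "f \<in> bergman_space \<beta>" and g: "g \<in> bergman_space \<beta>"
  shows "bergman_norm \<beta> (\<lambda>z. f z + g z) \<le> bergman_norm \<beta> f + bergman_norm \<beta> g"
proof -
  define a c where "a = bergman_norm \<beta> f" and "c = bergman_norm \<beta> g"
  have nn: "0 \<le> a" "0 \<le> c" by (auto simp: a_def c_def bergman_norm_nonneg)
  consider "a = 0" | "c = 0" | "a > 0" "c > 0" using nn by linarith
  then show ?thesis
  proof cases
    case 1
    then have "f z = 0" for z using bergman_norm_eq_0[OF b f] by (simp add: a_def)
    then show ?thesis by (simp add: bergman_norm_nonneg)
  next
    case 2
    then have "g z = 0" for z using bergman_norm_eq_0[OF b g] by (simp add: c_def)
    then show ?thesis by (simp add: bergman_norm_nonneg)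
  next
    case 3
    note I = bergman_spaceD(4)[OF f] bergman_spaceD(4)[OF g]
    have "(cmod (f z + g z))\<^sup>2 \<le> (1 + c / a) * (cmod (f z))\<^sup>2 + (1 + a / c) * (cmod (g z))\<^sup>2" for z
    proof -
      define x y where "x = cmod (f z)" and "y = cmod (g z)"
      have "(cmod (f z + g z))\<^sup>2 \<le> (x + y)\<^sup>2"
        unfolding x_def y_def by (intro power_mono norm_triangle_ineq) auto
      also have "\<dots> \<le> (1 + c / a) * x\<^sup>2 + (1 + a / c) * y\<^sup>2"
      proof -
        have "0 \<le> (c * x - a * y)\<^sup>2 / (a * c)" using 3 by simp
        also have "\<dots> = c / a * x\<^sup>2 + a / c * y\<^sup>2 - 2 * x * y"
          using 3 by (simp add: field_simps power2_eq_square)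
        finally show ?thesis by (simp add: power2_sum algebra_simps)
      qed
      finally show ?thesis by (simp add: x_def y_def)
    qed
    then have "(\<integral>z. (cmod (f z + g z))\<^sup>2 \<partial>polydisc_measure \<beta>)
        \<le> (\<integral>z. (1 + c / a) * (cmod (f z))\<^sup>2 + (1 + a / c) * (cmod (g z))\<^sup>2 \<partial>polydisc_measure \<beta>)"
      using I bergman_spaceD(4)[OF bergman_space_lincomb[OF f g, of 1 1]]
      by (intro integral_mono Bochner_Integration.integrable_add integrable_mult_right) auto
    also have "\<dots> = (1 + c / a) * a\<^sup>2 + (1 + a / c) * c\<^sup>2"
      using I by (simp add: a_def c_def bergman_norm_power2)
    also have "\<dots> = (a + c)\<^sup>2" using 3 by (simp add: field_simps power2_eq_square)
    finally have "(bergman_norm \<beta> (\<lambda>z. f z + g z))\<^sup>2 \<le> (a + c)\<^sup>2" by (simp add: bergman_norm_power2)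
    then show ?thesis using nn by (auto simp: a_def c_def intro: power2_le_imp_le)
  qed
qed

lemma Metric_space_bergman:
  assumes b: "\<beta> > -1"
  shows "Metric_space (bergman_space \<beta> :: (complex ^ 'n \<Rightarrow> complex) set) (\<lambda>f g. bergman_norm \<beta> (\<lambda>z. f z - g z))"
proof
  fix f g h :: "complex ^ 'n \<Rightarrow> complex"
  show "0 \<le> bergman_norm \<beta> (\<lambda>z. f z - g z)" by (rule bergman_norm_nonneg)
  show "bergman_norm \<beta> (\<lambda>z. f z - g z) = bergman_norm \<beta> (\<lambda>z. g z - f z)"
    by (simp add: bergman_norm_def norm_minus_commute)
  show "(bergman_norm \<beta> (\<lambda>z. f z - g z) = 0) = (f = g)" if "f \<in> bergman_space \<beta>" "g \<in> bergman_space \<beta>"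
  proof
    assume "bergman_norm \<beta> (\<lambda>z. f z - g z) = 0"
    from bergman_norm_eq_0[OF b bergman_space_diff[OF that] this] show "f = g" by (auto simp: fun_eq_iff)
  qed (simp add: bergman_norm_def)
  show "bergman_norm \<beta> (\<lambda>z. f z - h z) \<le> bergman_norm \<beta> (\<lambda>z. f z - g z) + bergman_norm \<beta> (\<lambda>z. g z - h z)"
    if "f \<in> bergman_space \<beta>" "g \<in> bergman_space \<beta>" "h \<in> bergman_space \<beta>"
    using bergman_norm_triangle[OF b bergman_space_diff[OF that(1,2)] bergman_space_diff[OF that(2,3)]] by simp
qed

subsection \<open>Locally uniform limits\<close>

text \<open>A Cauchy estimate from Schwarz-Pick. The complex line through \<open>x\<close> and
  \<open>y\<close> is scaled so that the unit disc has radius \<rho> on it; then \<open>y\<close>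
  has parameter \<open>q = norm (y - x) / \<rho> \<le> 1/2\<close>, and
  \<open>1 - q \<ge> 1/2\<close> yields the factor 2.\<close>

lemma holomorphic_lipschitz:
  fixes f :: "complex ^ 'n \<Rightarrow> complex"
  assumes f: "holomorphic_several_on f S" and \<rho>: "\<rho> > 0" and B: "B > 0"
    and sub: "\<And>z. norm (z - x) < \<rho> \<Longrightarrow> z \<in> S" and bd: "\<And>z. norm (z - x) < \<rho> \<Longrightarrow> cmod (f z) < B"
    and y: "norm (y - x) \<le> \<rho> / 2"
  shows "cmod (f y - f x) \<le> 2 * B / \<rho> * norm (y - x)"
proof (cases "y = x")
  case False
  define n where "n = norm (y - x)"
  have n: "0 < n" "n \<le> \<rho> / 2" using False y by (auto simp: n_def)
  define v where "v = (\<rho> / n) *\<^sub>R (y - x)"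
  define h where "h l = f (x + l *s v) / of_real B" for l
  have nv: "norm (l *s v) = cmod l * \<rho>" for l
  proof -
    have "norm (l *s v) = cmod l * norm v"
      by (simp add: norm_vec_def norm_mult L2_set_right_distrib)
    also have "norm v = \<rho>" using n \<rho> by (simp add: v_def n_def)
    finally show ?thesis .
  qed
  have near: "norm ((x + l *s v) - x) < \<rho>" if "cmod l < 1" for l
    using that \<rho> by (simp add: nv)
  have "(\<lambda>l. f (x + l *s v)) holomorphic_on ball 0 1"
    by (rule holomorphic_several_slice[OF f]) (use near sub in auto)
  then have hol: "h holomorphic_on ball 0 1" unfolding h_def using B by (intro holomorphic_intros) auto
  have less: "cmod (h l) < 1" if "cmod l < 1" for l
    using bd[OF near[OF that]] B by (simp add: h_def norm_divide)
  define q where "q = n / \<rho>"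
  have q: "0 < q" "q \<le> 1/2" using n \<rho> by (auto simp: q_def field_simps)
  have cq: "cmod (of_real q) = q" using q by simp
  have eq: "x + of_real q *s v = y"
    using n \<rho> by (simp add: vec_eq_iff v_def q_def) (simp add: scaleR_conv_of_real)
  have "cmod (h (of_real q) - h 0) * (1 - cmod (of_real q)) \<le> cmod (of_real q) * (1 - (cmod (h 0))\<^sup>2)"
    using q cq by (intro schwarz_pick_disc(2)[OF hol less]) auto
  then have "cmod (h (of_real q) - h 0) * (1 - q) \<le> q * (1 - (cmod (h 0))\<^sup>2)" using cq by simp
  also have "\<dots> \<le> q * 1" using q by (intro mult_left_mono) auto
  finally have 1: "cmod (h (of_real q) - h 0) * (1 - q) \<le> q" by simp
  have "cmod (h (of_real q) - h 0) * (1/2) \<le> cmod (h (of_real q) - h 0) * (1 - q)"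
    using q by (intro mult_left_mono) auto
  with 1 have "cmod (h (of_real q) - h 0) \<le> 2 * q" by simp
  moreover have "h (of_real q) - h 0 = (f y - f x) / of_real B"
    by (simp add: h_def eq diff_divide_distrib)
  ultimately have "cmod (f y - f x) / B \<le> 2 * q" using B by (simp add: norm_divide)
  then show ?thesis using B by (simp add: q_def n_def field_simps)
qed simp

text \<open>The Lipschitz bound passes to the difference quotients along \<open>v\<close>; complex
  homogeneity of \<open>D\<close> identifies their limit with \<open>D v\<close>.\<close>

lemma holomorphic_derivative_bound:
  fixes f :: "complex ^ 'n \<Rightarrow> complex"
  assumes f: "holomorphic_several_on f S" and \<rho>: "\<rho> > 0" and B: "B > 0"
    and sub: "\<And>z. norm (z - x) < \<rho> \<Longrightarrow> z \<in> S" and bd: "\<And>z. norm (z - x) < \<rho> \<Longrightarrow> cmod (f z) < B"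
    and D: "(f has_derivative D) (at x)" "\<And>c v. D (c *s v) = c * D v"
  shows "cmod (D v) \<le> 2 * B / \<rho> * norm v"
proof (cases "v = 0")
  case True
  then show ?thesis using has_derivative_bounded_linear[OF D(1)] by (simp add: bounded_linear.linear linear_0)
next
  case False
  have "linear (\<lambda>h::complex. h *s v)"
    by (rule linearI) (auto simp: vec_eq_iff algebra_simps)
  then have "((\<lambda>h. h *s v) has_derivative (\<lambda>h. h *s v)) (at 0)"
    by (simp add: linear_conv_bounded_linear bounded_linear_imp_has_derivative)
  then have "((\<lambda>h. x + h *s v) has_derivative (\<lambda>h. h *s v)) (at 0)"
    using has_derivative_add_const[of "\<lambda>h. h *s v" "\<lambda>h. h *s v" "at 0" x] by (simp add: add.commute)
  from has_derivative_compose[OF this, of f D] D(1)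
  have "((\<lambda>h. f (x + h *s v)) has_derivative (\<lambda>h. D (h *s v))) (at 0)" by simp
  moreover have "(\<lambda>h. D (h *s v)) = (*) (D v)" by (simp add: D(2) fun_eq_iff mult.commute)
  ultimately have "((\<lambda>h. f (x + h *s v)) has_field_derivative D v) (at 0)"
    by (simp add: has_field_derivative_def)
  then have "((\<lambda>h. (f (x + h *s v) - f x) / h) \<longlongrightarrow> D v) (at 0)" by (simp add: DERIV_def)
  then have lim: "((\<lambda>h. norm ((f (x + h *s v) - f x) / h)) \<longlongrightarrow> norm (D v)) (at 0)"
    by (rule tendsto_norm)
  have nv: "norm (h *s v) = cmod h * norm v" for h
    by (simp add: norm_vec_def norm_mult L2_set_right_distrib)
  have "\<forall>\<^sub>F h in at (0::complex). norm ((f (x + h *s v) - f x) / h) \<le> 2 * B / \<rho> * norm v"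
    unfolding eventually_at
  proof (intro exI[of _ "\<rho> / (2 * norm v)"] conjI ballI impI)
    show "\<rho> / (2 * norm v) > 0" using \<rho> False by simp
    fix h :: complex assume h: "h \<noteq> 0 \<and> dist h 0 < \<rho> / (2 * norm v)"
    then have "norm ((x + h *s v) - x) \<le> \<rho> / 2" using False by (simp add: nv field_simps)
    from holomorphic_lipschitz[OF f \<rho> B sub bd this]
    have "cmod (f (x + h *s v) - f x) \<le> 2 * B / \<rho> * (cmod h * norm v)" by (simp add: nv)
    then show "norm ((f (x + h *s v) - f x) / h) \<le> 2 * B / \<rho> * norm v"
      using h by (simp add: norm_divide field_simps)
  qed
  from tendsto_upperbound[OF lim this] show ?thesis by simp
qed

text \<open>Weierstrass' theorem: the derivative bound on balls of half the radius makes the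
  derivatives uniformly Cauchy, so real differentiation of a sequence applies, and complex
  homogeneity is inherited by the limit.\<close>

lemma holomorphic_several_limit:
  fixes f :: "nat \<Rightarrow> complex ^ 'n \<Rightarrow> complex"
  assumes f: "\<And>n. holomorphic_several_on (f n) S"
    and conv: "\<And>x. x \<in> S \<Longrightarrow> \<exists>\<rho>>0. ball x \<rho> \<subseteq> S \<and> (\<forall>e>0. \<exists>N. \<forall>n\<ge>N. \<forall>z\<in>ball x \<rho>. cmod (f n z - g z) < e)"
  shows "holomorphic_several_on g S"
  unfolding holomorphic_several_on_def
proof
  fix x assume "x \<in> S"
  then obtain \<rho> where \<rho>: "\<rho> > 0" "ball x \<rho> \<subseteq> S"
    and unif: "\<And>e. e > 0 \<Longrightarrow> \<exists>N. \<forall>n\<ge>N. \<forall>z\<in>ball x \<rho>. cmod (f n z - g z) < e"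
    using conv by meson
  have "\<forall>n. \<forall>y\<in>S. \<exists>D. (f n has_derivative D) (at y) \<and> (\<forall>c v. D (c *s v) = c * D v)"
    using f unfolding holomorphic_several_on_def by blast
  then obtain D where D: "\<And>n y. y \<in> S \<Longrightarrow> (f n has_derivative D n y) (at y)"
    "\<And>n y c v. y \<in> S \<Longrightarrow> D n y (c *s v) = c * D n y v" by metis
  let ?S = "ball x (\<rho> / 2)"
  have sub: "ball y (\<rho> / 2) \<subseteq> ball x \<rho>" if "y \<in> ?S" for y
  proof
    fix z assume "z \<in> ball y (\<rho> / 2)"
    then show "z \<in> ball x \<rho>" using that dist_triangle[of x z y] by simp
  qed
  have Sx: "?S \<subseteq> S" using \<rho> by auto
  have cauchy: "\<exists>N. \<forall>m\<ge>N. \<forall>n\<ge>N. \<forall>y\<in>?S. \<forall>v. cmod (D n y v - D m y v) \<le> e * norm v" if e: "e > 0" for e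
  proof -
    \<comment> \<open>Solves \<open>2 * B / (\<rho> / 2) = e\<close>; each of \<open>f n\<close> and
      \<open>f m\<close> is within \<open>B / 2\<close> of \<open>g\<close>.\<close>
    define B where "B = e * \<rho> / 4"
    have B: "B > 0" using e \<rho> by (simp add: B_def)
    have "\<exists>N. \<forall>n\<ge>N. \<forall>z\<in>ball x \<rho>. cmod (f n z - g z) < B / 2" by (rule unif) (use B in simp)
    then obtain N where N: "\<And>n z. n \<ge> N \<Longrightarrow> z \<in> ball x \<rho> \<Longrightarrow> cmod (f n z - g z) < B / 2" by blast
    have "cmod (D n y v - D m y v) \<le> e * norm v" if mn: "m \<ge> N" "n \<ge> N" and y: "y \<in> ?S" for m n y v
    proof -
      have yS: "y \<in> S" using y Sx by blast
      have "((\<lambda>z. f n z - f m z) has_derivative (\<lambda>v. D n y v - D m y v)) (at y)"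
        by (intro has_derivative_diff D yS)
      moreover have "cmod (f n z - f m z) < B" if "norm (z - y) < \<rho> / 2" for z
      proof -
        have "z \<in> ball x \<rho>" using sub[OF y] that by (auto simp: dist_norm norm_minus_commute)
        then show ?thesis using N[OF mn(1), of z] N[OF mn(2), of z] norm_triangle_ineq4[of "f n z - g z" "f m z - g z"] by simp
      qed
      moreover have "z \<in> S" if "norm (z - y) < \<rho> / 2" for z
        using subsetD[OF \<rho>(2) subsetD[OF sub[OF y]], of z] that by (simp add: dist_norm norm_minus_commute)
      moreover have "D n y (c *s v) - D m y (c *s v) = c * (D n y v - D m y v)" for c v
        by (simp add: D(2)[OF yS] right_diff_distrib)
      ultimately have "cmod (D n y v - D m y v) \<le> 2 * B / (\<rho> / 2) * norm v"
        using \<rho>(1) B by (intro holomorphic_derivative_bound[OF holomorphic_several_diff[OF f[of n] f[of m]]]) simp_all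
      also have "2 * B / (\<rho> / 2) = e" using \<rho> by (simp add: B_def)
      finally show ?thesis .
    qed
    then show ?thesis by blast
  qed
  define D' where "D' y v = lim (\<lambda>n. D n y v)" for y v
  have lim: "(\<lambda>n. D n y v) \<longlonglongrightarrow> D' y v" if y: "y \<in> ?S" for y v
  proof -
    have "Cauchy (\<lambda>n. D n y v)"
    proof (rule CauchyI)
      fix e :: real assume e: "e > 0"
      then have "e / (norm v + 1) > 0" by (simp add: add_nonneg_pos)
      from cauchy[OF this] obtain N where N: "\<And>m n. m \<ge> N \<Longrightarrow> n \<ge> N \<Longrightarrow> cmod (D n y v - D m y v) \<le> e / (norm v + 1) * norm v"
        using y by blast
      have "e / (norm v + 1) * norm v < e"
      proof -
        have "e * norm v < e * (norm v + 1)" using e by simp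
        then show ?thesis by (simp add: divide_less_eq add_nonneg_pos)
      qed
      then show "\<exists>M. \<forall>m\<ge>M. \<forall>n\<ge>M. norm (D m y v - D n y v) < e"
        using N by (meson le_less_trans)
    qed
    then show ?thesis unfolding D'_def by (simp add: Cauchy_convergent_iff convergent_LIMSEQ_iff)
  qed
  have D'_near: "\<forall>\<^sub>F n in sequentially. \<forall>y\<in>?S. \<forall>v. norm (D n y v - D' y v) \<le> e * norm v" if e: "e > 0" for e
  proof -
    obtain N where N: "\<And>m n y v. m \<ge> N \<Longrightarrow> n \<ge> N \<Longrightarrow> y \<in> ?S \<Longrightarrow> cmod (D n y v - D m y v) \<le> e * norm v"
      using cauchy[OF e] by blast
    have "norm (D n y v - D' y v) \<le> e * norm v" if n: "n \<ge> N" and y: "y \<in> ?S" for n y v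
    proof -
      have "(\<lambda>m. norm (D n y v - D m y v)) \<longlonglongrightarrow> norm (D n y v - D' y v)"
        by (intro tendsto_intros lim y)
      then show ?thesis
        by (rule tendsto_upperbound) (use N n y in \<open>auto simp: eventually_sequentially intro!: exI[of _ N]\<close>)
    qed
    then show ?thesis unfolding eventually_sequentially by blast
  qed
  have flim: "(\<lambda>n. f n y) \<longlonglongrightarrow> g y" if "y \<in> ball x \<rho>" for y
  proof (rule LIMSEQ_I)
    fix e :: real assume "e > 0"
    then show "\<exists>N. \<forall>n\<ge>N. norm (f n y - g y) < e" using unif[of e] that by blast
  qed
  have xS: "x \<in> ?S" "x \<in> S" "x \<in> ball x \<rho>" using \<rho> by auto
  have "\<exists>g2. \<forall>y\<in>?S. (\<lambda>n. f n y) \<longlonglongrightarrow> g2 y \<and> (g2 has_derivative D' y) (at y within ?S)"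
  proof (rule has_derivative_sequence[of ?S f D D' x "g x"])
    show "convex ?S" by (rule convex_ball)
    show "(f n has_derivative D n y) (at y within ?S)" if "y \<in> ?S" for n y
      using D(1)[of y n] Sx that by (blast intro: has_derivative_at_withinI)
    show "(\<lambda>n. f n x) \<longlonglongrightarrow> g x" by (rule flim[OF xS(3)])
  qed (fact D'_near, fact xS(1))
  then obtain g2 where g2: "\<And>y. y \<in> ?S \<Longrightarrow> (\<lambda>n. f n y) \<longlonglongrightarrow> g2 y" "(g2 has_derivative D' x) (at x within ?S)"
    using xS(1) by blast
  have g2g: "g2 y = g y" if "y \<in> ?S" for y
  proof -
    have "y \<in> ball x \<rho>" using that \<rho> by auto
    then show ?thesis using LIMSEQ_unique[OF g2(1)[OF that] flim] by simp
  qed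
  have "(g2 has_derivative D' x) (at x)" using g2(2) at_within_open[OF xS(1) open_ball] by simp
  then have "(g has_derivative D' x) (at x)"
    by (rule has_derivative_transform_within_open[OF _ open_ball xS(1) g2g])
  moreover have "D' x (c *s v) = c * D' x v" for c v
  proof -
    have "(\<lambda>n. D n x (c *s v)) \<longlonglongrightarrow> c * D' x v"
      unfolding D(2)[OF xS(2)] by (intro tendsto_intros lim xS)
    then show ?thesis using LIMSEQ_unique[OF lim[OF xS(1)]] by blast
  qed
  ultimately show "\<exists>D. (g has_derivative D) (at x) \<and> (\<forall>c v. D (c *s v) = c * D v)" by blast
qed

section \<open>Weights vanishing on the boundary and a Montel theorem\<close>

lemma continuous_on_boundary_product:
  assumes "p > 0"
  shows "continuous_on cpolydisc (\<lambda>z::complex ^ 'n. \<Prod>k\<in>UNIV. (1 - cmod (z $ k)) powr p)"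
  using assms by (intro continuous_on_prod continuous_on_powr' continuous_intros) (auto simp: cpolydisc_def)

lemma boundary_product_le_1:
  assumes "z \<in> cpolydisc" "p \<ge> 0"
  shows "(\<Prod>k\<in>UNIV. (1 - cmod (z $ k)) powr p) \<le> (1::real)"
  using assms by (intro prod_le_1) (auto simp: cpolydisc_def powr_le1)

lemma boundary_product_0:
  fixes z :: "complex ^ 'n"
  assumes "z \<in> cpolydisc" "z \<notin> polydisc"
  shows "(\<Prod>k\<in>UNIV. (1 - cmod (z $ k)) powr p) = (0::real)"
proof -
  obtain k where "\<not> cmod (z $ k) < 1" using assms(2) by (auto simp: polydisc_def)
  then have "cmod (z $ k) = 1" using assms(1) by (auto simp: cpolydisc_def intro: antisym)
  then show ?thesis by (auto simp: prod_zero_iff intro!: exI[of _ k])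
qed

lemma polydisc_coordinate_bound:
  fixes z :: "complex ^ 'n"
  assumes "z \<in> polydisc"
  obtains s where "0 \<le> s" "s < 1" "\<And>k. cmod (z $ k) \<le> s"
proof
  show "Max (range (\<lambda>k. cmod (z $ k))) < 1" using assms by (simp add: polydisc_def)
  show "cmod (z $ k) \<le> Max (range (\<lambda>k. cmod (z $ k)))" for k by simp
  show "0 \<le> Max (range (\<lambda>k. cmod (z $ k)))"
    using Max_ge[of "range (\<lambda>k. cmod (z $ k))" "cmod (z $ undefined)"] by (rule order_trans[rotated]) auto
qed

text \<open>The weight \<open>\<psi>\<close> makes the family equicontinuous on the closed polydisc, so that no
  exhaustion by compact sets is needed.\<close>

lemma bergman_montel:
  fixes f :: "nat \<Rightarrow> complex ^ 'n \<Rightarrow> complex"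
  assumes b: "\<beta> > -1" and f: "\<And>n. f n \<in> bergman_space \<beta>" and R: "\<And>n. bergman_norm \<beta> (f n) \<le> R"
  shows "\<exists>r g. strict_mono (r :: nat \<Rightarrow> nat) \<and> g \<in> bergman_space \<beta> \<and> bergman_norm \<beta> g \<le> R \<and>
    (\<forall>s<1. \<forall>e>0. \<exists>N. \<forall>n\<ge>N. \<forall>z. (\<forall>k. cmod (z $ k) \<le> s) \<longrightarrow> cmod (f (r n) z - g z) < e)"
proof -
  have R0: "0 \<le> R" using R[of 0] bergman_norm_nonneg[of \<beta> "f 0"] by linarith
  obtain C where C: "C > 0" "\<And>(f :: complex ^ 'n \<Rightarrow> complex) w. f \<in> bergman_space \<beta> \<Longrightarrow> w \<in> polydisc \<Longrightarrow>
    (cmod (f w))\<^sup>2 \<le> C * (\<Prod>k\<in>UNIV. (1 - cmod (w $ k)) powr (- 2 - \<beta>)) * (bergman_norm \<beta> f)\<^sup>2"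
    using bergman_pointwise[OF b, where 'n='n] by blast
  define q where "q = 2 + \<beta>"
  have q: "q > 0" using b by (simp add: q_def)
  \<comment> \<open>The summand 1 keeps \<open>K\<close> positive when \<open>R = 0\<close>;
    \<open>e / K\<close> occurs below.\<close>
  define K where "K = sqrt C * R + 1"
  have K: "K > 0" using C(1) R0 by (simp add: K_def add_nonneg_pos)
  have fle: "cmod (f n z) \<le> K * (\<Prod>k\<in>UNIV. (1 - cmod (z $ k)) powr (- (q / 2)))" if z: "z \<in> polydisc" for n z
  proof (rule power2_le_imp_le)
    let ?P = "\<Prod>k\<in>UNIV. (1 - cmod (z $ k)) powr (- (q / 2))"
    have eq: "(\<Prod>k\<in>UNIV. (1 - cmod (z $ k)) powr (- 2 - \<beta>)) = ?P\<^sup>2"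
      unfolding prod_power_distrib
    proof (intro prod.cong refl)
      fix k
      have "((1 - cmod (z $ k)) powr (- (q / 2)))\<^sup>2 = (1 - cmod (z $ k)) powr (- (q / 2) + - (q / 2))"
        unfolding powr_add by (simp add: power2_eq_square)
      then show "(1 - cmod (z $ k)) powr (- 2 - \<beta>) = ((1 - cmod (z $ k)) powr (- (q / 2)))\<^sup>2" by (simp add: q_def)
    qed
    have "(cmod (f n z))\<^sup>2 \<le> C * ?P\<^sup>2 * (bergman_norm \<beta> (f n))\<^sup>2" using C(2)[OF f z, of n] unfolding eq .
    also have "\<dots> \<le> C * ?P\<^sup>2 * R\<^sup>2"
      using C(1) R[of n] bergman_norm_nonneg[of \<beta> "f n"] by (intro mult_left_mono power_mono) auto
    also have "\<dots> = (sqrt C * R * ?P)\<^sup>2" using C(1) by (simp add: power_mult_distrib)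
    also have "\<dots> \<le> (K * ?P)\<^sup>2"
      using C(1) R0 by (intro power_mono mult_right_mono prod_nonneg mult_nonneg_nonneg) (auto simp: K_def)
    finally show "(cmod (f n z))\<^sup>2 \<le> (K * ?P)\<^sup>2" .
    show "0 \<le> K * ?P" using K by (intro mult_nonneg_nonneg prod_nonneg) auto
  qed
  \<comment> \<open>\<open>\<psi>\<close> is the square of \<open>H\<close>, while
    \<open>f n\<close> grows at most like \<open>K / H\<close> inside. So \<open>F n\<close> is
    bounded by \<open>K * H\<close> and tends to 0 at the boundary uniformly in \<open>n\<close>,
    which settles equicontinuity there.\<close>
  define \<psi> where "\<psi> z = (\<Prod>k\<in>UNIV. (1 - cmod (z $ k)) powr q)" for z :: "complex ^ 'n"
  define H where "H z = (\<Prod>k\<in>UNIV. (1 - cmod (z $ k)) powr (q / 2))" for z :: "complex ^ 'n"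
  define F where "F n z = of_real (\<psi> z) * f n z" for n z
  have \<psi>0: "0 \<le> \<psi> z" and H0: "0 \<le> H z" for z unfolding \<psi>_def H_def by (intro prod_nonneg; simp)+
  have \<psi>c: "continuous_on cpolydisc \<psi>" and Hc: "continuous_on cpolydisc H"
    unfolding \<psi>_def H_def using q by (intro continuous_on_boundary_product; simp)+
  have \<psi>1: "\<psi> z \<le> 1" and H1: "H z \<le> 1" if "z \<in> cpolydisc" for z
    unfolding \<psi>_def H_def using q that by (intro boundary_product_le_1; simp)+
  have Fle: "cmod (F n z) \<le> K * H z" if z: "z \<in> cpolydisc" for n z
  proof (cases "z \<in> polydisc")
    case True
    have "cmod (F n z) = \<psi> z * cmod (f n z)" using \<psi>0 by (simp add: F_def norm_mult)
    also have "\<dots> \<le> \<psi> z * (K * (\<Prod>k\<in>UNIV. (1 - cmod (z $ k)) powr (- (q / 2))))"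
      by (intro mult_left_mono fle True \<psi>0)
    also have "\<dots> = K * (\<Prod>k\<in>UNIV. (1 - cmod (z $ k)) powr q * (1 - cmod (z $ k)) powr (- (q / 2)))"
      by (simp add: \<psi>_def prod.distrib)
    also have "\<dots> = K * H z"
      unfolding powr_add[symmetric] H_def by simp
    finally show ?thesis .
  next
    case False
    then have "F n z = 0" using bergman_spaceD(2)[OF f] by (simp add: F_def)
    then show ?thesis using K H0 by simp
  qed
  have equi: "\<exists>d>0. \<forall>n y. y \<in> cpolydisc \<and> norm (x - y) < d \<longrightarrow> norm (F n x - F n y) < e"
    if x: "x \<in> cpolydisc" and e: "e > 0" for x e
  proof (cases "x \<in> polydisc")
    case False
    then have Hx: "H x = 0" unfolding H_def by (rule boundary_product_0[OF x])
    obtain d where d: "d > 0" "\<And>y. y \<in> cpolydisc \<Longrightarrow> dist y x < d \<Longrightarrow> dist (H y) (H x) < e / K"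
    proof (rule continuous_onE[OF Hc x])
      show "0 < e / K" using e K by simp
    qed (use less_imp_le in blast)
    have "norm (F n x - F n y) < e" if y: "y \<in> cpolydisc" "norm (x - y) < d" for n y
    proof -
      have "F n x = 0" using Fle[OF x, of n] Hx by simp
      then have "norm (F n x - F n y) \<le> K * H y" using Fle[OF y(1), of n] by simp
      also have "\<dots> < K * (e / K)"
        using d(2)[OF y(1)] y(2) Hx K by (intro mult_strict_left_mono) (auto simp: dist_norm norm_minus_commute)
      also have "\<dots> = e" using K by simp
      finally show ?thesis .
    qed
    then show ?thesis using d(1) by blast
  next
    case True
    obtain \<rho> where \<rho>: "\<rho> > 0" "cball x \<rho> \<subseteq> polydisc"
      using True open_polydisc unfolding open_contains_cball by blast
    let ?P = "\<lambda>z::complex ^ 'n. K * (\<Prod>k\<in>UNIV. (1 - cmod (z $ k)) powr (- (q / 2)))"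
    have "continuous_on (cball x \<rho>) ?P"
    proof (intro continuous_on_mult_left continuous_on_prod continuous_on_powr' continuous_intros ballI)
      fix k :: 'n and z assume "z \<in> cball x \<rho>"
      then have "cmod (z $ k) < 1" using \<rho>(2) by (auto simp: polydisc_def)
      then show "0 \<le> 1 - cmod (z $ k) \<and> (1 - cmod (z $ k) = 0 \<longrightarrow> 0 < - (q / 2))" by simp
    qed
    then have "bounded (?P ` cball x \<rho>)" by (intro compact_imp_bounded compact_continuous_image compact_cball)
    then obtain B0 where "\<forall>z\<in>cball x \<rho>. \<bar>?P z\<bar> \<le> B0" by (auto simp: bounded_iff)
    then have B0: "\<bar>?P z\<bar> \<le> B0" if "z \<in> cball x \<rho>" for z using that by blast
    define B where "B = \<bar>B0\<bar> + 1"
    have B: "B > 0" by (simp add: B_def)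
    have fB: "cmod (f n z) < B" if "norm (z - x) < \<rho>" for n z
    proof -
      have z: "z \<in> cball x \<rho>" using that by (simp add: dist_norm norm_minus_commute)
      then have "cmod (f n z) \<le> ?P z" using \<rho>(2) by (intro fle) auto
      then show ?thesis using B0[OF z] by (simp add: B_def)
    qed
    obtain d1 where d1: "d1 > 0" "\<And>y. y \<in> cpolydisc \<Longrightarrow> dist y x < d1 \<Longrightarrow> dist (\<psi> y) (\<psi> x) < e / (2 * B)"
    proof (rule continuous_onE[OF \<psi>c x])
      show "0 < e / (2 * B)" using e B by simp
    qed (use less_imp_le in blast)
    \<comment> \<open>\<open>e * \<rho> / (4 * B)\<close> makes the Lipschitz estimate for
      \<open>f n\<close> at most \<open>e / 2\<close>; \<open>d1\<close> gives the other half
      through the variation of \<psi>.\<close>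
    define d where "d = min d1 (min (\<rho> / 2) (e * \<rho> / (4 * B)))"
    have d: "d > 0" using d1(1) \<rho>(1) e B by (simp add: d_def)
    have "norm (F n x - F n y) < e" if y: "y \<in> cpolydisc" "norm (x - y) < d" for n y
    proof -
      have nyx: "norm (y - x) < d1" "norm (y - x) \<le> \<rho> / 2" "norm (y - x) < e * \<rho> / (4 * B)"
        using y(2) by (auto simp: d_def norm_minus_commute)
      have "cmod (f n y - f n x) \<le> 2 * B / \<rho> * norm (y - x)"
        using \<rho> by (intro holomorphic_lipschitz[OF bergman_spaceD(1)[OF f] \<rho>(1) B _ fB nyx(2)])
          (auto simp: dist_norm norm_minus_commute subset_eq)
      also have "\<dots> \<le> 2 * B / \<rho> * (e * \<rho> / (4 * B))"
        using \<rho>(1) B nyx(3) by (intro mult_left_mono) auto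
      also have "\<dots> = e / 2" using \<rho>(1) B by simp
      finally have l1: "cmod (f n y - f n x) \<le> e / 2" .
      have "F n y - F n x = of_real (\<psi> y) * (f n y - f n x) + of_real (\<psi> y - \<psi> x) * f n x"
        by (simp add: F_def algebra_simps)
      then have "cmod (F n y - F n x) \<le> cmod (of_real (\<psi> y) * (f n y - f n x)) + cmod (of_real (\<psi> y - \<psi> x) * f n x)"
        by (metis norm_triangle_ineq)
      also have "\<dots> = \<psi> y * cmod (f n y - f n x) + \<bar>\<psi> y - \<psi> x\<bar> * cmod (f n x)"
        using \<psi>0 by (simp only: norm_mult norm_of_real abs_of_nonneg)
      also have "\<dots> < e / 2 + e / 2"
      proof (rule add_le_less_mono)
        show "\<psi> y * cmod (f n y - f n x) \<le> e / 2"
          using mult_mono[OF \<psi>1[OF y(1)] l1] by simp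
        have "\<bar>\<psi> y - \<psi> x\<bar> < e / (2 * B)" using d1(2)[OF y(1)] nyx(1) by (simp add: dist_norm)
        then have "\<bar>\<psi> y - \<psi> x\<bar> * cmod (f n x) \<le> \<bar>\<psi> y - \<psi> x\<bar> * B"
          using fB[of x n] \<rho>(1) by (intro mult_left_mono) auto
        also have "\<dots> < e / (2 * B) * B" using \<open>\<bar>\<psi> y - \<psi> x\<bar> < e / (2 * B)\<close> B by (intro mult_strict_right_mono)
        also have "\<dots> = e / 2" using B by simp
        finally show "\<bar>\<psi> y - \<psi> x\<bar> * cmod (f n x) < e / 2" .
      qed
      finally show ?thesis by (simp add: norm_minus_commute)
    qed
    then show ?thesis using d by blast
  qed
  have Fbd: "norm (F n z) \<le> K" if "z \<in> cpolydisc" for n z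
    using Fle[OF that, of n] mult_left_mono[OF H1[OF that] less_imp_le[OF K]] by linarith
  have "\<exists>G r. strict_mono (r :: nat \<Rightarrow> nat) \<and>
    (\<forall>e>0. \<exists>N. \<forall>n x. n \<ge> N \<and> x \<in> cpolydisc \<longrightarrow> norm (F (r n) x - G x) < e)"
  proof (rule Arzela_Ascoli[of cpolydisc F K])
    fix G :: "complex ^ 'n \<Rightarrow> complex" and r :: "nat \<Rightarrow> nat"
    assume "strict_mono r" "\<And>e. 0 < e \<Longrightarrow> \<exists>N. \<forall>n x. n \<ge> N \<and> x \<in> cpolydisc \<longrightarrow> norm (F (r n) x - G x) < e"
    then show ?thesis by blast
  qed (fact compact_cpolydisc, fact Fbd, fact equi)
  then obtain G r where r: "strict_mono (r :: nat \<Rightarrow> nat)"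
    and G: "\<And>e. 0 < e \<Longrightarrow> \<exists>N. \<forall>n x. n \<ge> N \<and> x \<in> cpolydisc \<longrightarrow> norm (F (r n) x - G x) < e"
    by blast
  define g where "g z = (if z \<in> polydisc then G z / of_real (\<psi> z) else 0)" for z
  have unif: "\<exists>N. \<forall>n\<ge>N. \<forall>z. (\<forall>k. cmod (z $ k) \<le> s) \<longrightarrow> cmod (f (r n) z - g z) < e"
    if s: "s < 1" and e: "e > 0" for s e
  proof -
    \<comment> \<open>On the polydisc of radius \<open>s\<close> the weight is at least
      \<open>m\<close>, so dividing by it preserves uniform convergence.\<close>
    define m where "m = (\<Prod>k\<in>(UNIV::'n set). (1 - s) powr q)"
    have m: "m > 0" using s unfolding m_def by (intro prod_pos) auto
    obtain N where N: "\<And>n x. n \<ge> N \<Longrightarrow> x \<in> cpolydisc \<Longrightarrow> norm (F (r n) x - G x) < e * m"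
      using G[of "e * m"] e m by auto
    have "cmod (f (r n) z - g z) < e" if n: "n \<ge> N" and z: "\<forall>k. cmod (z $ k) \<le> s" for n z
    proof -
      have zp: "z \<in> polydisc" using z s by (auto simp: polydisc_def intro: le_less_trans)
      then have zc: "z \<in> cpolydisc" using polydisc_subset_cpolydisc by blast
      have m\<psi>: "m \<le> \<psi> z" unfolding m_def \<psi>_def using z s q by (intro prod_mono) (auto intro!: powr_mono2)
      then have p: "\<psi> z > 0" using m by simp
      have "f (r n) z - g z = (F (r n) z - G z) / of_real (\<psi> z)"
        using p zp by (simp add: g_def F_def diff_divide_distrib)
      then have "cmod (f (r n) z - g z) = cmod (F (r n) z - G z) / \<psi> z" using p by (simp add: norm_divide)
      also have "\<dots> < e"
      proof -
        have "cmod (F (r n) z - G z) < e * m" by (rule N[OF n zc])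
        also have "\<dots> \<le> e * \<psi> z" using m\<psi> e by simp
        finally show ?thesis using p by (simp add: divide_less_eq)
      qed
      finally show ?thesis .
    qed
    then show ?thesis by blast
  qed
  have hol: "holomorphic_several_on g polydisc"
  proof (rule holomorphic_several_limit[of "\<lambda>n. f (r n)"])
    fix x :: "complex ^ 'n" assume x: "x \<in> polydisc"
    obtain s where s: "s < 1" "\<And>k. cmod (x $ k) \<le> s" using polydisc_coordinate_bound[OF x] by blast
    define \<rho> where "\<rho> = (1 - s) / 2"
    have near: "cmod (z $ k) \<le> s + \<rho>" if "z \<in> ball x \<rho>" for z k
    proof -
      have "norm ((z - x) $ k) \<le> norm (z - x)" by (rule Finite_Cartesian_Product.norm_nth_le)
      then have "cmod (z $ k - x $ k) \<le> norm (z - x)" by simp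
      then have "cmod (z $ k - x $ k) \<le> \<rho>" using that by (simp add: dist_norm norm_minus_commute)
      then show ?thesis using s(2)[of k] norm_triangle_ineq2[of "z $ k" "x $ k"] by linarith
    qed
    have s': "s + \<rho> < 1" using s by (simp add: \<rho>_def field_simps)
    have "ball x \<rho> \<subseteq> polydisc" using near s' by (fastforce simp: polydisc_def intro: le_less_trans)
    moreover have "\<exists>N. \<forall>n\<ge>N. \<forall>z\<in>ball x \<rho>. cmod (f (r n) z - g z) < e" if "e > 0" for e
      using unif[OF s' that] near by blast
    moreover have "\<rho> > 0" using s by (simp add: \<rho>_def)
    ultimately show "\<exists>\<rho>>0. ball x \<rho> \<subseteq> polydisc \<and> (\<forall>e>0. \<exists>N. \<forall>n\<ge>N. \<forall>z\<in>ball x \<rho>. cmod (f (r n) z - g z) < e)"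
      by blast
  qed (rule bergman_spaceD(1)[OF f])
  have lim: "(\<lambda>n. f (r n) z) \<longlonglongrightarrow> g z" for z
  proof (cases "z \<in> polydisc")
    case True
    obtain s where s: "s < 1" "\<And>k. cmod (z $ k) \<le> s" using polydisc_coordinate_bound[OF True] by blast
    show ?thesis
    proof (rule LIMSEQ_I)
      fix e :: real assume "e > 0"
      from unif[OF s(1) this] show "\<exists>N. \<forall>n\<ge>N. norm (f (r n) z - g z) < e" using s(2) by blast
    qed
  next
    case False
    then show ?thesis using bergman_spaceD(2)[OF f] by (simp add: g_def)
  qed
  have [measurable]: "f n \<in> borel_measurable borel" for n by (rule bergman_spaceD(3)[OF f])
  have "(\<integral>\<^sup>+z. ennreal ((cmod (g z))\<^sup>2) \<partial>polydisc_measure \<beta>)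
      = (\<integral>\<^sup>+z. liminf (\<lambda>n. ennreal ((cmod (f (r n) z))\<^sup>2)) \<partial>polydisc_measure \<beta>)"
  proof (intro nn_integral_cong)
    fix z
    have "(\<lambda>n. ennreal ((cmod (f (r n) z))\<^sup>2)) \<longlonglongrightarrow> ennreal ((cmod (g z))\<^sup>2)"
      by (intro tendsto_ennrealI tendsto_intros lim)
    then show "ennreal ((cmod (g z))\<^sup>2) = liminf (\<lambda>n. ennreal ((cmod (f (r n) z))\<^sup>2))"
      by (intro lim_imp_Liminf[symmetric]) simp_all
  qed
  also have "\<dots> \<le> liminf (\<lambda>n. \<integral>\<^sup>+z. ennreal ((cmod (f (r n) z))\<^sup>2) \<partial>polydisc_measure \<beta>)"
    by (intro nn_integral_liminf) measurable
  also have "\<dots> \<le> liminf (\<lambda>n::nat. ennreal (R\<^sup>2))"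
    by (intro Liminf_mono always_eventually allI)
       (simp add: bergman_norm_nn_integral[OF f] ennreal_leI power_mono R bergman_norm_nonneg)
  also have "\<dots> = ennreal (R\<^sup>2)" by (simp add: Liminf_const)
  finally have "(\<integral>\<^sup>+z. ennreal ((cmod (g z))\<^sup>2) \<partial>polydisc_measure \<beta>) \<le> ennreal (R\<^sup>2)" .
  moreover have "g z = 0" if "z \<notin> polydisc" for z using that by (simp add: g_def)
  ultimately have "g \<in> bergman_space \<beta>" "bergman_norm \<beta> g \<le> R"
    using bergman_spaceI[OF hol _ R0] by blast+
  with r unif show ?thesis by blast
qed

subsection \<open>Sufficiency\<close>

text \<open>Inside the polydisc this is the pulled back mass relative to the product of the (1 -
  |z(k)|)^(2 + \<beta>), which is comparable to the mass of a Whitney box at \<open>z\<close>. A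
  bounded density gives a bounded operator, a density vanishing at the boundary a compact
  one.\<close>

definition carleson_density :: "(complex ^ 'n \<Rightarrow> complex ^ 'n) \<Rightarrow> real \<Rightarrow> complex ^ 'n \<Rightarrow> ennreal" where
  "carleson_density \<phi> \<beta> z = emeasure (polydisc_measure \<beta>) (preimage_whitney \<phi> z)
      * ennreal (\<Prod>k\<in>UNIV. (1 - cmod (z $ k)) powr (- 2 - \<beta>))"

lemma composition_operator_holomorphic:
  assumes "holomorphic_self_map \<phi>" "holomorphic_several_on f polydisc"
  shows "holomorphic_several_on (composition_operator \<phi> f) polydisc"
proof (rule holomorphic_several_transform)
  show "holomorphic_several_on (\<lambda>z. f (\<phi> z)) polydisc"
  proof (rule holomorphic_several_compose[of f polydisc \<phi> polydisc])
    show "holomorphic_several_on (\<lambda>z. \<phi> z $ k) polydisc" for k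
      using assms(1) by (simp add: holomorphic_self_map_def)
    show "\<phi> ` polydisc \<subseteq> polydisc" using assms(1) by (simp add: holomorphic_self_map_def)
  qed (rule assms(2))
qed (auto simp: composition_operator_def)

text \<open>Joint measurability for Fubini. \<open>h\<close> replaces \<phi> because the assumption
  gives no regularity of \<phi> outside the polydisc.\<close>

lemma indicator_preimage_whitney_measurable:
  fixes \<phi> :: "complex ^ 'n \<Rightarrow> complex ^ 'n"
  assumes hol: "holomorphic_self_map \<phi>"
  shows "(\<lambda>(w, z). indicator (preimage_whitney \<phi> z) w :: ennreal)
    \<in> borel_measurable (polydisc_measure \<beta> \<Otimes>\<^sub>M polydisc_measure \<beta>)"
proof -
  define h where "h k w = (if w \<in> polydisc then \<phi> w $ k else 0)" for k w
  have [measurable]: "h k \<in> borel_measurable borel" for k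
  proof (rule holomorphic_several_measurable)
    show "holomorphic_several_on (h k) polydisc"
      by (rule holomorphic_several_transform[of "\<lambda>w. \<phi> w $ k"])
         (use hol in \<open>auto simp: holomorphic_self_map_def h_def\<close>)
  qed (simp add: h_def)
  have "preimage_whitney \<phi> z = {w. w \<in> polydisc \<and> (\<forall>k. cmod (z $ k - h k w) < (1 - cmod (h k w)) / 2)}" for z
    by (auto simp: preimage_whitney_def whitney_def h_def)
  then have "(\<lambda>(w, z). indicator (preimage_whitney \<phi> z) w :: ennreal)
    = (\<lambda>p. indicator {p \<in> space (polydisc_measure \<beta> \<Otimes>\<^sub>M polydisc_measure \<beta>). fst p \<in> polydisc \<and>
        (\<forall>k. cmod (snd p $ k - h k (fst p)) < (1 - cmod (h k (fst p))) / 2)} p)"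
    by (auto simp: fun_eq_iff indicator_def space_pair_measure)
  also have "\<dots> \<in> borel_measurable (polydisc_measure \<beta> \<Otimes>\<^sub>M polydisc_measure \<beta>)"
    by measurable
  finally show ?thesis .
qed

lemma nn_integral_mono_polydisc:
  fixes f g :: "complex ^ 'n \<Rightarrow> ennreal"
  assumes "\<beta> > -1" "\<And>z. z \<in> polydisc \<Longrightarrow> f z \<le> g z"
  shows "(\<integral>\<^sup>+z. f z \<partial>polydisc_measure \<beta>) \<le> (\<integral>\<^sup>+z. g z \<partial>polydisc_measure \<beta>)"
  by (rule nn_integral_mono_AE, rule AE_mp[OF AE_polydisc[OF assms(1)]], intro AE_I2 impI assms(2))

lemma boundary_product_inverse:
  fixes z :: "complex ^ 'n"
  assumes "z \<in> polydisc"
  shows "(\<Prod>k\<in>UNIV. (1 - cmod (z $ k)) powr p) * (\<Prod>k\<in>UNIV. (1 - cmod (z $ k)) powr (- p)) = 1"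
proof -
  have "1 - cmod (z $ k) > 0" for k using assms by (simp add: polydisc_def)
  then have "(1 - cmod (z $ k)) powr (p + - p) = 1" for k by (simp add: less_imp_neq[symmetric])
  then show ?thesis unfolding prod.distrib[symmetric] powr_add[symmetric] by simp
qed

text \<open>The mean value inequality at \<open>\<phi> w\<close> bounds the integrand by an integral
  over \<open>z\<close>. On the box the weight at \<open>\<phi> w\<close> is replaced by the weight
  at \<open>z\<close>, so that after exchanging the integrals the inner one is the mass of
  \<open>preimage_whitney \<phi> z\<close>.\<close>

lemma composition_carleson_bound:
  fixes \<phi> :: "complex ^ 'n \<Rightarrow> complex ^ 'n"
  assumes b: "\<beta> > -1" and hol: "holomorphic_self_map \<phi>"
  shows "\<exists>C>0. \<forall>f. holomorphic_several_on f polydisc \<longrightarrow> f \<in> borel_measurable borel \<longrightarrow>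
    (\<integral>\<^sup>+w. ennreal ((cmod (composition_operator \<phi> f w))\<^sup>2) \<partial>polydisc_measure \<beta>)
      \<le> ennreal C * (\<integral>\<^sup>+z. ennreal ((cmod (f z))\<^sup>2) * carleson_density \<phi> \<beta> z \<partial>polydisc_measure \<beta>)"
proof -
  obtain C where C: "C > 0" "\<And>(f :: complex ^ 'n \<Rightarrow> complex) w. holomorphic_several_on f polydisc \<Longrightarrow> f \<in> borel_measurable borel \<Longrightarrow> w \<in> polydisc \<Longrightarrow>
    ennreal ((cmod (f w))\<^sup>2)
      \<le> ennreal (C * (\<Prod>k\<in>UNIV. (1 - cmod (w $ k)) powr (- 2 - \<beta>)))
        * (\<integral>\<^sup>+z. indicator (whitney w) z * ennreal ((cmod (f z))\<^sup>2) \<partial>polydisc_measure \<beta>)"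
    using mean_value_polydisc[OF b, where 'n='n] by blast
  let ?V = "polydisc_measure \<beta> :: (complex ^ 'n) measure"
  interpret V: finite_measure ?V by (rule finite_polydisc_measure[OF b])
  interpret VV: pair_sigma_finite ?V ?V by unfold_locales
  let ?P = "\<lambda>z::complex ^ 'n. \<Prod>k\<in>UNIV. (1 - cmod (z $ k)) powr (- 2 - \<beta>)"
  define c where "c = ((3/2) powr (2 + \<beta>)) ^ CARD('n)"
  have c: "c > 0" by (simp add: c_def)
  have P0: "0 \<le> ?P z" for z by (intro prod_nonneg) simp
  have [measurable]: "?P \<in> borel_measurable borel" by measurable
  have Pw: "?P y \<le> c * ?P z" if y: "y \<in> polydisc" and z: "z \<in> whitney y" for y z
  proof -
    have "?P y \<le> (\<Prod>k\<in>UNIV. (3/2) powr (2 + \<beta>) * (1 - cmod (z $ k)) powr (- 2 - \<beta>))"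
    proof (intro prod_mono conjI)
      fix k
      have zk: "0 < 1 - cmod (z $ k)" "1 - cmod (z $ k) < 3 / 2 * (1 - cmod (y $ k))"
        using whitney_bounds[OF z, of k] y by (auto simp: polydisc_def dest: spec[of _ k])
      have "(1 - cmod (y $ k)) powr (- 2 - \<beta>) \<le> (2 / 3 * (1 - cmod (z $ k))) powr (- 2 - \<beta>)"
        using zk b by (intro powr_mono2') auto
      also have "\<dots> = (2/3) powr (- 2 - \<beta>) * (1 - cmod (z $ k)) powr (- 2 - \<beta>)"
        using zk by (simp only: powr_mult)
      also have "(2/3) powr (- 2 - \<beta>) = (3/2) powr (2 + \<beta>)"
      proof -
        have "(2/3::real) powr (- 2 - \<beta>) = (2/3) powr (- (2 + \<beta>))" by simp
        also have "\<dots> = inverse ((2/3) powr (2 + \<beta>))" by (rule powr_minus)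
        also have "\<dots> = (inverse (2/3)) powr (2 + \<beta>)" by (simp only: powr_divide inverse_eq_divide powr_one_eq_one)
        finally show ?thesis by simp
      qed
      finally show "(1 - cmod (y $ k)) powr (- 2 - \<beta>) \<le> (3/2) powr (2 + \<beta>) * (1 - cmod (z $ k)) powr (- 2 - \<beta>)" .
    qed simp
    also have "\<dots> = c * ?P z" by (simp add: prod.distrib c_def)
    finally show ?thesis .
  qed
  have "(\<integral>\<^sup>+w. ennreal ((cmod (composition_operator \<phi> f w))\<^sup>2) \<partial>?V)
      \<le> ennreal (C * c) * (\<integral>\<^sup>+z. ennreal ((cmod (f z))\<^sup>2) * carleson_density \<phi> \<beta> z \<partial>?V)"
    if f: "holomorphic_several_on f polydisc" and [measurable]: "f \<in> borel_measurable borel" for f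
  proof -
    define Q where "Q z = ennreal (?P z) * ennreal ((cmod (f z))\<^sup>2)" for z
    have [measurable]: "Q \<in> borel_measurable borel" unfolding Q_def by measurable
    define I where "I w z = (indicator (preimage_whitney \<phi> z) w :: ennreal)" for w z
    have I2 [measurable]: "(\<lambda>(w, z). I w z) \<in> borel_measurable (?V \<Otimes>\<^sub>M ?V)"
      unfolding I_def by (rule indicator_preimage_whitney_measurable[OF hol])
    have [measurable]: "I w \<in> borel_measurable borel" for w
      using measurable_Pair2[OF I2, of w] by simp
    have pw: "ennreal ((cmod (composition_operator \<phi> f w))\<^sup>2) \<le> (\<integral>\<^sup>+z. ennreal (C * c) * (I w z * Q z) \<partial>?V)" for w
    proof (cases "w \<in> polydisc")
      case True
      then have \<phi>w: "\<phi> w \<in> polydisc" using hol by (auto simp: holomorphic_self_map_def)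
      have "ennreal ((cmod (composition_operator \<phi> f w))\<^sup>2) = ennreal ((cmod (f (\<phi> w)))\<^sup>2)"
        using True by (simp add: composition_operator_def)
      also have "\<dots> \<le> ennreal (C * ?P (\<phi> w)) * (\<integral>\<^sup>+z. indicator (whitney (\<phi> w)) z * ennreal ((cmod (f z))\<^sup>2) \<partial>?V)"
        by (intro C(2) f \<phi>w) measurable
      also have "\<dots> = (\<integral>\<^sup>+z. ennreal (C * ?P (\<phi> w)) * (indicator (whitney (\<phi> w)) z * ennreal ((cmod (f z))\<^sup>2)) \<partial>?V)"
        by (intro nn_integral_cmult[symmetric]) measurable
      also have "\<dots> \<le> (\<integral>\<^sup>+z. ennreal (C * c) * (I w z * Q z) \<partial>?V)"
      proof (intro nn_integral_mono)
        fix z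
        show "ennreal (C * ?P (\<phi> w)) * (indicator (whitney (\<phi> w)) z * ennreal ((cmod (f z))\<^sup>2)) \<le> ennreal (C * c) * (I w z * Q z)"
        proof (cases "z \<in> whitney (\<phi> w)")
          case z: True
          then have Iw: "I w z = 1" using True by (simp add: I_def preimage_whitney_def)
          have "ennreal (C * ?P (\<phi> w)) \<le> ennreal ((C * c) * ?P z)"
            using Pw[OF \<phi>w z] C(1) by (intro ennreal_leI) (simp add: mult.assoc)
          also have "\<dots> = ennreal (C * c) * ennreal (?P z)"
            using C(1) c P0 by (intro ennreal_mult) auto
          finally have "ennreal (C * ?P (\<phi> w)) * ennreal ((cmod (f z))\<^sup>2) \<le> ennreal (C * c) * ennreal (?P z) * ennreal ((cmod (f z))\<^sup>2)"
            by (rule mult_right_mono) simp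
          then show ?thesis using z by (simp add: Iw Q_def mult.assoc)
        qed simp
      qed
      finally show ?thesis .
    qed (simp add: composition_operator_def)
    have "(\<integral>\<^sup>+w. ennreal ((cmod (composition_operator \<phi> f w))\<^sup>2) \<partial>?V) \<le> (\<integral>\<^sup>+w. \<integral>\<^sup>+z. ennreal (C * c) * (I w z * Q z) \<partial>?V \<partial>?V)"
      by (intro nn_integral_mono pw)
    also have "\<dots> = (\<integral>\<^sup>+z. \<integral>\<^sup>+w. ennreal (C * c) * (I w z * Q z) \<partial>?V \<partial>?V)"
      by (rule VV.Fubini'[symmetric]) measurable
    also have "\<dots> = (\<integral>\<^sup>+z. ennreal (C * c) * (ennreal ((cmod (f z))\<^sup>2) * carleson_density \<phi> \<beta> z) \<partial>?V)"
    proof (intro nn_integral_cong)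
      fix z
      have "preimage_whitney \<phi> z \<in> sets ?V" using open_preimage_whitney[OF hol] by simp
      then have "(\<integral>\<^sup>+w. I w z \<partial>?V) = emeasure ?V (preimage_whitney \<phi> z)" by (simp add: I_def)
      moreover have "(\<integral>\<^sup>+w. ennreal (C * c) * (I w z * Q z) \<partial>?V) = (ennreal (C * c) * Q z) * (\<integral>\<^sup>+w. I w z \<partial>?V)"
        using \<open>preimage_whitney \<phi> z \<in> sets ?V\<close>
        by (subst nn_integral_cmult[symmetric]) (auto simp: I_def mult_ac intro!: nn_integral_cong)
      ultimately show "(\<integral>\<^sup>+w. ennreal (C * c) * (I w z * Q z) \<partial>?V) = ennreal (C * c) * (ennreal ((cmod (f z))\<^sup>2) * carleson_density \<phi> \<beta> z)"
        by (simp add: Q_def carleson_density_def mult_ac)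
    qed
    also have "\<dots> = ennreal (C * c) * (\<integral>\<^sup>+z. ennreal ((cmod (f z))\<^sup>2) * carleson_density \<phi> \<beta> z \<partial>?V)"
    proof (rule nn_integral_cmult)
      have "(\<lambda>z. \<integral>\<^sup>+w. I w z \<partial>?V) \<in> borel_measurable ?V"
        using V.borel_measurable_nn_integral_fst[OF measurable_pair_swap[OF I2]] by simp
      moreover have "(\<integral>\<^sup>+w. I w z \<partial>?V) = emeasure ?V (preimage_whitney \<phi> z)" for z
        using open_preimage_whitney[OF hol] by (simp add: I_def)
      ultimately have [measurable]: "(\<lambda>z. emeasure ?V (preimage_whitney \<phi> z)) \<in> borel_measurable ?V" by simp
      show "(\<lambda>z. ennreal ((cmod (f z))\<^sup>2) * carleson_density \<phi> \<beta> z) \<in> borel_measurable ?V"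
        unfolding carleson_density_def by measurable
    qed
    finally show ?thesis .
  qed
  moreover have "C * c > 0" using C(1) c by simp
  ultimately show ?thesis by blast
qed

text \<open>The integral that bounds the norm of an image is split: near the boundary the density is
  small, on a smaller polydisc the function is. \<open>bergman_montel\<close> supplies subsequences
  whose differences from their limit are small in this second sense.\<close>

lemma compact_operator_if_vanishing:
  fixes \<phi> :: "complex ^ 'n \<Rightarrow> complex ^ 'n"
  assumes b: "\<beta> > -1" and hol: "holomorphic_self_map \<phi>"
    and van: "\<And>e. e > 0 \<Longrightarrow> \<exists>\<eta>>0. \<forall>z\<in>polydisc. (\<exists>i. 1 - cmod (z $ i) \<le> \<eta>) \<longrightarrow>
      emeasure (polydisc_measure \<beta>) (preimage_whitney \<phi> z) \<le> ennreal (e * (\<Prod>k\<in>UNIV. (1 - cmod (z $ k)) powr (2 + \<beta>)))"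
  shows "compact_operator (bergman_space \<beta>) (bergman_norm \<beta>) (composition_operator \<phi>)"
proof -
  let ?V = "polydisc_measure \<beta> :: (complex ^ 'n) measure"
  let ?A = "bergman_space \<beta> :: (complex ^ 'n \<Rightarrow> complex) set"
  let ?T = "composition_operator \<phi>"
  interpret V: finite_measure ?V by (rule finite_polydisc_measure[OF b])
  define v where "v = measure ?V UNIV"
  have v: "emeasure ?V UNIV = ennreal v" "0 \<le> v" by (auto simp: v_def V.emeasure_eq_measure)
  obtain C where C: "C > 0" "\<And>f. holomorphic_several_on f polydisc \<Longrightarrow> f \<in> borel_measurable borel \<Longrightarrow>
    (\<integral>\<^sup>+w. ennreal ((cmod (?T f w))\<^sup>2) \<partial>?V) \<le> ennreal C * (\<integral>\<^sup>+z. ennreal ((cmod (f z))\<^sup>2) * carleson_density \<phi> \<beta> z \<partial>?V)"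
    using composition_carleson_bound[OF b hol] by blast
  have near: "\<exists>s<1. \<forall>z\<in>polydisc. (\<forall>k. cmod (z $ k) \<le> s) \<or> carleson_density \<phi> \<beta> z \<le> ennreal e" if e: "e > 0" for e
  proof -
    obtain \<eta> where \<eta>: "\<eta> > 0" "\<And>z. z\<in>polydisc \<Longrightarrow> (\<exists>i. 1 - cmod (z $ i) \<le> \<eta>) \<Longrightarrow>
      emeasure ?V (preimage_whitney \<phi> z) \<le> ennreal (e * (\<Prod>k\<in>UNIV. (1 - cmod (z $ k)) powr (2 + \<beta>)))"
      using van[OF e] by blast
    have "carleson_density \<phi> \<beta> z \<le> ennreal e" if z: "z \<in> polydisc" and far: "\<not> (\<forall>k. cmod (z $ k) \<le> 1 - \<eta>)" for z
    proof -
      let ?a = "\<Prod>k\<in>UNIV. (1 - cmod (z $ k)) powr (2 + \<beta>)" and ?b = "\<Prod>k\<in>UNIV. (1 - cmod (z $ k)) powr (- 2 - \<beta>)"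
      have "\<exists>i. 1 - cmod (z $ i) \<le> \<eta>" using far by (auto simp: not_le) (metis less_imp_le diff_less_eq add.commute)
      from \<eta>(2)[OF z this] have "carleson_density \<phi> \<beta> z \<le> ennreal (e * ?a) * ennreal ?b"
        unfolding carleson_density_def by (intro mult_right_mono) auto
      also have "\<dots> = ennreal (e * (?a * ?b))"
        using e by (subst ennreal_mult[symmetric]) (auto intro!: mult_nonneg_nonneg prod_nonneg simp: mult.assoc)
      also have "?a * ?b = 1" using boundary_product_inverse[OF z, of "2 + \<beta>"] by simp
      finally show ?thesis by simp
    qed
    then show ?thesis using \<eta>(1) by (intro exI[of _ "1 - \<eta>"]) auto
  qed
  \<comment> \<open>Near the boundary the density is at most 1; on the remaining polydisc of radius
    \<open>s\<close> its weight is bounded and the mass is at most the total mass.\<close>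
  have "\<exists>K>0. \<forall>z\<in>polydisc. carleson_density \<phi> \<beta> z \<le> ennreal K"
  proof -
    obtain s where s: "s < 1" "\<And>z. z\<in>polydisc \<Longrightarrow> (\<forall>k. cmod (z $ k) \<le> s) \<or> carleson_density \<phi> \<beta> z \<le> ennreal 1"
      using near[of 1] by auto
    define K where "K = v * (\<Prod>k\<in>(UNIV::'n set). (1 - s) powr (- 2 - \<beta>)) + 1"
    have nn: "0 \<le> (\<Prod>k\<in>(UNIV::'n set). (1 - s) powr (- 2 - \<beta>))" by (intro prod_nonneg) simp
    have K1: "K \<ge> 1" using v(2) nn by (simp add: K_def)
    have "carleson_density \<phi> \<beta> z \<le> ennreal K" if z: "z \<in> polydisc" for z
      using s(2)[OF z]
    proof
      assume "carleson_density \<phi> \<beta> z \<le> ennreal 1"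
      then show ?thesis using K1 by (meson ennreal_leI order_trans)
    next
      assume zs: "\<forall>k. cmod (z $ k) \<le> s"
      have "(\<Prod>k\<in>UNIV. (1 - cmod (z $ k)) powr (- 2 - \<beta>)) \<le> (\<Prod>k\<in>(UNIV::'n set). (1 - s) powr (- 2 - \<beta>))"
        using zs s(1) b by (intro prod_mono) (auto intro!: powr_mono2')
      moreover have "emeasure ?V (preimage_whitney \<phi> z) \<le> ennreal v"
        unfolding v(1)[symmetric] by (metis emeasure_space space_polydisc_measure)
      ultimately have "carleson_density \<phi> \<beta> z \<le> ennreal v * ennreal (\<Prod>k\<in>(UNIV::'n set). (1 - s) powr (- 2 - \<beta>))"
        unfolding carleson_density_def by (intro mult_mono ennreal_leI) auto
      also have "\<dots> = ennreal (v * (\<Prod>k\<in>(UNIV::'n set). (1 - s) powr (- 2 - \<beta>)))"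
        using v(2) nn by (simp add: ennreal_mult)
      also have "\<dots> \<le> ennreal K" by (intro ennreal_leI) (simp add: K_def)
      finally show ?thesis .
    qed
    then show ?thesis using K1 by (intro exI[of _ K]) auto
  qed
  then obtain K where K: "K > 0" "\<And>z. z\<in>polydisc \<Longrightarrow> carleson_density \<phi> \<beta> z \<le> ennreal K" by blast
  have T_in: "?T f \<in> ?A" if f: "f \<in> ?A" for f
  proof (rule bergman_spaceI(1))
    show "holomorphic_several_on (?T f) polydisc"
      by (rule composition_operator_holomorphic[OF hol bergman_spaceD(1)[OF f]])
    show "?T f z = 0" if "z \<notin> polydisc" for z using that by (simp add: composition_operator_def)
    show "0 \<le> sqrt (C * K) * bergman_norm \<beta> f" using C(1) K(1) by (simp add: bergman_norm_nonneg)
    have "(\<integral>\<^sup>+w. ennreal ((cmod (?T f w))\<^sup>2) \<partial>?V) \<le> ennreal C * (\<integral>\<^sup>+z. ennreal ((cmod (f z))\<^sup>2) * carleson_density \<phi> \<beta> z \<partial>?V)"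
      by (intro C(2) bergman_spaceD[OF f])
    also have "\<dots> \<le> ennreal C * (\<integral>\<^sup>+z. ennreal ((cmod (f z))\<^sup>2) * ennreal K \<partial>?V)"
      by (intro mult_left_mono nn_integral_mono_polydisc[OF b] K) auto
    also have "\<dots> = ennreal C * (ennreal ((bergman_norm \<beta> f)\<^sup>2) * ennreal K)"
      using bergman_spaceD(3)[OF f] by (simp add: nn_integral_multc bergman_norm_nn_integral[OF f])
    also have "\<dots> = ennreal ((sqrt (C * K) * bergman_norm \<beta> f)\<^sup>2)"
      using C(1) K(1) by (simp add: ennreal_mult[symmetric] power_mult_distrib mult_ac)
    finally show "(\<integral>\<^sup>+w. ennreal ((cmod (?T f w))\<^sup>2) \<partial>?V) \<le> ennreal ((sqrt (C * K) * bergman_norm \<beta> f)\<^sup>2)" .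
  qed
  \<comment> \<open>The bound 2 is meant for differences of two elements of the unit ball.\<close>
  have small: "\<exists>s<1. \<exists>t>0. \<forall>h\<in>?A. bergman_norm \<beta> h \<le> 2 \<longrightarrow> (\<forall>z. (\<forall>k. cmod (z $ k) \<le> s) \<longrightarrow> cmod (h z) < t) \<longrightarrow> bergman_norm \<beta> (?T h) < e"
    if e: "e > 0" for e
  proof -
    \<comment> \<open>With \<open>bergman_norm \<beta> h \<le> 2\<close> the boundary part is at
      most \<open>4 * C * e1 = e\<^sup>2 / 4\<close>; the choice of \<open>t\<close> bounds the
      inner part by another \<open>e\<^sup>2 / 4\<close>.\<close>
    define e1 where "e1 = e\<^sup>2 / (16 * C)"
    have e1: "e1 > 0" using e C(1) by (simp add: e1_def)
    obtain s where s: "s < 1" "\<And>z. z\<in>polydisc \<Longrightarrow> (\<forall>k. cmod (z $ k) \<le> s) \<or> carleson_density \<phi> \<beta> z \<le> ennreal e1"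
      using near[OF e1] by auto
    define X where "X = C * K * (v + 1)"
    define t where "t = e / (2 * sqrt X)"
    have pos: "X > 0" using C(1) K(1) v(2) by (simp add: X_def)
    have t: "t > 0" using e pos by (simp add: t_def)
    have t2: "C * (t\<^sup>2 * K * v) \<le> e\<^sup>2 / 4"
    proof -
      have "C * (t\<^sup>2 * K * v) \<le> t\<^sup>2 * X"
        using C(1) K(1) v(2) t by (simp add: X_def algebra_simps)
      also have "\<dots> = e\<^sup>2 / 4" using pos by (simp add: t_def power_divide power_mult_distrib)
      finally show ?thesis .
    qed
    have "bergman_norm \<beta> (?T h) < e"
      if h: "h \<in> ?A" and h2: "bergman_norm \<beta> h \<le> 2" and ht: "\<forall>z. (\<forall>k. cmod (z $ k) \<le> s) \<longrightarrow> cmod (h z) < t" for h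
    proof -
      note [measurable] = bergman_spaceD(3)[OF h]
      have pt: "ennreal ((cmod (h z))\<^sup>2) * carleson_density \<phi> \<beta> z \<le> ennreal ((cmod (h z))\<^sup>2) * ennreal e1 + ennreal (t\<^sup>2 * K)"
        if z: "z \<in> polydisc" for z
        using s(2)[OF z]
      proof
        assume "\<forall>k. cmod (z $ k) \<le> s"
        then have "(cmod (h z))\<^sup>2 \<le> t\<^sup>2" using ht by (intro power_mono) (auto simp: less_imp_le)
        then have "ennreal ((cmod (h z))\<^sup>2) * carleson_density \<phi> \<beta> z \<le> ennreal (t\<^sup>2) * ennreal K"
          by (intro mult_mono ennreal_leI K z) auto
        also have "\<dots> = ennreal (t\<^sup>2 * K)" using K(1) by (simp add: ennreal_mult)
        finally show ?thesis by (rule order_trans) simp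
      next
        assume "carleson_density \<phi> \<beta> z \<le> ennreal e1"
        then have "ennreal ((cmod (h z))\<^sup>2) * carleson_density \<phi> \<beta> z \<le> ennreal ((cmod (h z))\<^sup>2) * ennreal e1"
          by (intro mult_left_mono) auto
        then show ?thesis by (rule order_trans) simp
      qed
      have "ennreal ((bergman_norm \<beta> (?T h))\<^sup>2) = (\<integral>\<^sup>+w. ennreal ((cmod (?T h w))\<^sup>2) \<partial>?V)"
        by (rule bergman_norm_nn_integral[OF T_in[OF h], symmetric])
      also have "\<dots> \<le> ennreal C * (\<integral>\<^sup>+z. ennreal ((cmod (h z))\<^sup>2) * carleson_density \<phi> \<beta> z \<partial>?V)"
        by (intro C(2) bergman_spaceD[OF h])
      also have "\<dots> \<le> ennreal C * (\<integral>\<^sup>+z. ennreal ((cmod (h z))\<^sup>2) * ennreal e1 + ennreal (t\<^sup>2 * K) \<partial>?V)"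
        by (intro mult_left_mono nn_integral_mono_polydisc[OF b] pt) auto
      also have "(\<integral>\<^sup>+z. ennreal ((cmod (h z))\<^sup>2) * ennreal e1 + ennreal (t\<^sup>2 * K) \<partial>?V)
          = ennreal ((bergman_norm \<beta> h)\<^sup>2) * ennreal e1 + ennreal (t\<^sup>2 * K) * ennreal v"
        by (simp add: nn_integral_add nn_integral_multc bergman_norm_nn_integral[OF h] v(1))
      also have "ennreal C * \<dots> = ennreal (C * ((bergman_norm \<beta> h)\<^sup>2 * e1 + t\<^sup>2 * K * v))"
        using C(1) K(1) e1 v(2) by (simp add: ennreal_mult[symmetric] ennreal_plus[symmetric] del: ennreal_plus)
      finally have "(bergman_norm \<beta> (?T h))\<^sup>2 \<le> C * ((bergman_norm \<beta> h)\<^sup>2 * e1 + t\<^sup>2 * K * v)"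
        using C(1) K(1) e1 v(2) by (subst (asm) ennreal_le_iff) auto
      also have "\<dots> = C * ((bergman_norm \<beta> h)\<^sup>2 * e1) + C * (t\<^sup>2 * K * v)" by (simp add: algebra_simps)
      also have "\<dots> \<le> C * (2\<^sup>2 * e1) + e\<^sup>2 / 4"
        using C(1) e1 h2 t2 by (intro add_mono mult_left_mono mult_right_mono power_mono) (auto simp: bergman_norm_nonneg)
      also have "\<dots> < e\<^sup>2" using C(1) e by (simp add: e1_def)
      finally have "(bergman_norm \<beta> (?T h))\<^sup>2 < e\<^sup>2" .
      then show ?thesis by (rule power2_less_imp_less) (use e in simp)
    qed
    then show ?thesis using s(1) t by blast
  qed
  interpret M: Metric_space ?A "\<lambda>f g. bergman_norm \<beta> (\<lambda>z. f z - g z)" by (rule Metric_space_bergman[OF b])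
  let ?B = "{f \<in> ?A. bergman_norm \<beta> f \<le> 1}"
  have sub: "?T ` ?B \<subseteq> ?A" using T_in by auto
  have seq: "\<exists>l r. l \<in> ?A \<and> strict_mono r \<and> limitin M.mtopology (\<sigma> \<circ> r) l sequentially"
    if \<sigma>: "range \<sigma> \<subseteq> ?T ` ?B" for \<sigma> :: "nat \<Rightarrow> complex ^ 'n \<Rightarrow> complex"
  proof -
    have "\<forall>n. \<exists>f. f \<in> ?A \<and> bergman_norm \<beta> f \<le> 1 \<and> \<sigma> n = ?T f" using \<sigma> by blast
    then obtain f where f: "\<And>n. f n \<in> ?A" "\<And>n. bergman_norm \<beta> (f n) \<le> 1" "\<And>n. \<sigma> n = ?T (f n)" by metis
    obtain r g where r: "strict_mono (r :: nat \<Rightarrow> nat)" and g: "g \<in> ?A" "bergman_norm \<beta> g \<le> 1"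
      and conv: "\<And>s e. s < 1 \<Longrightarrow> e > 0 \<Longrightarrow> \<exists>N. \<forall>n\<ge>N. \<forall>z. (\<forall>k. cmod (z $ k) \<le> s) \<longrightarrow> cmod (f (r n) z - g z) < e"
      using bergman_montel[OF b, of f, OF f(1) f(2)] by blast
    have "\<exists>N. \<forall>n\<ge>N. (\<sigma> \<circ> r) n \<in> ?A \<and> bergman_norm \<beta> (\<lambda>z. (\<sigma> \<circ> r) n z - ?T g z) < e" if e: "e > 0" for e
    proof -
      obtain s t where st: "s < 1" "t > 0" "\<And>h. h\<in>?A \<Longrightarrow> bergman_norm \<beta> h \<le> 2 \<Longrightarrow> (\<forall>z. (\<forall>k. cmod (z $ k) \<le> s) \<longrightarrow> cmod (h z) < t) \<Longrightarrow> bergman_norm \<beta> (?T h) < e"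
        using small[OF e] by blast
      obtain N where N: "\<And>n z. n\<ge>N \<Longrightarrow> (\<forall>k. cmod (z $ k) \<le> s) \<Longrightarrow> cmod (f (r n) z - g z) < t"
        using conv[OF st(1,2)] by blast
      have "(\<sigma> \<circ> r) n \<in> ?A \<and> bergman_norm \<beta> (\<lambda>z. (\<sigma> \<circ> r) n z - ?T g z) < e" if n: "n \<ge> N" for n
      proof
        show "(\<sigma> \<circ> r) n \<in> ?A" by (simp add: f(3) T_in f(1))
        have "(\<lambda>z. (\<sigma> \<circ> r) n z - ?T g z) = ?T (\<lambda>z. f (r n) z - g z)"
          by (simp add: f(3) composition_operator_def fun_eq_iff)
        moreover have "bergman_norm \<beta> (?T (\<lambda>z. f (r n) z - g z)) < e"
        proof (rule st(3))
          show "(\<lambda>z. f (r n) z - g z) \<in> ?A" by (intro bergman_space_diff f g)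
          have "(\<lambda>z. 0) \<in> ?A" using bergman_space_lincomb[OF g(1) g(1), of 0 0] by simp
          then have "bergman_norm \<beta> (\<lambda>z. f (r n) z - g z) \<le> bergman_norm \<beta> (\<lambda>z. f (r n) z - 0) + bergman_norm \<beta> (\<lambda>z. 0 - g z)"
            using f(1) g(1) by (intro M.triangle) auto
          also have "\<dots> = bergman_norm \<beta> (f (r n)) + bergman_norm \<beta> g" by (simp add: bergman_norm_def)
          also have "\<dots> \<le> 2" using f(2)[of "r n"] g(2) by simp
          finally show "bergman_norm \<beta> (\<lambda>z. f (r n) z - g z) \<le> 2" .
        qed (use N n in blast)
        ultimately show "bergman_norm \<beta> (\<lambda>z. (\<sigma> \<circ> r) n z - ?T g z) < e" by simp
      qed
      then show ?thesis by blast
    qed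
    then have "limitin M.mtopology (\<sigma> \<circ> r) (?T g) sequentially"
      unfolding M.limitin_metric eventually_sequentially using T_in[OF g(1)] by blast
    then show ?thesis using T_in[OF g(1)] r by blast
  qed
  \<comment> \<open>Compactness of the closure is reduced to limit points of infinite subsets of the
    image itself, so only sequences from the image have to be considered.\<close>
  have "compactin M.mtopology (M.mtopology closure_of (?T ` ?B))"
    unfolding M.compact_closure_of_eq_Bolzano_Weierstrass
  proof (intro allI impI)
    fix T assume T: "infinite T \<and> T \<subseteq> ?T ` ?B \<and> T \<subseteq> ?A"
    have "\<forall>T. T \<subseteq> ?T ` ?B \<and> infinite T \<longrightarrow> ?A \<inter> M.mtopology derived_set_of T \<noteq> {}"
      using M.Bolzano_Weierstrass_property[OF sub sub] seq by blast
    then show "M.mtopology derived_set_of T \<noteq> {}" using T by blast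
  qed
  moreover have "?T ` ?A \<subseteq> ?A" using T_in by blast
  moreover have "?T (\<lambda>z. a * f z + c * g z) = (\<lambda>z. a * ?T f z + c * ?T g z)" for f g a c
    by (simp add: composition_operator_def fun_eq_iff)
  ultimately show ?thesis by (simp add: compact_operator_def norm_topology_def)
qed

subsection \<open>Necessity\<close>

lemma holomorphic_several_coordinate:
  fixes i :: "'n::finite"
  assumes h: "h holomorphic_on ball 0 1"
  shows "holomorphic_several_on (\<lambda>z. h (z $ i)) polydisc"
  unfolding holomorphic_several_on_def
proof
  fix z :: "complex ^ 'n" assume "z \<in> polydisc"
  then have "z $ i \<in> ball 0 1" by (simp add: polydisc_def)
  then obtain h' where "(h has_field_derivative h') (at (z $ i))"
    using h by (meson holomorphic_on_open open_ball)
  then have "(h has_derivative (*) h') (at (z $ i))" by (simp add: has_field_derivative_def)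
  from has_derivative_compose[OF bounded_linear_imp_has_derivative[OF bounded_linear_vec_nth] this]
  have "((\<lambda>z. h (z $ i)) has_derivative (\<lambda>v. h' * v $ i)) (at z)" .
  then show "\<exists>D. ((\<lambda>z. h (z $ i)) has_derivative D) (at z) \<and> (\<forall>c v. D (c *s v) = c * D v)"
    by (intro exI[of _ "\<lambda>v. h' * v $ i"]) auto
qed

section \<open>Test functions with poles near the image point\<close>

lemma bergman_norm_cmult: "bergman_norm \<beta> (\<lambda>z. a * f z) = cmod a * bergman_norm \<beta> f"
  by (simp add: bergman_norm_def norm_mult power_mult_distrib real_sqrt_mult)

text \<open>A product over \<open>J\<close> of powers of Cauchy kernels with poles at
  \<open>(1 + t) * \<xi> $ i\<close>, just outside the disc. The squared numerator
  \<open>t powr (2 * real N - (2 + \<beta>))\<close> is inverse to the order of the kernel integral,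
  so the norms stay bounded as \<open>t\<close> tends to 0.\<close>

definition test_function :: "nat \<Rightarrow> real \<Rightarrow> 'n set \<Rightarrow> complex ^ 'n \<Rightarrow> real \<Rightarrow> complex ^ 'n \<Rightarrow> complex" where
  "test_function N \<beta> J \<xi> t z = (if z \<in> polydisc then
     \<Prod>i\<in>J. of_real (t powr (real N - (2 + \<beta>) / 2)) / (1 + of_real t - cnj (\<xi> $ i) * z $ i) ^ N else 0)"

lemma powr_half_power2: "((t::real) powr (x - p / 2))\<^sup>2 = t powr (2 * x - p)"
proof -
  have "x - p / 2 + (x - p / 2) = 2 * x - p" by simp
  then show ?thesis by (simp only: power2_eq_square powr_add[symmetric])
qed

lemma test_function_denominator:
  assumes "cmod x = 1" "cmod z < 1" "0 < t"
  shows "1 + of_real t - cnj x * z \<noteq> 0"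
proof
  assume "1 + of_real t - cnj x * z = 0"
  then have "cnj x * z = of_real (1 + t)" by simp
  then have "cmod (cnj x * z) = 1 + t" using assms(3) by (simp del: of_real_add)
  then show False using assms by (simp add: norm_mult)
qed

text \<open>The squared modulus factorises over the coordinates: those in \<open>J\<close>
  contribute at most \<open>C\<close> each, the others the total mass of the disc. \<open>R\<close>
  is uniform in \<open>J\<close>, \<xi> and \<open>t\<close>, which is what a compactness argument
  needs.\<close>

lemma test_function_bergman:
  assumes b: "\<beta> > -1" and N: "2 + \<beta> < 2 * real N"
  shows "\<exists>R>0. \<forall>(J :: 'n::finite set) \<xi> t. (\<forall>i\<in>J. cmod (\<xi> $ i) = 1) \<longrightarrow> 0 < t \<longrightarrow>
    test_function N \<beta> J \<xi> t \<in> bergman_space \<beta> \<and> bergman_norm \<beta> (test_function N \<beta> J \<xi> t) \<le> R"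
proof -
  interpret finite_measure "disc_measure \<beta>" by (rule finite_disc_measure[OF b])
  obtain C where C: "C > 0" "\<And>x t. cmod x = 1 \<Longrightarrow> 0 < t \<Longrightarrow>
    (\<integral>\<^sup>+z. ennreal (1 / cmod (1 + of_real t - cnj x * z) ^ (2 * N)) \<partial>disc_measure \<beta>)
      \<le> ennreal (C * t powr (2 + \<beta> - 2 * real N))"
    using nn_integral_kernel_bound[OF b N] by blast
  define B where "B = max 1 (max C (measure (disc_measure \<beta>) UNIV))"
  have B: "B \<ge> 1" "C \<le> B" "measure (disc_measure \<beta>) UNIV \<le> B" by (auto simp: B_def)
  define R where "R = sqrt (B ^ CARD('n))"
  have R: "R > 0" using B(1) by (simp add: R_def)
  have "test_function N \<beta> J \<xi> t \<in> bergman_space \<beta> \<and> bergman_norm \<beta> (test_function N \<beta> J \<xi> t) \<le> R"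
    if \<xi>: "\<forall>i\<in>J. cmod (\<xi> $ i) = 1" and t: "0 < t" for J :: "'n set" and \<xi> t
  proof -
    let ?F = "test_function N \<beta> J \<xi> t"
    let ?s = "t powr (real N - (2 + \<beta>) / 2)"
    have "holomorphic_several_on (\<lambda>z. \<Prod>i\<in>J. of_real ?s / (1 + of_real t - cnj (\<xi> $ i) * z $ i) ^ N) polydisc"
    proof (intro holomorphic_several_prod holomorphic_several_coordinate)
      fix i assume "i \<in> J"
      then show "(\<lambda>x. of_real ?s / (1 + of_real t - cnj (\<xi> $ i) * x) ^ N) holomorphic_on ball 0 1"
        using \<xi> t test_function_denominator by (intro holomorphic_intros) auto
    qed
    then have hol: "holomorphic_several_on ?F polydisc"
      by (rule holomorphic_several_transform) (auto simp: test_function_def)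
    have zero: "?F z = 0" if "z \<notin> polydisc" for z using that by (simp add: test_function_def)
    define G where "G k z = (if k \<in> J then ennreal (?s\<^sup>2) * ennreal (1 / cmod (1 + of_real t - cnj (\<xi> $ k) * z) ^ (2 * N)) else 1)"
      for k z
    have [measurable]: "G k \<in> borel_measurable borel" for k
      unfolding G_def by (cases "k \<in> J") auto
    have "(\<integral>\<^sup>+z. ennreal ((cmod (?F z))\<^sup>2) \<partial>polydisc_measure \<beta>) \<le> (\<integral>\<^sup>+z. (\<Prod>k\<in>UNIV. G k (z $ k)) \<partial>polydisc_measure \<beta>)"
    proof (intro nn_integral_mono_polydisc b)
      fix z :: "complex ^ 'n" assume z: "z \<in> polydisc"
      have "(\<Prod>k\<in>UNIV. G k (z $ k)) = (\<Prod>k\<in>J. G k (z $ k))"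
        by (intro prod.mono_neutral_right) (auto simp: G_def)
      also have "\<dots> = (\<Prod>k\<in>J. ennreal (?s\<^sup>2 * (1 / cmod (1 + of_real t - cnj (\<xi> $ k) * z $ k) ^ (2 * N))))"
        by (intro prod.cong) (auto simp: G_def ennreal_mult[symmetric])
      also have "\<dots> = ennreal (\<Prod>k\<in>J. ?s\<^sup>2 * (1 / cmod (1 + of_real t - cnj (\<xi> $ k) * z $ k) ^ (2 * N)))"
        by (intro prod_ennreal) auto
      also have "(\<Prod>k\<in>J. ?s\<^sup>2 * (1 / cmod (1 + of_real t - cnj (\<xi> $ k) * z $ k) ^ (2 * N))) = (cmod (?F z))\<^sup>2"
      proof -
        have "(cmod (?F z))\<^sup>2 = (\<Prod>k\<in>J. (?s / cmod (1 + of_real t - cnj (\<xi> $ k) * z $ k) ^ N)\<^sup>2)"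
          using z by (simp add: test_function_def prod_norm[symmetric] norm_divide norm_power prod_power_distrib)
        also have "\<dots> = (\<Prod>k\<in>J. ?s\<^sup>2 * (1 / cmod (1 + of_real t - cnj (\<xi> $ k) * z $ k) ^ (2 * N)))"
          by (intro prod.cong refl) (simp add: power_divide power_mult[symmetric] mult.commute)
        finally show ?thesis by (rule sym)
      qed
      finally show "ennreal ((cmod (?F z))\<^sup>2) \<le> (\<Prod>k\<in>UNIV. G k (z $ k))" by simp
    qed
    also have "\<dots> = (\<Prod>k\<in>UNIV. \<integral>\<^sup>+z. G k z \<partial>disc_measure \<beta>)"
      by (intro nn_integral_polydisc_prod b) measurable
    also have "\<dots> \<le> (\<Prod>k\<in>(UNIV::'n set). ennreal B)"
    proof (intro prod_mono_ennreal)
      fix k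
      show "(\<integral>\<^sup>+z. G k z \<partial>disc_measure \<beta>) \<le> ennreal B"
      proof (cases "k \<in> J")
        case True
        have "(\<integral>\<^sup>+z. G k z \<partial>disc_measure \<beta>)
            = ennreal (?s\<^sup>2) * (\<integral>\<^sup>+z. ennreal (1 / cmod (1 + of_real t - cnj (\<xi> $ k) * z) ^ (2 * N)) \<partial>disc_measure \<beta>)"
          using True by (simp add: G_def nn_integral_cmult)
        also have "\<dots> \<le> ennreal (?s\<^sup>2) * ennreal (C * t powr (2 + \<beta> - 2 * real N))"
          using \<xi> True t by (intro mult_left_mono C) auto
        also have "\<dots> = ennreal (?s\<^sup>2 * (C * t powr (2 + \<beta> - 2 * real N)))"
          using C(1) by (simp add: ennreal_mult)
        also have "?s\<^sup>2 = t powr (2 * real N - (2 + \<beta>))"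
          by (rule powr_half_power2)
        also have "t powr (2 * real N - (2 + \<beta>)) * (C * t powr (2 + \<beta> - 2 * real N)) = C"
          using t by (simp add: powr_add[symmetric] mult.left_commute)
        also have "ennreal C \<le> ennreal B" using B by (intro ennreal_leI)
        finally show ?thesis .
      next
        case False
        then show ?thesis using B by (simp add: G_def emeasure_eq_measure ennreal_leI)
      qed
    qed
    also have "\<dots> = ennreal (R\<^sup>2)" using B(1) by (simp add: R_def ennreal_power)
    finally have "(\<integral>\<^sup>+z. ennreal ((cmod (?F z))\<^sup>2) \<partial>polydisc_measure \<beta>) \<le> ennreal (R\<^sup>2)" .
    from bergman_spaceI[OF hol zero less_imp_le[OF R] this] show ?thesis by simp
  qed
  with R show ?thesis by blast
qed

text \<open>A point within \<open>L * t\<close> of \<open>\<xi> $ i\<close> makes the denominator at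
  most \<open>(1 + L) * t\<close>, so every index of \<open>J\<close> contributes the full order
  \<open>t powr (- (2 + \<beta>))\<close>.\<close>

lemma test_function_lower_bound:
  fixes J :: "'n::finite set"
  assumes w: "w \<in> polydisc" and t: "0 < t" and L: "0 \<le> L"
    and near: "\<And>i. i \<in> J \<Longrightarrow> cmod (\<xi> $ i) = 1 \<and> cmod (w $ i - \<xi> $ i) \<le> L * t"
  shows "((1 / (1 + L) ^ (2 * N)) * t powr (- (2 + \<beta>))) ^ card J \<le> (cmod (test_function N \<beta> J \<xi> t w))\<^sup>2"
proof -
  let ?s = "t powr (real N - (2 + \<beta>) / 2)"
  let ?q = "\<lambda>i. 1 + of_real t - cnj (\<xi> $ i) * w $ i"
  have "((1 / (1 + L) ^ (2 * N)) * t powr (- (2 + \<beta>))) ^ card J = (\<Prod>i\<in>J. (1 / (1 + L) ^ (2 * N)) * t powr (- (2 + \<beta>)))"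
    by simp
  also have "\<dots> \<le> (\<Prod>i\<in>J. (?s / cmod (?q i) ^ N)\<^sup>2)"
  proof (intro prod_mono conjI)
    fix i assume i: "i \<in> J"
    have x1: "cmod (\<xi> $ i) = 1" using near[OF i] by simp
    have qe: "?q i = of_real t - cnj (\<xi> $ i) * (w $ i - \<xi> $ i)"
      using x1 by (simp add: algebra_simps complex_norm_square[symmetric])
    have "cmod (?q i) \<le> t + cmod (cnj (\<xi> $ i) * (w $ i - \<xi> $ i))"
      unfolding qe using norm_triangle_ineq4[of "of_real t :: complex" "cnj (\<xi> $ i) * (w $ i - \<xi> $ i)"] t by simp
    also have "cmod (cnj (\<xi> $ i) * (w $ i - \<xi> $ i)) = cmod (w $ i - \<xi> $ i)" using x1 by (simp add: norm_mult)
    also have "t + \<dots> \<le> (1 + L) * t" using near[OF i] by (simp add: algebra_simps)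
    finally have q: "cmod (?q i) \<le> (1 + L) * t" .
    have "cmod (w $ i) < 1" using w by (simp add: polydisc_def)
    then have q0: "cmod (?q i) > 0" using test_function_denominator[OF x1 _ t] by simp
    have "(1 / (1 + L) ^ (2 * N)) * t powr (- (2 + \<beta>)) = (?s / ((1 + L) * t) ^ N)\<^sup>2"
    proof -
      have s2: "?s\<^sup>2 = t powr (2 * real N - (2 + \<beta>))"
        by (rule powr_half_power2)
      have "(?s / ((1 + L) * t) ^ N)\<^sup>2 = ?s\<^sup>2 / ((1 + L) ^ (2 * N) * t ^ (2 * N))"
        by (simp add: power_divide power_mult_distrib power_mult[symmetric] mult.commute)
      also have "t ^ (2 * N) = t powr (2 * real N)" using t by (simp add: powr_realpow[symmetric])
      also have "?s\<^sup>2 / ((1 + L) ^ (2 * N) * t powr (2 * real N)) = (1 / (1 + L) ^ (2 * N)) * (t powr (2 * real N - (2 + \<beta>)) / t powr (2 * real N))"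
        by (simp add: s2)
      also have "t powr (2 * real N - (2 + \<beta>)) / t powr (2 * real N) = t powr (- (2 + \<beta>))"
        by (simp add: powr_diff[symmetric])
      finally show ?thesis by simp
    qed
    also have "\<dots> \<le> (?s / cmod (?q i) ^ N)\<^sup>2"
      using q q0 t L by (intro power_mono divide_left_mono mult_pos_pos zero_less_power) (auto intro!: power_mono)
    finally show "(1 / (1 + L) ^ (2 * N)) * t powr (- (2 + \<beta>)) \<le> (?s / cmod (?q i) ^ N)\<^sup>2" .
  qed (use L in simp)
  also have "\<dots> = (cmod (test_function N \<beta> J \<xi> t w))\<^sup>2"
    using w by (simp add: test_function_def prod_norm[symmetric] norm_divide norm_power prod_power_distrib)
  finally show ?thesis .
qed

text \<open>The extended partials are bounded on a compact set; \<open>mean_value\<close> with zero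
  linear part and the whole space as \<open>U\<close> then works up to the boundary.\<close>

lemma self_map_lipschitz:
  fixes \<phi> :: "complex ^ 'n \<Rightarrow> complex ^ 'n"
  assumes "holomorphic_self_map \<phi>" "C1_closed_polydisc \<phi>"
  shows "\<exists>L\<ge>0. \<forall>i. \<forall>w\<in>cpolydisc. \<forall>w'\<in>cpolydisc. cmod (\<phi> w $ i - \<phi> w' $ i) \<le> L * (\<Sum>k\<in>UNIV. cmod (w $ k - w' $ k))"
proof -
  obtain g where g: "\<And>i. C1_disc_function (\<lambda>w. \<phi> w $ i) (g i)"
    using C1_disc_function_components[OF assms] by blast
  have "\<exists>e. \<forall>u\<in>cpolydisc. cmod (g i k u) \<le> e" for i k
  proof -
    have "bounded (g i k ` cpolydisc)"
      using C1_disc_function.gcont[OF g] compact_cpolydisc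
      by (intro compact_imp_bounded compact_continuous_image)
    then show ?thesis by (auto simp: bounded_iff)
  qed
  then obtain e where e: "\<And>i k u. u \<in> cpolydisc \<Longrightarrow> cmod (g i k u) \<le> e i k" by metis
  define L where "L = (\<Sum>i\<in>UNIV. \<Sum>k\<in>UNIV. \<bar>e i k\<bar>)"
  have L: "cmod (g i k u) \<le> L" if "u \<in> cpolydisc" for i k u
  proof -
    have "cmod (g i k u) \<le> \<bar>e i k\<bar>" using e[OF that, of i k] by simp
    also have "\<dots> \<le> (\<Sum>k\<in>UNIV. \<bar>e i k\<bar>)" by (intro member_le_sum) auto
    also have "\<dots> \<le> L" unfolding L_def by (intro member_le_sum) (auto intro: sum_nonneg)
    finally show ?thesis .
  qed
  have "cmod (\<phi> w $ i - \<phi> w' $ i) \<le> L * (\<Sum>k\<in>UNIV. cmod (w $ k - w' $ k))" if "w \<in> cpolydisc" "w' \<in> cpolydisc" for i w w'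
    using C1_disc_function.mean_value[OF g, of UNIV i "\<lambda>_. 0" L w w'] L that by simp
  moreover have "L \<ge> 0" by (auto simp: L_def intro!: sum_nonneg)
  ultimately show ?thesis by blast
qed

text \<open>At the points \<open>w t\<close>, images of test functions are squared at least of order
  \<open>(t powr (- p)) ^ card I\<close>, which is also the general upper order for members of the
  space. The contradiction lies in the constants: for the limit \<open>l\<close> only the mass of a
  box sliding to the boundary enters, for the difference \<open>h n\<close> its norm, and both tend
  to 0.\<close>

lemma num_unimodular_decreases_if_compact:
  fixes \<phi> :: "complex ^ 'n \<Rightarrow> complex ^ 'n"
  assumes b: "\<beta> > -1" and hol: "holomorphic_self_map \<phi>" and C1: "C1_closed_polydisc \<phi>"
    and comp: "compact_operator (bergman_space \<beta>) (bergman_norm \<beta>) (composition_operator \<phi>)"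
    and z0: "z0 \<in> cpolydisc" and pos: "num_unimodular (\<phi> z0) > 0"
  shows "num_unimodular (\<phi> z0) < num_unimodular z0"
proof (rule ccontr)
  assume neg: "\<not> ?thesis"
  let ?V = "polydisc_measure \<beta> :: (complex ^ 'n) measure"
  let ?A = "bergman_space \<beta> :: (complex ^ 'n \<Rightarrow> complex) set"
  let ?T = "composition_operator \<phi>"
  define I where "I = {k. cmod (z0 $ k) = 1}"
  define J where "J = {i. cmod (\<phi> z0 $ i) = 1}"
  have IJ: "card I \<le> card J" using neg by (simp add: I_def J_def num_unimodular_def)
  \<comment> \<open>An interior point has an interior image, so \<open>z0\<close> lies on the
    boundary. A coordinate \<open>k1\<close> in \<open>I\<close> later drives the Whitney boxes past
    every fixed point of the polydisc.\<close>
  have "I \<noteq> {}"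
  proof
    assume "I = {}"
    then have "z0 \<in> polydisc" using z0 by (force simp: I_def polydisc_def cpolydisc_def less_le)
    then have "\<phi> z0 \<in> polydisc" using hol by (auto simp: holomorphic_self_map_def)
    then have "{k. cmod (\<phi> z0 $ k) = 1} = {}" by (auto simp: polydisc_def) (metis less_irrefl)
    then show False using pos by (simp add: num_unimodular_def)
  qed
  then obtain k1 where k1: "k1 \<in> I" by blast
  obtain L where L: "L \<ge> 0" "\<And>i w w'. w\<in>cpolydisc \<Longrightarrow> w'\<in>cpolydisc \<Longrightarrow> cmod (\<phi> w $ i - \<phi> w' $ i) \<le> L * (\<Sum>k\<in>UNIV. cmod (w $ k - w' $ k))"
    using self_map_lipschitz[OF hol C1] by blast
  obtain N where N: "2 + \<beta> < 2 * real N"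
    using reals_Archimedean2[of "(2 + \<beta>) / 2"] by (auto simp: field_simps)
  obtain R where R: "R > 0" "\<And>(J :: 'n set) \<xi> t. (\<forall>i\<in>J. cmod (\<xi> $ i) = 1) \<Longrightarrow> 0 < t \<Longrightarrow>
    test_function N \<beta> J \<xi> t \<in> ?A \<and> bergman_norm \<beta> (test_function N \<beta> J \<xi> t) \<le> R"
    using test_function_bergman[OF b N, where 'n='n] by blast
  obtain C where C: "C > 0" "\<And>(f :: complex ^ 'n \<Rightarrow> complex) w. holomorphic_several_on f polydisc \<Longrightarrow> f \<in> borel_measurable borel \<Longrightarrow> w \<in> polydisc \<Longrightarrow>
    ennreal ((cmod (f w))\<^sup>2)
      \<le> ennreal (C * (\<Prod>k\<in>UNIV. (1 - cmod (w $ k)) powr (- 2 - \<beta>)))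
        * (\<integral>\<^sup>+z. indicator (whitney w) z * ennreal ((cmod (f z))\<^sup>2) \<partial>polydisc_measure \<beta>)"
    using mean_value_polydisc[OF b, where 'n='n] by blast
  let ?P = "\<lambda>z::complex ^ 'n. \<Prod>k\<in>UNIV. (1 - cmod (z $ k)) powr (- 2 - \<beta>)"
  \<comment> \<open>The mass in the box and not the full norm: for a fixed function it tends to 0 as
    the box moves to the boundary.\<close>
  define mass where "mass f w = enn2real (\<integral>\<^sup>+z. indicator (whitney w) z * ennreal ((cmod (f z))\<^sup>2) \<partial>?V)" for f w
  have mass: "(\<integral>\<^sup>+z. indicator (whitney w) z * ennreal ((cmod (f z))\<^sup>2) \<partial>?V) = ennreal (mass f w)"
    "mass f w \<le> (bergman_norm \<beta> f)\<^sup>2" if f: "f \<in> ?A" for f w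
  proof -
    have le: "(\<integral>\<^sup>+z. indicator (whitney w) z * ennreal ((cmod (f z))\<^sup>2) \<partial>?V) \<le> ennreal ((bergman_norm \<beta> f)\<^sup>2)"
      unfolding bergman_norm_nn_integral[OF f, symmetric] by (intro nn_integral_mono) (auto simp: indicator_def)
    then have "(\<integral>\<^sup>+z. indicator (whitney w) z * ennreal ((cmod (f z))\<^sup>2) \<partial>?V) < \<top>"
      using ennreal_less_top le_less_trans by blast
    then show "(\<integral>\<^sup>+z. indicator (whitney w) z * ennreal ((cmod (f z))\<^sup>2) \<partial>?V) = ennreal (mass f w)"
      by (simp add: mass_def)
    with le show "mass f w \<le> (bergman_norm \<beta> f)\<^sup>2" by simp
  qed
  have mass0: "0 \<le> mass f w" for f w by (simp add: mass_def)
  have growth: "(cmod (f w))\<^sup>2 \<le> C * ?P w * mass f w" if f: "f \<in> ?A" and w: "w \<in> polydisc" for f w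
  proof -
    have P0: "0 \<le> C * ?P w" using C(1) by (intro mult_nonneg_nonneg prod_nonneg) auto
    have "ennreal ((cmod (f w))\<^sup>2) \<le> ennreal (C * ?P w * mass f w)"
      using C(2)[OF bergman_spaceD(1)[OF f] bergman_spaceD(3)[OF f] w] P0 mass0
      unfolding mass(1)[OF f] by (simp add: ennreal_mult)
    then show ?thesis using P0 mass0 by simp
  qed
  define w where "w t = (\<chi> k. if k \<in> I then of_real (1 - t) * z0 $ k else z0 $ k)" for t :: real
  have wk: "1 - cmod (w t $ k) = (if k \<in> I then t else 1 - cmod (z0 $ k))" if "0 < t" "t < 1" for t k
  proof -
    have "cmod (of_real (1 - t)) = 1 - t" using that by (simp del: of_real_diff)
    then show ?thesis by (simp add: w_def norm_mult I_def del: of_real_diff)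
  qed
  have z0less: "0 < 1 - cmod (z0 $ k)" if "k \<notin> I" for k
    using z0 that by (simp add: I_def cpolydisc_def less_le)
  have wp: "w t \<in> polydisc" if t: "0 < t" "t < 1" for t
  proof -
    have "0 < 1 - cmod (w t $ k)" for k unfolding wk[OF t] using t z0less by simp
    then show ?thesis by (simp add: polydisc_def)
  qed
  define p where "p = 2 + \<beta>"
  define A where "A = (\<Prod>k\<in>-I. (1 - cmod (z0 $ k)) powr (- 2 - \<beta>))"
  have A: "A > 0" unfolding A_def
  proof (intro prod_pos ballI)
    fix k assume "k \<in> - I"
    then show "0 < (1 - cmod (z0 $ k)) powr (- 2 - \<beta>)" using z0less[of k] by simp
  qed
  \<comment> \<open>Only the coordinates in \<open>I\<close> approach the circle; the others keep a
    fixed distance and make up the constant \<open>A\<close>.\<close>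
  have PwA: "?P (w t) = A * (t powr (- p)) ^ card I" if t: "0 < t" "t < 1" for t
  proof -
    have "?P (w t) = (\<Prod>k\<in>I \<union> -I. (if k \<in> I then t else 1 - cmod (z0 $ k)) powr (- 2 - \<beta>))"
      unfolding wk[OF t] by simp
    also have "\<dots> = (\<Prod>k\<in>I. (if k \<in> I then t else 1 - cmod (z0 $ k)) powr (- 2 - \<beta>)) * (\<Prod>k\<in>-I. (if k \<in> I then t else 1 - cmod (z0 $ k)) powr (- 2 - \<beta>))"
      by (intro prod.union_disjoint) auto
    also have "\<dots> = (t powr (- p)) ^ card I * A" by (simp add: A_def p_def)
    finally show ?thesis by simp
  qed
  define L' where "L' = L * real CARD('n)"
  have L': "L' \<ge> 0" using L(1) by (simp add: L'_def)
  define F where "F t = test_function N \<beta> J (\<phi> z0) t" for t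
  have F: "F t \<in> ?A" "bergman_norm \<beta> (F t) \<le> R" if "0 < t" for t
    using R(2)[of J "\<phi> z0" t] that by (auto simp: F_def J_def)
  define c where "c = (1 / (1 + L') ^ (2 * N)) ^ card J"
  have c: "c > 0" using L' by (simp add: c_def)
  have lower: "c * (t powr (- p)) ^ card I \<le> (cmod (?T (F t) (w t)))\<^sup>2" if t: "0 < t" "t < 1" for t
  proof -
    have "(\<Sum>k\<in>UNIV. cmod (w t $ k - z0 $ k)) \<le> (\<Sum>k\<in>(UNIV::'n set). t)"
    proof (rule sum_mono)
      fix k
      show "cmod (w t $ k - z0 $ k) \<le> t"
      proof (cases "k \<in> I")
        case True
        then have "w t $ k - z0 $ k = - (of_real t * z0 $ k)" by (simp add: w_def algebra_simps)
        then show ?thesis using True t by (simp add: norm_mult I_def)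
      qed (use t in \<open>simp add: w_def\<close>)
    qed
    then have "L * (\<Sum>k\<in>UNIV. cmod (w t $ k - z0 $ k)) \<le> L' * t"
      using mult_left_mono[OF _ L(1)] by (fastforce simp: L'_def mult.assoc)
    moreover have "w t \<in> cpolydisc" using wp[OF t] polydisc_subset_cpolydisc by blast
    ultimately have "cmod (\<phi> (w t) $ i - \<phi> z0 $ i) \<le> L' * t" for i
      using L(2)[OF _ z0, of "w t" i] by linarith
    moreover have "\<phi> (w t) \<in> polydisc" using hol wp[OF t] by (auto simp: holomorphic_self_map_def)
    ultimately have "((1 / (1 + L') ^ (2 * N)) * t powr (- p)) ^ card J \<le> (cmod (F t (\<phi> (w t))))\<^sup>2"
      unfolding F_def p_def by (intro test_function_lower_bound t L') (auto simp: J_def)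
    moreover have "F t (\<phi> (w t)) = ?T (F t) (w t)" using wp[OF t] by (simp add: composition_operator_def)
    \<comment> \<open>This is where \<open>card I \<le> card J\<close> enters: lowering the exponent
      of a base that is at least 1 gives a lower bound.\<close>
    moreover have "1 \<le> t powr (- p)"
    proof -
      have "t powr p \<le> 1" using t b by (simp add: p_def powr_le1)
      then show ?thesis using t by (simp add: powr_minus field_simps)
    qed
    then have "c * (t powr (- p)) ^ card I \<le> c * (t powr (- p)) ^ card J"
      using c IJ by (intro mult_left_mono power_increasing) auto
    moreover have "c * (t powr (- p)) ^ card J = ((1 / (1 + L') ^ (2 * N)) * t powr (- p)) ^ card J"
      by (simp only: c_def power_mult_distrib)
    ultimately show ?thesis by simp
  qed
  \<comment> \<open>The shift by 2 keeps \<open>\<tau> n\<close> strictly below 1 from the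
    start.\<close>
  define \<tau> where "\<tau> n = 1 / (real n + 2)" for n :: nat
  have \<tau>: "0 < \<tau> n" "\<tau> n < 1" for n by (auto simp: \<tau>_def)
  have \<tau>0: "\<tau> \<longlonglongrightarrow> 0"
    using LIMSEQ_ignore_initial_segment[OF lim_1_over_n[where 'a = real], of 2]
    by (simp add: \<tau>_def[abs_def] add.commute)
  \<comment> \<open>Division by \<open>R\<close> moves the test functions into the unit ball, whose
    image is relatively compact.\<close>
  define \<sigma> where "\<sigma> n = ?T (\<lambda>z. of_real (1 / R) * F (\<tau> n) z)" for n
  interpret M: Metric_space ?A "\<lambda>f g. bergman_norm \<beta> (\<lambda>z. f z - g z)" by (rule Metric_space_bergman[OF b])
  let ?B = "{f \<in> ?A. bergman_norm \<beta> f \<le> 1}"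
  have TA: "?T ` ?A \<subseteq> ?A" using comp by (simp add: compact_operator_def)
  have cpt: "compactin M.mtopology (M.mtopology closure_of (?T ` ?B))"
    using comp by (simp add: compact_operator_def norm_topology_def)
  have inB: "(\<lambda>z. of_real (1 / R) * F (\<tau> n) z) \<in> ?B" for n
  proof -
    have "bergman_norm \<beta> (\<lambda>z. of_real (1 / R) * F (\<tau> n) z) = 1 / R * bergman_norm \<beta> (F (\<tau> n))"
      unfolding bergman_norm_cmult using R(1) by (simp only: norm_of_real) simp
    also have "\<dots> \<le> 1 / R * R" using R(1) F(2)[OF \<tau>(1)] by (intro mult_left_mono) auto
    finally have "bergman_norm \<beta> (\<lambda>z. of_real (1 / R) * F (\<tau> n) z) \<le> 1" using R(1) by simp
    moreover have "(\<lambda>z. of_real (1 / R) * F (\<tau> n) z) \<in> ?A"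
      using bergman_space_lincomb[of "F (\<tau> n)" \<beta> "F (\<tau> n)" "of_real (1 / R)" 0] F(1)[OF \<tau>(1)] by simp
    ultimately show ?thesis by simp
  qed
  have "range \<sigma> \<subseteq> ?T ` ?B" using inB by (auto simp: \<sigma>_def)
  also have "\<dots> \<subseteq> M.mtopology closure_of (?T ` ?B)" using TA by (intro closure_of_subset) auto
  finally obtain l r where r: "strict_mono (r :: nat \<Rightarrow> nat)" and lim: "limitin M.mtopology (\<sigma> \<circ> r) l sequentially"
    using cpt unfolding M.compactin_sequentially by blast
  have l: "l \<in> ?A" using M.limitin_mspace[OF lim] .
  define h where "h n = (\<lambda>z. \<sigma> (r n) z - l z)" for n
  have \<sigma>A: "\<sigma> n \<in> ?A" for n using TA inB[of n] by (auto simp: \<sigma>_def)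
  have hA: "h n \<in> ?A" for n unfolding h_def by (intro bergman_space_diff \<sigma>A l)
  have hlim: "(\<lambda>n. bergman_norm \<beta> (h n)) \<longlonglongrightarrow> 0"
  proof (rule LIMSEQ_I)
    fix e :: real assume "e > 0"
    then have "\<exists>N. \<forall>n\<ge>N. (\<sigma> \<circ> r) n \<in> ?A \<and> bergman_norm \<beta> (\<lambda>z. (\<sigma> \<circ> r) n z - l z) < e"
      using lim unfolding M.limitin_metric eventually_sequentially by blast
    then obtain N where "\<forall>n\<ge>N. bergman_norm \<beta> (h n) < e" unfolding h_def comp_def by blast
    then show "\<exists>N. \<forall>n\<ge>N. norm (bergman_norm \<beta> (h n) - 0) < e"
      by (intro exI[of _ N]) (simp add: bergman_norm_nonneg)
  qed
  have rlim: "(\<lambda>n. \<tau> (r n)) \<longlonglongrightarrow> 0"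
    using LIMSEQ_subseq_LIMSEQ[OF \<tau>0 r] by (simp add: o_def)
  have masslim: "(\<lambda>n. mass l (w (\<tau> (r n)))) \<longlonglongrightarrow> 0"
  proof -
    note [measurable] = bergman_spaceD(3)[OF l]
    have "(\<lambda>n. \<integral>\<^sup>+z. indicator (whitney (w (\<tau> (r n)))) z * ennreal ((cmod (l z))\<^sup>2) \<partial>?V) \<longlonglongrightarrow> (\<integral>\<^sup>+z. 0 \<partial>?V)"
    proof (rule nn_integral_dominated_convergence[where w = "\<lambda>z. ennreal ((cmod (l z))\<^sup>2)"])
      show "(\<integral>\<^sup>+z. ennreal ((cmod (l z))\<^sup>2) \<partial>?V) < \<infinity>" by (simp add: bergman_norm_nn_integral[OF l])
      \<comment> \<open>Points of the box satisfy
        \<open>1 - cmod (z $ k1) < 3 / 2 * \<tau> (r n)\<close>, so a fixed \<open>z\<close> is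
        eventually excluded.\<close>
      have "(\<lambda>n. indicator (whitney (w (\<tau> (r n)))) z * ennreal ((cmod (l z))\<^sup>2)) \<longlonglongrightarrow> 0" if z: "z \<in> polydisc" for z
      proof (rule tendsto_eventually)
        have "0 < 2 / 3 * (1 - cmod (z $ k1))" using z by (simp add: polydisc_def)
        from order_tendstoD(2)[OF rlim this]
        show "\<forall>\<^sub>F n in sequentially. indicator (whitney (w (\<tau> (r n)))) z * ennreal ((cmod (l z))\<^sup>2) = 0"
        proof eventually_elim
          case (elim n)
          have "z \<notin> whitney (w (\<tau> (r n)))"
          proof
            assume "z \<in> whitney (w (\<tau> (r n)))"
            from whitney_bounds(2)[OF this, of k1] show False
              using elim unfolding wk[OF \<tau>] using k1 by simp
          qed
          then show ?case by simp
        qed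
      qed
      then show "AE z in ?V. (\<lambda>n. indicator (whitney (w (\<tau> (r n)))) z * ennreal ((cmod (l z))\<^sup>2)) \<longlonglongrightarrow> 0"
        by (intro AE_mp[OF AE_polydisc[OF b] AE_I2]) simp
    qed (auto simp: indicator_def)
    then have "(\<lambda>n. ennreal (mass l (w (\<tau> (r n))))) \<longlonglongrightarrow> ennreal 0"
      by (simp add: mass(1)[OF l])
    then show ?thesis using mass0 by (subst (asm) tendsto_ennreal_iff) auto
  qed
  have bound: "c / R\<^sup>2 \<le> 2 * C * A * (mass l (w (\<tau> (r n))) + (bergman_norm \<beta> (h n))\<^sup>2)" for n
  proof -
    define t where "t = \<tau> (r n)"
    have t: "0 < t" "t < 1" using \<tau> by (auto simp: t_def)
    let ?y = "(t powr (- p)) ^ card I"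
    have y: "?y > 0" using t by simp
    have "\<sigma> (r n) (w t) = of_real (1 / R) * ?T (F t) (w t)"
      by (simp add: \<sigma>_def t_def composition_operator_def)
    then have "(cmod (\<sigma> (r n) (w t)))\<^sup>2 = (cmod (?T (F t) (w t)))\<^sup>2 / R\<^sup>2"
      by (simp add: norm_divide power_divide)
    then have "c * ?y / R\<^sup>2 \<le> (cmod (\<sigma> (r n) (w t)))\<^sup>2"
      using lower[OF t] R(1) by (simp add: divide_right_mono)
    also have "\<sigma> (r n) (w t) = l (w t) + h n (w t)" by (simp add: h_def)
    also have "(cmod (l (w t) + h n (w t)))\<^sup>2 \<le> 2 * (cmod (l (w t)))\<^sup>2 + 2 * (cmod (h n (w t)))\<^sup>2"
    proof -
      have "(cmod (l (w t) + h n (w t)))\<^sup>2 \<le> (cmod (l (w t)) + cmod (h n (w t)))\<^sup>2"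
        by (intro power_mono norm_triangle_ineq) auto
      also have "\<dots> \<le> 2 * (cmod (l (w t)))\<^sup>2 + 2 * (cmod (h n (w t)))\<^sup>2"
        using sum_squares_bound[of "cmod (l (w t))" "cmod (h n (w t))"] by (simp add: power2_sum)
      finally show ?thesis .
    qed
    also have "\<dots> \<le> 2 * (C * ?P (w t) * mass l (w t)) + 2 * (C * ?P (w t) * (bergman_norm \<beta> (h n))\<^sup>2)"
    proof -
      have "0 \<le> C * ?P (w t)" using C(1) by (intro mult_nonneg_nonneg prod_nonneg) auto
      then have "C * ?P (w t) * mass (h n) (w t) \<le> C * ?P (w t) * (bergman_norm \<beta> (h n))\<^sup>2"
        by (intro mult_left_mono mass(2) hA)
      then show ?thesis using growth[OF l wp[OF t]] growth[OF hA wp[OF t], of n] by simp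
    qed
    also have "\<dots> = 2 * C * A * (mass l (w t) + (bergman_norm \<beta> (h n))\<^sup>2) * ?y"
      unfolding PwA[OF t] by (simp add: algebra_simps)
    finally have "c / R\<^sup>2 * ?y \<le> 2 * C * A * (mass l (w t) + (bergman_norm \<beta> (h n))\<^sup>2) * ?y" by simp
    \<comment> \<open>The common power of \<open>t\<close> cancels, which leaves a positive constant
      below a null sequence.\<close>
    then show ?thesis using y unfolding t_def by (simp only: mult_le_cancel_right_pos)
  qed
  have "(\<lambda>n. 2 * C * A * (mass l (w (\<tau> (r n))) + (bergman_norm \<beta> (h n))\<^sup>2)) \<longlonglongrightarrow> 2 * C * A * (0 + 0\<^sup>2)"
    by (intro tendsto_intros masslim hlim)
  from tendsto_lowerbound[OF this always_eventually[OF allI[OF bound]]]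
  have "c / R\<^sup>2 \<le> 0" by simp
  then show False using c R(1) by (simp add: divide_le_0_iff)
qed

text \<open>In the closed polydisc, \<open>torus_stratum j\<close> consists of the points with at
  least \<open>j\<close> unimodular coordinates, so lying off \<open>torus_stratum (j + 1)\<close>
  means having at most \<open>j\<close>. The choice \<open>j = num_unimodular (\<phi> z)\<close>
  then turns the disjointness conditions into one strict inequality.\<close>

lemma num_unimodular_decreases_iff:
  fixes \<phi> :: "complex ^ 'n \<Rightarrow> complex ^ 'n"
  assumes "\<phi> ` cpolydisc \<subseteq> cpolydisc"
  shows "(\<forall>j\<in>{1..CARD('n)}. \<phi> ` (cpolydisc - torus_stratum (j + 1)) \<inter> torus_stratum j = {}) \<longleftrightarrow>
    (\<forall>z\<in>cpolydisc. num_unimodular (\<phi> z) > 0 \<longrightarrow> num_unimodular (\<phi> z) < num_unimodular z)"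
proof -
  have strat: "z \<in> torus_stratum j \<longleftrightarrow> j \<le> num_unimodular z" if "z \<in> cpolydisc" for z :: "complex ^ 'n" and j
  proof
    assume "z \<in> torus_stratum j"
    then obtain I where "card I = j" "I \<subseteq> {k. cmod (z $ k) = 1}" by (auto simp: torus_stratum_def)
    then show "j \<le> num_unimodular z" unfolding num_unimodular_def by (metis card_mono finite)
  next
    assume "j \<le> num_unimodular z"
    then obtain I where "I \<subseteq> {k. cmod (z $ k) = 1}" "card I = j"
      unfolding num_unimodular_def using obtain_subset_with_card_n by metis
    then show "z \<in> torus_stratum j" using that by (auto simp: torus_stratum_def)
  qed
  show ?thesis
  proof (intro iffI ballI impI)
    fix z :: "complex ^ 'n"
    assume *: "\<forall>j\<in>{1..CARD('n)}. \<phi> ` (cpolydisc - torus_stratum (j + 1)) \<inter> torus_stratum j = {}"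
      and z: "z \<in> cpolydisc" and pos: "num_unimodular (\<phi> z) > 0"
    show "num_unimodular (\<phi> z) < num_unimodular z"
    proof (rule ccontr)
      assume "\<not> ?thesis"
      then have "z \<notin> torus_stratum (num_unimodular (\<phi> z) + 1)" using strat[OF z] by simp
      moreover have "\<phi> z \<in> torus_stratum (num_unimodular (\<phi> z))" using strat[of "\<phi> z"] assms z by auto
      moreover have "num_unimodular (\<phi> z) \<in> {1..CARD('n)}"
        using pos by (auto simp: num_unimodular_def intro: card_mono)
      ultimately show False using * z by blast
    qed
  next
    fix j
    assume *: "\<forall>z\<in>cpolydisc. num_unimodular (\<phi> z) > 0 \<longrightarrow> num_unimodular (\<phi> z) < num_unimodular z"
      and j: "j \<in> {1..CARD('n)}"
    show "\<phi> ` (cpolydisc - torus_stratum (j + 1)) \<inter> torus_stratum j = {}"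
    proof (rule ccontr)
      assume "\<not> ?thesis"
      then obtain z where z: "z \<in> cpolydisc" "z \<notin> torus_stratum (j + 1)" "\<phi> z \<in> torus_stratum j" by auto
      then have "num_unimodular z \<le> j" "j \<le> num_unimodular (\<phi> z)"
        using strat[of z] strat[of "\<phi> z"] assms by auto
      then show False using * z(1) j by force
    qed
  qed
qed

lemma self_map_closed_polydisc:
  assumes "holomorphic_self_map \<phi>" "C1_closed_polydisc \<phi>"
  shows "\<phi> ` cpolydisc \<subseteq> cpolydisc"
proof -
  obtain g where g: "\<And>i. C1_disc_function (\<lambda>w. \<phi> w $ i) (g i)"
    using C1_disc_function_components[OF assms] by blast
  show ?thesis using C1_disc_function.cbound[OF g] by (auto simp: cpolydisc_def)
qed

theorem theorem1p2:
  fixes \<phi> :: "complex ^ 'n \<Rightarrow> complex ^ 'n" and \<beta> :: real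
  assumes "2 \<le> CARD('n)"
    and "holomorphic_self_map \<phi>"
    and "C1_closed_polydisc \<phi>"
    and "real CARD('n) - 3 < \<beta>"
  shows "compact_operator (bergman_space \<beta>) (bergman_norm \<beta>) (composition_operator \<phi>) \<longleftrightarrow>
         (\<forall>j\<in>{1..CARD('n)}. \<phi> ` (cpolydisc - torus_stratum (j + 1)) \<inter> torus_stratum j = {})"
proof -
  \<comment> \<open>For d \<ge> 2 the bound \<beta> > d - 3 contains \<beta> > -1.\<close>
  have b: "\<beta> > -1" using assms(1,4) by simp
  note dec = num_unimodular_decreases_iff[OF self_map_closed_polydisc[OF assms(2,3)]]
  show ?thesis
    unfolding dec
  proof (intro iffI ballI impI)
    fix z
    assume "compact_operator (bergman_space \<beta>) (bergman_norm \<beta>) (composition_operator \<phi>)"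
      and "z \<in> cpolydisc" "num_unimodular (\<phi> z) > 0"
    then show "num_unimodular (\<phi> z) < num_unimodular z"
      by (rule num_unimodular_decreases_if_compact[OF b assms(2,3)])
  next
    assume *: "\<forall>z\<in>cpolydisc. num_unimodular (\<phi> z) > 0 \<longrightarrow> num_unimodular (\<phi> z) < num_unimodular z"
    show "compact_operator (bergman_space \<beta>) (bergman_norm \<beta>) (composition_operator \<phi>)"
      using * by (intro compact_operator_if_vanishing[OF b assms(2)] vanishing_carleson[OF assms(2,3) b assms(4)]) auto
  qed
qed

end
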